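(* Let $\mathcal{V}$ be a van Emde Boas tree over the universe $\mathcal{U}=[0,U)$ and let $B\subseteq\mathcal{V}$ be a batch of $m$ keys present in $\mathcal{V}$, given in sorted order. Deleting all keys of $B$ from $\mathcal{V}$ can be done in parallel in $O(m\log\log U)$ work and $O(\log U\log\log U)$ span.
   Context: A van Emde Boas (vEB) tree $\mathcal{V}$ over $[0,2^w)$ is a quadruple $(\mathit{summary},\mathit{cluster}[\cdot],\mathit{min},\mathit{max})$: $\mathit{min},\mathit{max}$ store the minimum and maximum keys ($+\infty$, $-\infty$ when empty); each other key $x$ is split into high bits $\lfloor x/2^{\lceil w/2\rceil}\rfloor$ and low bits $x\bmod 2^{\lceil w/2\rceil}$; distinct high bits are stored recursively in the vEB tree $\mathit{summary}$ and low bits of keys with high bits $h$ recursively in the vEB tree $\mathit{cluster}[h]$; $\mathit{min}$ and $\mathit{max}$ are not stored again in the summary or clusters. After deletion the tree must satisfy this structure with key set $\mathcal{V}\setminus B$. Model: binary-forking work-span model (work = total operations, span = longest chain of sequentially dependent operations). *)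

theory Defs
  imports Complex_Main "HOL-Library.Disjoint_Sets"
begin

datatype key = MInf | Key int | PInf

text \<open>Universes of width at most 1 are the base case: there \<open>min\<close> and \<open>max\<close> already hold every key,
  so no summary and clusters are kept.\<close>

datatype veb =
    Leaf (vmin: key) (vmax: key)
  | Node (summary: veb) (cluster: "int \<Rightarrow> veb") (vmin: key) (vmax: key)

definition min_key :: "int set \<Rightarrow> key" where
  "min_key K = (if K = {} then PInf else Key (Min K))"

definition max_key :: "int set \<Rightarrow> key" where
  "max_key K = (if K = {} then MInf else Key (Max K))"

definition low_bits :: "nat \<Rightarrow> nat" where "low_bits w = (w + 1) div 2"
definition high_bits :: "nat \<Rightarrow> nat" where "high_bits w = w div 2"

definition high :: "nat \<Rightarrow> int \<Rightarrow> int" where "high w x = x div 2 ^ low_bits w"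
definition low :: "nat \<Rightarrow> int \<Rightarrow> int" where "low w x = x mod 2 ^ low_bits w"

text \<open>\<open>inner_keys K\<close>: the keys that are passed on to summary and clusters.\<close>

definition inner_keys :: "int set \<Rightarrow> int set" where
  "inner_keys K = {x \<in> K. Key x \<noteq> min_key K \<and> Key x \<noteq> max_key K}"

text \<open>\<open>is_veb t w K\<close>: \<open>t\<close> is a vEB tree over the universe \<open>[0, 2^w)\<close> with key set \<open>K\<close>.\<close>

primrec is_veb :: "veb \<Rightarrow> nat \<Rightarrow> int set \<Rightarrow> bool" where
  "is_veb (Leaf mn mx) w K \<longleftrightarrow>
     w \<le> 1 \<and> K \<subseteq> {0..<2 ^ w} \<and> mn = min_key K \<and> mx = max_key K"
| "is_veb (Node s c mn mx) w K \<longleftrightarrow>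
     w \<ge> 2 \<and> K \<subseteq> {0..<2 ^ w} \<and> mn = min_key K \<and> mx = max_key K \<and>
     is_veb s (high_bits w) (high w ` inner_keys K) \<and>
     (\<forall>h\<in>{0..<2 ^ high_bits w}.
        is_veb (c h) (low_bits w) (low w ` {x \<in> inner_keys K. high w x = h}))"

text \<open>
  The binary-forking model on a word RAM.  Programs are finite lists of (possibly recursive) first-order procedures over a shared random-access
  memory.  All registers and memory words hold integers in \<open>[-2^L, 2^L)\<close>; an operation whose
  result leaves this range has no execution, so large numbers cannot be used to pack data.
\<close>

type_synonym name = string
type_synonym env = "name \<Rightarrow> int option"
type_synonym mem = "int \<Rightarrow> int"

datatype binop = Add | Sub | Mul | Div | Mod | Shl | Less | Equ

datatype exp = Lit int | Var name | Bin binop exp exp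

datatype com =
    Ret exp
  | Read exp
  | Write exp exp
  | Bind name com com
  | Cond exp com com
  | Call name "exp list"
  | Fork name com name com com

type_synonym prog = "(name \<times> name list \<times> com) list"

definition is_word :: "nat \<Rightarrow> int \<Rightarrow> bool" where
  "is_word L i \<longleftrightarrow> - (2 ^ L) \<le> i \<and> i < 2 ^ L"

fun binop_val :: "binop \<Rightarrow> int \<Rightarrow> int \<Rightarrow> int" where
  "binop_val Add i j = i + j"
| "binop_val Sub i j = i - j"
| "binop_val Mul i j = i * j"
| "binop_val Div i j = i div j"
| "binop_val Mod i j = i mod j"
| "binop_val Shl i j = i * 2 ^ nat j"
| "binop_val Less i j = (if i < j then 1 else 0)"
| "binop_val Equ i j = (if i = j then 1 else 0)"

definition word_result :: "nat \<Rightarrow> int \<Rightarrow> int option" where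
  "word_result L i = (if is_word L i then Some i else None)"

fun exp_val :: "nat \<Rightarrow> env \<Rightarrow> exp \<Rightarrow> int option" where
  "exp_val L \<rho> (Lit i) = word_result L i"
| "exp_val L \<rho> (Var x) = \<rho> x"
| "exp_val L \<rho> (Bin op e1 e2) =
     (case (exp_val L \<rho> e1, exp_val L \<rho> e2) of
        (Some i, Some j) \<Rightarrow> word_result L (binop_val op i j)
      | _ \<Rightarrow> None)"

fun exp_cost :: "exp \<Rightarrow> nat" where
  "exp_cost (Lit i) = 1"
| "exp_cost (Var x) = 1"
| "exp_cost (Bin op e1 e2) = 1 + exp_cost e1 + exp_cost e2"

text \<open>
  \<open>exec L P \<rho> t M (v, M', A, W, work, span)\<close>: started in memory \<open>M\<close>, command \<open>t\<close> terminates with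
  result \<open>v\<close> and memory \<open>M'\<close>, having accessed (read or written) the cells \<open>A\<close> and written the
  cells \<open>W\<close>.

  \<open>Fork x t1 y t2 t\<close> runs \<open>t1\<close> and \<open>t2\<close> in parallel, joins, and continues with \<open>t\<close>, the two
  results being bound to \<open>x\<close> and \<open>y\<close>.  Both branches start from the memory at the fork, and no
  cell written by one may be accessed by the other.  Hence no information flows between them, the
  joint memory does not depend on the scheduling, and the semantics is deterministic; concurrent
  reads are allowed.
\<close>

inductive exec ::
  "nat \<Rightarrow> prog \<Rightarrow> env \<Rightarrow> com \<Rightarrow> mem \<Rightarrow> int \<times> mem \<times> int set \<times> int set \<times> nat \<times> nat \<Rightarrow> bool"
  for L :: nat and P :: prog
where
  Ret: "exp_val L \<rho> e = Some v \<Longrightarrow>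
    exec L P \<rho> (Ret e) M (v, M, {}, {}, 1 + exp_cost e, 1 + exp_cost e)"
| Read: "exp_val L \<rho> e = Some i \<Longrightarrow> 0 \<le> i \<Longrightarrow> is_word L (M i) \<Longrightarrow>
    exec L P \<rho> (Read e) M (M i, M, {i}, {}, 1 + exp_cost e, 1 + exp_cost e)"
| Write: "exp_val L \<rho> e1 = Some i \<Longrightarrow> 0 \<le> i \<Longrightarrow> exp_val L \<rho> e2 = Some v \<Longrightarrow>
    exec L P \<rho> (Write e1 e2) M
      (v, M(i := v), {i}, {i}, 1 + exp_cost e1 + exp_cost e2, 1 + exp_cost e1 + exp_cost e2)"
| Bind: "exec L P \<rho> t1 M (v1, M1, A1, W1, c1, s1) \<Longrightarrow>
    exec L P (\<rho>(x \<mapsto> v1)) t2 M1 (v2, M2, A2, W2, c2, s2) \<Longrightarrow>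
    exec L P \<rho> (Bind x t1 t2) M (v2, M2, A1 \<union> A2, W1 \<union> W2, 1 + c1 + c2, 1 + s1 + s2)"
| Cond_True: "exp_val L \<rho> e = Some i \<Longrightarrow> i \<noteq> 0 \<Longrightarrow>
    exec L P \<rho> t1 M (v, M', A, W, c, s) \<Longrightarrow>
    exec L P \<rho> (Cond e t1 t2) M (v, M', A, W, 1 + exp_cost e + c, 1 + exp_cost e + s)"
| Cond_False: "exp_val L \<rho> e = Some 0 \<Longrightarrow>
    exec L P \<rho> t2 M (v, M', A, W, c, s) \<Longrightarrow>
    exec L P \<rho> (Cond e t1 t2) M (v, M', A, W, 1 + exp_cost e + c, 1 + exp_cost e + s)"
| Call: "map_of P p = Some (xs, t) \<Longrightarrow> length xs = length es \<Longrightarrow>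
    map (exp_val L \<rho>) es = map Some vs \<Longrightarrow>
    exec L P (map_of (zip xs vs)) t M (v, M', A, W, c, s) \<Longrightarrow>
    exec L P \<rho> (Call p es) M
      (v, M', A, W, 1 + sum_list (map exp_cost es) + c, 1 + sum_list (map exp_cost es) + s)"
| Fork: "exec L P \<rho> t1 M (v1, M1, A1, W1, c1, s1) \<Longrightarrow>
    exec L P \<rho> t2 M (v2, M2, A2, W2, c2, s2) \<Longrightarrow>
    W1 \<inter> A2 = {} \<Longrightarrow> W2 \<inter> A1 = {} \<Longrightarrow>
    exec L P (\<rho>(x \<mapsto> v1, y \<mapsto> v2)) t (override_on M2 M1 W1) (v, M', A, W, c, s) \<Longrightarrow>
    exec L P \<rho> (Fork x t1 y t2 t) M
      (v, M', A1 \<union> A2 \<union> A, W1 \<union> W2 \<union> W, 1 + c1 + c2 + c, 1 + max s1 s2 + s)"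

text \<open>In a node of width \<open>w\<close>, the infinities are represented by the numbers \<open>-1\<close> and \<open>2^w\<close> just
  outside its universe.\<close>

fun encode :: "nat \<Rightarrow> key \<Rightarrow> int" where
  "encode w MInf = -1"
| "encode w (Key x) = x"
| "encode w PInf = 2 ^ w"

text \<open>
  \<open>stored M t w a F\<close>: memory \<open>M\<close> holds the tree \<open>t\<close> of width \<open>w\<close> at address \<open>a\<close>, occupying
  exactly the cells \<open>F\<close>.  A leaf consists of the cells \<open>min, max\<close>; an inner node consists of the
  cells \<open>min, max\<close>, a pointer to the summary and a pointer to an array of pointers to the clusters.
  All parts occupy disjoint cells.
\<close>

primrec stored :: "mem \<Rightarrow> veb \<Rightarrow> nat \<Rightarrow> int \<Rightarrow> int set \<Rightarrow> bool" where
  "stored M (Leaf mn mx) w a F \<longleftrightarrow>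
     M a = encode w mn \<and> M (a + 1) = encode w mx \<and> F = {a, a + 1}"
| "stored M (Node s c mn mx) w a F \<longleftrightarrow>
     M a = encode w mn \<and> M (a + 1) = encode w mx \<and>
     (\<exists>Fs Fc.
        let H = {0..<2 ^ high_bits w};
            header = {a..<a + 4};
            table = {M (a + 3)..<M (a + 3) + 2 ^ high_bits w}
        in stored M s (high_bits w) (M (a + 2)) Fs \<and>
           (\<forall>h\<in>H. stored M (c h) (low_bits w) (M (M (a + 3) + h)) (Fc h)) \<and>
           header \<inter> table = {} \<and>
           Fs \<inter> (header \<union> table) = {} \<and>
           (\<forall>h\<in>H. Fc h \<inter> (header \<union> table \<union> Fs) = {}) \<and>
           disjoint_family_on Fc H \<and>
           F = header \<union> table \<union> Fs \<union> (\<Union>h\<in>H. Fc h))"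

definition array_at :: "mem \<Rightarrow> int \<Rightarrow> int list \<Rightarrow> bool" where
  "array_at M b xs \<longleftrightarrow> (\<forall>i<length xs. M (b + int i) = xs ! i)"

end

theory Submission
  imports Defs
begin

text \<open>
  At a node the batch \<open>X\<close>, stripped of minimum and maximum, is split into groups of keys with equal
  high bits.  The groups are deleted from their clusters in parallel; the high bits of the emptied
  clusters are then packed into an array and deleted from the summary.  A deleted minimum or maximum
  is replaced afterwards by the smallest or largest inner key, which is removed by the same procedure
  with a batch of size one.  So every key of the batch accounts for at most one key at the levels
  below.

  Work: let \<open>T(n)\<close> bound the work for \<open>n\<close> keys at a node with \<open>d\<close> levels.  Minimum and maximum
  are not passed on, so emptying a tree costs only \<open>c (n - 1) d + O(1)\<close>, while the general bound is
  \<open>T(n) = c n d\<close>.  The saving of \<open>c d\<close> for each emptied cluster pays for its entry in the batch for the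
  summary, and each level adds only \<open>O(n)\<close>.

  Span: the clusters and then the summary give the recurrence
  \<open>S(w) = S(w / 2) + S(w / 2) + O(w)\<close>, where \<open>O(w)\<close> comes from the parallel loops; the batches of size
  one take only \<open>O(log w)\<close> time each, because their span is at most their work.
\<close>

section \<open>Reasoning about programs\<close>

text \<open>The model has no allocator, words are bounded, and parallel branches must not touch each
  other's written cells. So every call receives a preassigned scratch region whose parts are
  addressed by high bits: cluster \<open>h\<close> has its own slice. The region is polynomial in
  \<open>2^w\<close>, far larger than the batch, and is never initialised. The work still depends
  only on the batch, because a table cell is read only after the same call has written it.

  Each deletion returns a flag telling whether its tree became empty. The loop over the groups adds
  up these flags and keeps the partial sums at its split points, so the heads of emptied clusters
  can be packed without a separate prefix-sum pass.

  Constants: the budget is \<open>3000\<close> per key and level. At one level \<open>inner\<close>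
  spends at most \<open>1500\<close> per key, and an extraction, which is one call of
  \<open>inner\<close> plus a few reads, at most \<open>1700\<close>. What is left absorbs the
  constant overhead of a node. Only when a tree is emptied by deleting its single key is there no
  such slack, and this is the origin of the extra \<open>500\<close> in
  \<open>work_ok\<close>.\<close>

definition run ::
  "nat \<Rightarrow> prog \<Rightarrow> int set \<Rightarrow> int set \<Rightarrow> env \<Rightarrow> com \<Rightarrow> mem \<Rightarrow> (int \<Rightarrow> mem \<Rightarrow> nat \<Rightarrow> nat \<Rightarrow> bool) \<Rightarrow> bool" where
  "run L P R X \<rho> t M Q \<longleftrightarrow>
     (\<exists>v M' A W c s. exec L P \<rho> t M (v, M', A, W, c, s) \<and> A \<subseteq> R \<and> W \<subseteq> X \<and> Q v M' c s)"

text \<open>The rules for consequence, sequencing and forks hand both facts on. In particular a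
  postcondition may bound the work alone; the span bound then comes for free, which is how
  extractions are treated.\<close>

lemma exec_frame:
  assumes "exec L P \<rho> t M r"
  shows "case r of (v, M', A, W, c, s) \<Rightarrow> (\<forall>x. x \<notin> W \<longrightarrow> M' x = M x) \<and> s \<le> c"
  using assms by induction (auto simp: override_on_def)

lemma runE:
  assumes "run L P R X \<rho> t M Q"
  obtains v M' A W c s where "exec L P \<rho> t M (v, M', A, W, c, s)" "A \<subseteq> R" "W \<subseteq> X" "Q v M' c s"
    "\<And>x. x \<notin> W \<Longrightarrow> M' x = M x" "s \<le> c"
  using assms exec_frame unfolding run_def by fastforce

lemma run_conseq:
  assumes "run L P R X \<rho> t M Q" "R \<subseteq> R'" "X \<subseteq> X'"
    and "\<And>v M' c s. \<lbrakk>Q v M' c s; \<And>x. x \<notin> X \<Longrightarrow> M' x = M x; s \<le> c\<rbrakk> \<Longrightarrow> Q' v M' c s"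
  shows "run L P R' X' \<rho> t M Q'"
  using assms(1)
proof (rule runE)
  fix v M' A W c s
  assume *: "exec L P \<rho> t M (v, M', A, W, c, s)" "A \<subseteq> R" "W \<subseteq> X" "Q v M' c s"
    "\<And>x. x \<notin> W \<Longrightarrow> M' x = M x" "s \<le> c"
  then have "Q' v M' c s" using assms(4) by blast
  with * assms(2,3) show ?thesis unfolding run_def by blast
qed

lemma run_Ret:
  assumes "exp_val L \<rho> e = Some v" "Q v M (1 + exp_cost e) (1 + exp_cost e)"
  shows "run L P R X \<rho> (Ret e) M Q"
  using exec.Ret[OF assms(1)] assms(2) unfolding run_def by blast

lemma run_Read:
  assumes "exp_val L \<rho> e = Some i" "0 \<le> i" "is_word L (M i)" "i \<in> R"
    "Q (M i) M (1 + exp_cost e) (1 + exp_cost e)"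
  shows "run L P R X \<rho> (Read e) M Q"
  using exec.Read[of L \<rho> e i M P] assms unfolding run_def by blast

lemma run_Write:
  assumes "exp_val L \<rho> e1 = Some i" "0 \<le> i" "exp_val L \<rho> e2 = Some v" "i \<in> R" "i \<in> X"
    "Q v (M(i := v)) (1 + exp_cost e1 + exp_cost e2) (1 + exp_cost e1 + exp_cost e2)"
  shows "run L P R X \<rho> (Write e1 e2) M Q"
  using exec.Write[OF assms(1,2,3), of P M] assms(4-) unfolding run_def by blast

lemma run_Bind:
  assumes "run L P R X \<rho> t1 M N"
    and "\<And>v M1 c s. \<lbrakk>N v M1 c s; \<And>x. x \<notin> X \<Longrightarrow> M1 x = M x; s \<le> c\<rbrakk> \<Longrightarrow>
      run L P R X (\<rho>(x \<mapsto> v)) t2 M1 (\<lambda>v' M' c' s'. Q v' M' (1 + c + c') (1 + s + s'))"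
  shows "run L P R X \<rho> (Bind x t1 t2) M Q"
  using assms(1)
proof (rule runE)
  fix v M' A W c s
  assume *: "exec L P \<rho> t1 M (v, M', A, W, c, s)" "A \<subseteq> R" "W \<subseteq> X" "N v M' c s"
    "\<And>x. x \<notin> W \<Longrightarrow> M' x = M x" "s \<le> c"
  then have "run L P R X (\<rho>(x \<mapsto> v)) t2 M' (\<lambda>v' M' c' s'. Q v' M' (1 + c + c') (1 + s + s'))"
    using assms(2) by blast
  then show ?thesis
  proof (rule runE)
    fix v2 M2 A2 W2 c2 s2
    assume **: "exec L P (\<rho>(x \<mapsto> v)) t2 M' (v2, M2, A2, W2, c2, s2)" "A2 \<subseteq> R" "W2 \<subseteq> X"
      "Q v2 M2 (1 + c + c2) (1 + s + s2)"
    show ?thesis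
      unfolding run_def using exec.Bind[OF *(1) **(1)] *(2,3) **(2-) by blast
  qed
qed

lemma run_Bind_Ret:
  assumes "exp_val L \<rho> e = Some v"
    "run L P R X (\<rho>(x \<mapsto> v)) t M (\<lambda>v' M' c s. Q v' M' (2 + exp_cost e + c) (2 + exp_cost e + s))"
  shows "run L P R X \<rho> (Bind x (Ret e) t) M Q"
  by (rule run_Bind[OF run_Ret[where Q="\<lambda>r M' c s. r = v \<and> M' = M \<and> c = 1 + exp_cost e \<and> s = c"]])
    (use assms in auto)

lemma run_Bind_Read:
  assumes "exp_val L \<rho> e = Some i" "0 \<le> i" "is_word L v" "i \<in> R" "M i = v"
    "run L P R X (\<rho>(x \<mapsto> v)) t M (\<lambda>v' M' c s. Q v' M' (2 + exp_cost e + c) (2 + exp_cost e + s))"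
  shows "run L P R X \<rho> (Bind x (Read e) t) M Q"
  by (rule run_Bind[OF run_Read[where Q="\<lambda>r M' c s. r = v \<and> M' = M \<and> c = 1 + exp_cost e \<and> s = c"]])
    (use assms in auto)

lemma run_Cond:
  assumes "exp_val L \<rho> e = Some i"
    and "i \<noteq> 0 \<Longrightarrow> run L P R X \<rho> t1 M (\<lambda>v M' c s. Q v M' (1 + exp_cost e + c) (1 + exp_cost e + s))"
    and "i = 0 \<Longrightarrow> run L P R X \<rho> t2 M (\<lambda>v M' c s. Q v M' (1 + exp_cost e + c) (1 + exp_cost e + s))"
  shows "run L P R X \<rho> (Cond e t1 t2) M Q"
proof (cases "i = 0")
  case True
  with assms show ?thesis unfolding run_def by (metis exec.Cond_False)
next
  case False
  with assms show ?thesis unfolding run_def by (metis exec.Cond_True)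
qed

lemma run_Call:
  assumes "map_of P p = Some (xs, t)" "length xs = length es"
    "map (exp_val L \<rho>) es = map Some vs"
    "run L P R X (map_of (zip xs vs)) t M
      (\<lambda>v M' c s. Q v M' (1 + sum_list (map exp_cost es) + c) (1 + sum_list (map exp_cost es) + s))"
  shows "run L P R X \<rho> (Call p es) M Q"
  using assms(4) exec.Call[OF assms(1,2,3)] unfolding run_def by blast

text \<open>The joint memory depends on the exact write set of the first branch, which a
  specification does not name. Since \<open>X1\<close> and \<open>X2\<close> are disjoint, a cell of
  \<open>X1\<close> left unwritten by the first branch is unchanged by the second one too, so the
  upper bounds suffice to describe the result.\<close>

lemma run_Fork:
  assumes "run L P R1 X1 \<rho> t1 M Q1" "run L P R2 X2 \<rho> t2 M Q2"
    "X1 \<inter> R2 = {}" "X2 \<inter> R1 = {}" "X1 \<inter> X2 = {}" "R1 \<union> R2 \<subseteq> R" "X1 \<union> X2 \<subseteq> X"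
    and "\<And>v1 M1 c1 s1 v2 M2 c2 s2 M3. \<lbrakk>Q1 v1 M1 c1 s1; Q2 v2 M2 c2 s2; s1 \<le> c1; s2 \<le> c2;
      \<And>x. x \<in> X1 \<Longrightarrow> M3 x = M1 x; \<And>x. x \<in> X2 \<Longrightarrow> M3 x = M2 x; \<And>x. x \<notin> X1 \<union> X2 \<Longrightarrow> M3 x = M x\<rbrakk> \<Longrightarrow>
      run L P R X (\<rho>(x \<mapsto> v1, y \<mapsto> v2)) t M3
        (\<lambda>v' M' c' s'. Q v' M' (1 + c1 + c2 + c') (1 + max s1 s2 + s'))"
  shows "run L P R X \<rho> (Fork x t1 y t2 t) M Q"
  using assms(1)
proof (rule runE)
  fix v1 M1 A1 W1 c1 s1
  assume 1: "exec L P \<rho> t1 M (v1, M1, A1, W1, c1, s1)" "A1 \<subseteq> R1" "W1 \<subseteq> X1" "Q1 v1 M1 c1 s1"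
    "\<And>x. x \<notin> W1 \<Longrightarrow> M1 x = M x" "s1 \<le> c1"
  show ?thesis using assms(2)
  proof (rule runE)
    fix v2 M2 A2 W2 c2 s2
    assume 2: "exec L P \<rho> t2 M (v2, M2, A2, W2, c2, s2)" "A2 \<subseteq> R2" "W2 \<subseteq> X2" "Q2 v2 M2 c2 s2"
      "\<And>x. x \<notin> W2 \<Longrightarrow> M2 x = M x" "s2 \<le> c2"
    let ?M = "override_on M2 M1 W1"
    have disj: "W1 \<inter> X2 = {}" "W2 \<inter> X1 = {}" using 1(3) 2(3) assms(5) by blast+
    have "run L P R X (\<rho>(x \<mapsto> v1, y \<mapsto> v2)) t ?M
        (\<lambda>v' M' c' s'. Q v' M' (1 + c1 + c2 + c') (1 + max s1 s2 + s'))"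
    proof (rule assms(8)[OF 1(4) 2(4) 1(6) 2(6)])
      show "?M x = M1 x" if "x \<in> X1" for x
        using 1(5)[of x] 2(5)[of x] disj that by (cases "x \<in> W1";
            cases "x \<in> W2") (auto simp: override_on_def)
      show "?M x = M2 x" if "x \<in> X2" for x
        using 1(5)[of x] 2(5)[of x] disj that by (cases "x \<in> W1";
            cases "x \<in> W2") (auto simp: override_on_def)
      show "?M x = M x" if "x \<notin> X1 \<union> X2" for x
        using 1(3) 2(3) 2(5)[of x] that by (auto simp: override_on_def)
    qed
    then show ?thesis
    proof (rule runE)
      fix v' M' A W c s
      assume 3: "exec L P (\<rho>(x \<mapsto> v1, y \<mapsto> v2)) t ?M (v', M', A, W, c, s)" "A \<subseteq> R" "W \<subseteq> X"
        "Q v' M' (1 + c1 + c2 + c) (1 + max s1 s2 + s)"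
      have "W1 \<inter> A2 = {}" "W2 \<inter> A1 = {}" using 1 2 assms(3,4) by blast+
      from exec.Fork[OF 1(1) 2(1) this 3(1)] show ?thesis
        unfolding run_def using 1(2,3) 2(2,3) 3(2-) assms(6,7) by blast
    qed
  qed
qed

section \<open>The program\<close>

abbreviation "plus_e \<equiv> Bin Add"
abbreviation "minus_e \<equiv> Bin Sub"
abbreviation "eq_e \<equiv> Bin Equ"
abbreviation "less_e \<equiv> Bin Less"
abbreviation pow2 :: "exp \<Rightarrow> exp" where "pow2 e \<equiv> Bin Shl (Lit 1) e"

text \<open>A key \<open>x\<close> of the batch is represented in a node of width \<open>w\<close> by any number congruent to \<open>x\<close>
  modulo \<open>2^w\<close>; so the batch need not be rewritten when it is passed on to a cluster.\<close>

abbreviation head :: "name \<Rightarrow> exp" where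
  "head x \<equiv> Bin Div (Bin Mod (Var x) (pow2 (Var ''w''))) (pow2 (Var ''l''))"

text \<open>Since the batch is sorted, only its first and last entries can be the minimum and the
  maximum; \<open>p\<close> and \<open>q\<close> record whether they are. If a single key is both,
  \<open>k\<close> is \<open>-1\<close>, so the call of \<open>inner\<close> is guarded by
  \<open>0 < k\<close>. If no inner key is left, the new minimum defaults to the surviving maximum,
  or else to the code of plus infinity; the new maximum then defaults to the new minimum, or to
  \<open>-1\<close> in an empty tree. The result \<open>e\<close> is the emptiness flag.\<close>

definition delete_com :: com where
  "delete_com =
    Cond (eq_e (Var ''n'') (Lit 0)) (Ret (Lit 0))
    (Bind ''mn'' (Read (Var ''a''))
    (Bind ''mx'' (Read (plus_e (Var ''a'') (Lit 1)))
    (Bind ''x'' (Read (Var ''i''))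
    (Bind ''y'' (Read (plus_e (Var ''i'') (minus_e (Var ''n'') (Lit 1))))
    (Bind ''p'' (Ret (eq_e (Bin Mod (Var ''x'') (pow2 (Var ''w''))) (Var ''mn'')))
    (Bind ''q'' (Ret (eq_e (Bin Mod (Var ''y'') (pow2 (Var ''w''))) (Var ''mx'')))
    (Bind ''k'' (Ret (minus_e (minus_e (Var ''n'') (Var ''p'')) (Var ''q'')))
    (Bind ''u'' (Cond (less_e (Lit 0) (Var ''k''))
        (Call ''inner'' [Var ''a'', Var ''w'', plus_e (Var ''i'') (Var ''p''), Var ''k'', plus_e
            (Var ''f'') (Lit 1)])
        (Ret (Lit 0)))
    (Bind ''d'' (Cond (Var ''q'') (Ret (pow2 (Var ''w''))) (Ret (Var ''mx'')))
    (Bind ''r'' (Cond (Var ''p'')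
        (Call ''extract'' [Var ''a'', Var ''w'', Lit 0, Var ''d'', Var ''f''])
        (Ret (Var ''mn'')))
    (Bind ''u'' (Write (Var ''a'') (Var ''r''))
    (Bind ''e'' (Ret (eq_e (Var ''r'') (pow2 (Var ''w''))))
    (Bind ''d'' (Cond (Var ''e'') (Ret (Lit (-1))) (Ret (Var ''r'')))
    (Bind ''t'' (Cond (Var ''q'')
        (Call ''extract'' [Var ''a'', Var ''w'', Lit 1, Var ''d'', Var ''f''])
        (Ret (Var ''mx'')))
    (Bind ''u'' (Write (plus_e (Var ''a'') (Lit 1)) (Var ''t''))
    (Ret (Var ''e'')))))))))))))))))"

text \<open>\<open>extract\<close> removes the smallest (\<open>o = 0\<close>) or the largest (\<open>o = 1\<close>) key from summary and
  clusters and returns it, or returns \<open>d\<close> if there is none.\<close>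

definition extract_com :: com where
  "extract_com =
    Cond (less_e (Var ''w'') (Lit 2)) (Ret (Var ''d''))
    (Bind ''s'' (Read (plus_e (Var ''a'') (Lit 2)))
    (Bind ''x'' (Read (Var ''s''))
    (Bind ''y'' (Read (plus_e (Var ''s'') (Lit 1)))
    (Cond (less_e (Var ''y'') (Var ''x'')) (Ret (Var ''d''))
    (Bind ''h'' (Read (plus_e (Var ''s'') (Var ''o'')))
    (Bind ''t'' (Read (plus_e (Var ''a'') (Lit 3)))
    (Bind ''c'' (Read (plus_e (Var ''t'') (Var ''h'')))
    (Bind ''x'' (Read (plus_e (Var ''c'') (Var ''o'')))
    (Bind ''x'' (Ret (plus_e (Bin Shl (Var ''h'') (Bin Div (plus_e (Var ''w'') (Lit 1)) (Lit 2)))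
        (Var ''x'')))
    (Bind ''u'' (Write (Var ''f'') (Var ''x''))
    (Bind ''u'' (Call ''inner'' [Var ''a'', Var ''w'', Var ''f'', Lit 1, plus_e (Var ''f'') (Lit 1)])
    (Ret (Var ''x'')))))))))))))"

text \<open>The scratch region consists of four parts: from \<open>f\<close> on, the group ends
  indexed by high bits; then \<open>2^w\<close> cells for partial sums, where the shift by
  \<open>i\<close> in \<open>g\<close> lets positions of the batch serve as indices; from
  \<open>o\<close> on, the packed heads; from \<open>v\<close> on, scratch for the recursive calls.
  The summary reuses the last part, since all cluster deletions have been joined by then.\<close>

definition inner_com :: com where
  "inner_com =
    Bind ''z'' (Ret (pow2 (Var ''w'')))
    (Bind ''l'' (Ret (Bin Div (plus_e (Var ''w'') (Lit 1)) (Lit 2)))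
    (Bind ''t'' (Read (plus_e (Var ''a'') (Lit 3)))
    (Bind ''j'' (Ret (plus_e (Var ''i'') (Var ''n'')))
    (Bind ''g'' (Ret (minus_e (plus_e (Var ''f'') (Var ''z'')) (Var ''i'')))
    (Bind ''o'' (Ret (plus_e (plus_e (Var ''f'') (Var ''z'')) (Var ''z'')))
    (Bind ''v'' (Ret (plus_e (Var ''o'') (Var ''z'')))
    (Bind ''u'' (Call ''seg'' [Var ''i'', Var ''j'', Var ''i'', Var ''j'', Var ''w'', Var ''l'', Var
        ''f'', Var ''g'', Var ''t'', Var ''v''])
    (Bind ''k'' (Call ''run'' [Var ''i'', Var ''j'', Var ''i'', Var ''j'', Var ''w'', Var ''l'', Var
        ''f'', Var ''g'', Var ''t'', Var ''v''])
    (Cond (eq_e (Var ''k'') (Lit 0)) (Ret (Lit 0))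
    (Bind ''u'' (Call ''pack'' [Var ''i'', Var ''j'', Var ''w'', Var ''l'', Var ''g'', Var ''o'',
        Var ''k''])
    (Bind ''s'' (Read (plus_e (Var ''a'') (Lit 2)))
    (Call ''batch_delete'' [Var ''s'', Bin Div (Var ''w'') (Lit 2), Var ''o'', Var ''k'', Var
        ''v'']))))))))))))"

abbreviation for_params :: "name list" where
  "for_params \<equiv> [''i'', ''j'', ''b'', ''e'', ''w'', ''l'', ''f'', ''g'', ''t'', ''v'']"

text \<open>A parallel loop over \<open>[i, j)\<close> that adds up the results of its body and leaves at \<open>g + m\<close> the
  partial sum of the part to the left of each split point \<open>m\<close>.\<close>

definition for_com :: "name \<Rightarrow> com \<Rightarrow> com" where
  "for_com nm body =
    Cond (eq_e (minus_e (Var ''j'') (Var ''i'')) (Lit 1)) body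
    (Bind ''m'' (Ret (plus_e (Var ''i'') (Bin Div (minus_e (Var ''j'') (Var ''i'')) (Lit 2))))
    (Fork
      ''x'' (Call nm [Var ''i'', Var ''m'', Var ''b'', Var ''e'', Var ''w'', Var ''l'', Var ''f'',
          Var ''g'', Var ''t'', Var ''v''])
      ''y'' (Call nm [Var ''m'', Var ''j'', Var ''b'', Var ''e'', Var ''w'', Var ''l'', Var ''f'',
          Var ''g'', Var ''t'', Var ''v''])
      (Bind ''u'' (Write (plus_e (Var ''g'') (Var ''m'')) (Var ''x''))
      (Ret (plus_e (Var ''x'') (Var ''y''))))))"

text \<open>The last key of each group with equal high bits \<open>h\<close> records the end of the group at \<open>f + h\<close>.\<close>

definition seg_com :: com where
  "seg_com =
    Bind ''x'' (Read (Var ''i''))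
    (Bind ''h'' (Ret (head ''x''))
    (Bind ''d'' (Cond (eq_e (plus_e (Var ''i'') (Lit 1)) (Var ''e'')) (Ret (Lit 0))
      (Bind ''y'' (Read (plus_e (Var ''i'') (Lit 1))) (Ret (eq_e (head ''y'') (Var ''h'')))))
    (Cond (Var ''d'') (Ret (Lit 0))
      (Bind ''u'' (Write (plus_e (Var ''f'') (Var ''h'')) (plus_e (Var ''i'') (Lit 1))) (Ret (Lit
          0))))))"

text \<open>Only the first key of a group acts. It finds the end of its group in the table filled by
  \<open>seg\<close> and passes the contiguous piece of the batch, in place, to the cluster. The
  shift by \<open>2 * (l + 1)\<close> multiplies \<open>h\<close> by the scratch size for width
  \<open>l\<close>, which separates the scratch of different clusters. The returned flag is what the
  loop adds up.\<close>

definition run_com :: com where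
  "run_com =
    Bind ''x'' (Read (Var ''i''))
    (Bind ''h'' (Ret (head ''x''))
    (Bind ''d'' (Cond (eq_e (Var ''i'') (Var ''b'')) (Ret (Lit 0))
      (Bind ''y'' (Read (minus_e (Var ''i'') (Lit 1))) (Ret (eq_e (head ''y'') (Var ''h'')))))
    (Cond (Var ''d'') (Ret (Lit 0))
      (Bind ''k'' (Read (plus_e (Var ''f'') (Var ''h'')))
      (Bind ''c'' (Read (plus_e (Var ''t'') (Var ''h'')))
      (Call ''batch_delete'' [Var ''c'', Var ''l'', Var ''i'', minus_e (Var ''k'') (Var ''i''),
        plus_e (Var ''v'') (Bin Shl (Var ''h'') (Bin Mul (Lit 2) (plus_e (Var ''l'') (Lit 1))))]))))))"

text \<open>The recursion splits at the same points as \<open>for_com\<close>, so the cell at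
  \<open>g + m\<close> already contains the number of entries produced by the left half. Both halves
  therefore know their destination before the fork, and halves without entries are cut off.\<close>

definition pack_com :: com where
  "pack_com =
    Cond (eq_e (Var ''n'') (Lit 0)) (Ret (Lit 0))
    (Cond (eq_e (minus_e (Var ''j'') (Var ''i'')) (Lit 1))
      (Bind ''x'' (Read (Var ''i'')) (Write (Var ''o'') (head ''x'')))
      (Bind ''m'' (Ret (plus_e (Var ''i'') (Bin Div (minus_e (Var ''j'') (Var ''i'')) (Lit 2))))
      (Bind ''c'' (Read (plus_e (Var ''g'') (Var ''m'')))
      (Fork
        ''x'' (Call ''pack'' [Var ''i'', Var ''m'', Var ''w'', Var ''l'', Var ''g'', Var ''o'', Var
            ''c''])
        ''y'' (Call ''pack'' [Var ''m'', Var ''j'', Var ''w'', Var ''l'', Var ''g'',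
                plus_e (Var ''o'') (Var ''c''), minus_e (Var ''n'') (Var ''c'')])
        (Ret (Lit 0))))))"

definition veb_prog :: prog where
  "veb_prog =
    [(''batch_delete'', [''a'', ''w'', ''i'', ''n'', ''f''], delete_com),
     (''extract'', [''a'', ''w'', ''o'', ''d'', ''f''], extract_com),
     (''inner'', [''a'', ''w'', ''i'', ''n'', ''f''], inner_com),
     (''seg'', for_params, for_com ''seg'' seg_com),
     (''run'', for_params, for_com ''run'' run_com),
     (''pack'', [''i'', ''j'', ''w'', ''l'', ''g'', ''o'', ''n''], pack_com)]"

lemma veb_prog_procs:
  "map_of veb_prog ''batch_delete'' = Some ([''a'', ''w'', ''i'', ''n'', ''f''], delete_com)"
  "map_of veb_prog ''extract'' = Some ([''a'', ''w'', ''o'', ''d'', ''f''], extract_com)"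
  "map_of veb_prog ''inner'' = Some ([''a'', ''w'', ''i'', ''n'', ''f''], inner_com)"
  "map_of veb_prog ''seg'' = Some (for_params, for_com ''seg'' seg_com)"
  "map_of veb_prog ''run'' = Some (for_params, for_com ''run'' run_com)"
  "map_of veb_prog ''pack'' = Some ([''i'', ''j'', ''w'', ''l'', ''g'', ''o'', ''n''], pack_com)"
  by (simp_all add: veb_prog_def)

section \<open>Parallel loops\<close>

text \<open>The derivation tree mirrors the split tree of \<open>for_com\<close>. The split points
  of \<open>[i, j)\<close> lie strictly between \<open>i\<close> and \<open>j\<close>, so
  neighbouring subintervals use disjoint counter cells and leave the cell at their common boundary
  free.\<close>

inductive counts :: "(int \<Rightarrow> int) \<Rightarrow> int \<Rightarrow> mem \<Rightarrow> int \<Rightarrow> int \<Rightarrow> bool" for v g M where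
  one: "counts v g M i (i + 1)"
| split: "\<lbrakk>i + 1 < j; m = i + (j - i) div 2; M (g + m) = sum v {i..<m};
    counts v g M i m; counts v g M m j\<rbrakk> \<Longrightarrow> counts v g M i j"

lemma counts_frame:
  assumes "counts v g M i j" "\<And>x. x \<in> {g + i<..<g + j} \<Longrightarrow> M' x = M x"
  shows "counts v g M' i j"
  using assms
proof induction
  case (one i)
  show ?case by (rule counts.one)
next
  case (split i j m)
  have m: "i < m" "m < j" using split.hyps(1,2) by auto
  show ?case
  proof (rule counts.split[OF split.hyps(1,2)])
    show "M' (g + m) = sum v {i..<m}" using split.hyps(3) split.prems m by auto
  qed (use split m in auto)
qed

abbreviation for_env :: "int \<Rightarrow> int \<Rightarrow> int list \<Rightarrow> env" where
  "for_env i j vs \<equiv> map_of (zip for_params (i # j # vs))"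

lemma sum_bits_bounds:
  fixes v :: "int \<Rightarrow> int"
  assumes "\<And>p. v p \<in> {0, 1}" "x \<le> y"
  shows "0 \<le> sum v {x..<y}" "sum v {x..<y} \<le> y - x"
proof -
  have v: "0 \<le> v p" "v p \<le> 1" for p using assms(1)[of p] by auto
  have "sum v {x..<y} \<le> (\<Sum>p\<in>{x..<y}. 1)" by (intro sum_mono v)
  then show "sum v {x..<y} \<le> y - x" using assms(2) by simp
  show "0 \<le> sum v {x..<y}" by (intro sum_nonneg v)
qed

lemma sum_bits_length:
  fixes v :: "int \<Rightarrow> int"
  assumes "\<And>p. v p \<in> {0, 1}"
  shows "sum v {x..<y} = int (length (filter (\<lambda>p. v p = 1) [x..y - 1]))"
proof -
  have "sum_list (map v ps) = int (length (filter (\<lambda>p. v p = 1) ps))" for ps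
  proof (induction ps)
    case (Cons p ps)
    then show ?case using assms[of p] by auto
  qed simp
  moreover have "{x..<y} = set [x..y - 1]" by auto
  ultimately show ?thesis by (metis distinct_upto sum_list_distinct_conv_sum_set)
qed

text \<open>\<open>R\<close> is shared and only read, \<open>Z p\<close> is private to iteration
  \<open>p\<close>. By this separation every body can be specified from the one memory
  \<open>M\<close> at the start of the loop, and its effect \<open>Q p\<close> survives as far as it
  depends on \<open>Z p\<close>. The summand \<open>50\<close> on the left of the work bound is the
  credit that pays for the next inner node of the split tree.\<close>

lemma run_for:
  assumes proc: "map_of P nm = Some (for_params, for_com nm body)"
    and vs: "vs = [b, e, w, l, f, g, t, u]"
    and body: "\<And>p. p \<in> {b..<e} \<Longrightarrow> run L P (R \<union> Z p) (Z p) (for_env p (p + 1) vs) body M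
        (\<lambda>r M' c s. r = v p \<and> Q p M' \<and> c \<le> cc p \<and> s \<le> ss)"
    and v: "\<And>p. v p \<in> {0, 1}"
    and Z: "\<And>p. p \<in> {b..<e} \<Longrightarrow> Z p \<inter> R = {}"
      "\<And>p q. p \<in> {b..<e} \<Longrightarrow> q \<in> {b..<e} \<Longrightarrow> p \<noteq> q \<Longrightarrow> Z p \<inter> Z q = {}"
      "\<And>p. p \<in> {b..<e} \<Longrightarrow> Z p \<inter> {g + b<..<g + e} = {}"
    and R: "R \<inter> {g + b<..<g + e} = {}"
    and word: "0 \<le> b" "e < 2 ^ L" "0 \<le> g + b" "g + e \<le> 2 ^ L"
    and ij: "b \<le> i" "i < j" "j \<le> e" "j - i \<le> 2 ^ k"
  shows "run L P (R \<union> (\<Union>p\<in>{i..<j}. Z p) \<union> {g + i<..<g + j}) ((\<Union>p\<in>{i..<j}. Z p) \<union> {g + i<..<g + j})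
    (for_env i j vs) (for_com nm body) M
    (\<lambda>r M' c s. r = sum v {i..<j} \<and> (\<forall>p\<in>{i..<j}. \<exists>Mp. Q p Mp \<and> (\<forall>x\<in>Z p. M' x = Mp x)) \<and>
       counts v g M' i j \<and> c + 50 \<le> sum cc {i..<j} + 100 * nat (j - i) \<and> s \<le> ss + 50 * (k + 1))"
proof -
  have one: "{p..<p + 1} = {p}" for p :: int by auto
  define T where "T i j r M' \<longleftrightarrow> r = sum v {i..<j} \<and>
    (\<forall>p\<in>{i..<j}. \<exists>Mp. Q p Mp \<and> (\<forall>x\<in>Z p. M' x = Mp x)) \<and> counts v g M' i j" for i j r M'
  define RR where "RR i j = R \<union> (\<Union>p\<in>{i..<j}. Z p) \<union> {g + i<..<g + j}" for i j
  define X where "X i j = (\<Union>p\<in>{i..<j}. Z p) \<union> {g + i<..<g + j}" for i j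
  have leaf: "run L P (RR i j) (X i j) (for_env i j vs) (for_com nm body) M
    (\<lambda>r M' c s. T i j r M' \<and> c + 50 \<le> sum cc {i..<j} + 100 * nat (j - i) \<and> s \<le> ss + 50 * (k + 1))"
    if "b \<le> i" "j = i + 1" "j \<le> e" for i j k
  proof -
    have "(1::int) < 2 ^ L" using word that by auto
    then have "is_word L 1" by (auto simp: is_word_def)
    then show ?thesis
      unfolding for_com_def that(2)
      apply (intro run_Cond[where i=1])
        apply (simp add: word_result_def)
       prefer 2 apply simp
      apply (rule run_conseq[OF body])
      using that by (auto intro: counts.one simp: RR_def X_def T_def one)
  qed
  have "run L P (RR i j) (X i j) (for_env i j vs) (for_com nm body) M
    (\<lambda>r M' c s. T i j r M' \<and> c + 50 \<le> sum cc {i..<j} + 100 * nat (j - i) \<and> s \<le> ss + 50 * (k + 1))"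
    using ij
  proof (induction k arbitrary: i j)
    case (0 i j)
    show ?case by (rule leaf) (use 0 in auto)
  next
    case (Suc k i j)
    show ?case
    proof (cases "j - i = 1")
      case True
      show ?thesis by (rule leaf) (use Suc True in auto)
    next
      case False
      define m where "m = i + (j - i) div 2"
      have m: "i < m" "m < j" "m - i \<le> 2 ^ k" "j - m \<le> 2 ^ k" using False Suc.prems by (auto simp: m_def)
      have L2: "(2::int) < 2 ^ L" using word Suc.prems False by auto
      have w: "is_word L 2" "is_word L ((j - i) div 2)" "is_word L m" "is_word L (g + m)"
        "is_word L (sum v {i..<m} + sum v {m..<j})" "is_word L 1" "is_word L 0" "is_word L (j - i)"
        using L2 word Suc.prems m sum_bits_bounds[of v i m, OF v] sum_bits_bounds[of v m j, OF v]
            by (auto simp: is_word_def)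
      have split: "{i..<j} = {i..<m} \<union> {m..<j}" using m by auto
      \<comment> \<open>Private cells are separated by hypothesis, and the counter cells lie on the
        two sides of \<open>g + m\<close>. The cell \<open>g + m\<close> itself belongs to neither
        branch; it is written after the join.\<close>
      have dj: "X i m \<inter> RR m j = {}" "X m j \<inter> RR i m = {}" "X i m \<inter> X m j = {}"
        "g + m \<notin> X i m" "g + m \<notin> X m j"
      proof -
        have 5: "Z p \<inter> {g + i<..<g + m} = {}" "Z p \<inter> {g + m<..<g + j} = {}" "Z p \<inter> R = {}" "g + m \<notin> Z p"
          if "p \<in> {i..<j}" for p
          using Z(1,3)[of p] that Suc.prems m by fastforce+
        have 6: "R \<inter> {g + i<..<g + m} = {}" "R \<inter> {g + m<..<g + j} = {}"
            "{g + i<..<g + m} \<inter> {g + m<..<g + j} = {}"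
          using R Suc.prems m by fastforce+
        have 7: "\<Union> (Z ` {i..<m}) \<inter> \<Union> (Z ` {m..<j}) = {}"
        proof -
          have "Z p \<inter> Z q = {}" if "p \<in> {i..<m}" "q \<in> {m..<j}" for p q
            using Z(2)[of p q] that Suc.prems m by auto
          then show ?thesis by blast
        qed
        have U: "\<Union> (Z ` {i..<m}) \<inter> Y = {}" "\<Union> (Z ` {m..<j}) \<inter> Y = {}"
          if "\<And>p. p \<in> {i..<j} \<Longrightarrow> Z p \<inter> Y = {}" for Y
        proof -
          have "{i..<m} \<subseteq> {i..<j}" "{m..<j} \<subseteq> {i..<j}" using m by auto
          then show "\<Union> (Z ` {i..<m}) \<inter> Y = {}" "\<Union> (Z ` {m..<j}) \<inter> Y = {}"
            using that by blast+
        qed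
        note 8 = U[of R, OF 5(3)] U[of "{g + i<..<g + m}", OF 5(1)] U[of "{g + m<..<g + j}", OF 5(2)]
        note 8 = 8 8[THEN trans[OF Int_commute]] 6 6[THEN trans[OF Int_commute]]
          7 7[THEN trans[OF Int_commute]]
        show "X i m \<inter> RR m j = {}" "X m j \<inter> RR i m = {}" "X i m \<inter> X m j = {}"
          unfolding X_def RR_def Int_Un_distrib Int_Un_distrib2 by (simp_all only: 8 Un_empty_left)
        show "g + m \<notin> X i m" "g + m \<notin> X m j"
          unfolding X_def using 5(4) m by auto
      qed
      have sub: "RR i m \<union> RR m j \<subseteq> RR i j" "X i m \<union> X m j \<subseteq> X i j" "g + m \<in> X i j" "X i j \<subseteq> RR i j"
        using m by (auto simp: X_def RR_def split)
      have left: "run L P (RR i m) (X i m) ((for_env i j vs)(''m'' \<mapsto> m))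
        (Call nm [Var ''i'', Var ''m'', Var ''b'', Var ''e'', Var ''w'', Var ''l'', Var ''f'', Var
            ''g'', Var ''t'', Var ''v'']) M
        (\<lambda>r M' c s. T i m r M' \<and> c + 39 \<le> sum cc {i..<m} + 100 * nat (m - i) \<and>
            s \<le> ss + 50 * (k + 1) + 11)"
        apply (rule run_Call[OF proc, where vs="i # m # vs"])
          apply simp
         apply (simp add: vs)
        apply (rule run_conseq)
           apply (rule Suc.IH)
        using Suc.prems m apply auto
        done
      have right: "run L P (RR m j) (X m j) ((for_env i j vs)(''m'' \<mapsto> m))
        (Call nm [Var ''m'', Var ''j'', Var ''b'', Var ''e'', Var ''w'', Var ''l'', Var ''f'', Var
            ''g'', Var ''t'', Var ''v'']) M
        (\<lambda>r M' c s. T m j r M' \<and> c + 39 \<le> sum cc {m..<j} + 100 * nat (j - m) \<and>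
            s \<le> ss + 50 * (k + 1) + 11)"
        apply (rule run_Call[OF proc, where vs="m # j # vs"])
          apply simp
         apply (simp add: vs)
        apply (rule run_conseq)
           apply (rule Suc.IH)
        using Suc.prems m apply auto
        done
      have T: "T i j (r1 + r2) (M3(g + m := r1))"
        if *: "T i m r1 M1" "T m j r2 M2" "\<And>x. x \<in> X i m \<Longrightarrow> M3 x = M1 x" "\<And>x. x \<in> X m j \<Longrightarrow> M3 x = M2 x"
        for r1 r2 M1 M2 M3
      proof -
        have "counts v g (M3(g + m := r1)) i m"
          by (rule counts_frame[of _ _ M1]) (use * dj(4) in \<open>auto simp: T_def X_def\<close>)
        moreover have "counts v g (M3(g + m := r1)) m j"
          by (rule counts_frame[of _ _ M2]) (use * dj(5) in \<open>auto simp: T_def X_def\<close>)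
        ultimately have "counts v g (M3(g + m := r1)) i j"
          using * m by (intro counts.split[OF _ m_def]) (auto simp: T_def)
        moreover have "\<exists>Mp. Q p Mp \<and> (\<forall>x\<in>Z p. (M3(g + m := r1)) x = Mp x)" if p: "p \<in> {i..<j}" for p
        proof (cases "p < m")
          case True
          then have "p \<in> {i..<m}" using p by simp
          moreover from this obtain Mp where "Q p Mp" "\<forall>x\<in>Z p. M1 x = Mp x"
              using *(1) unfolding T_def by blast
          moreover have "Z p \<subseteq> X i m" using calculation(1) by (auto simp: X_def)
          ultimately show ?thesis using *(3) dj(4) by (intro exI[of _ Mp]) (auto simp: subset_iff)
        next
          case False
          then have "p \<in> {m..<j}" using p by simp
          moreover from this obtain Mp where "Q p Mp" "\<forall>x\<in>Z p. M2 x = Mp x"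
              using *(2) unfolding T_def by blast
          moreover have "Z p \<subseteq> X m j" using calculation(1) by (auto simp: X_def)
          ultimately show ?thesis using *(4) dj(5) by (intro exI[of _ Mp]) (auto simp: subset_iff)
        qed
        moreover have "sum v {i..<j} = r1 + r2"
          using * unfolding split T_def by (subst sum.union_disjoint) auto
        ultimately show ?thesis unfolding T_def by simp
      qed
      have cc: "sum cc {i..<j} = sum cc {i..<m} + sum cc {m..<j}"
        unfolding split by (subst sum.union_disjoint) auto
      show ?thesis
        unfolding for_com_def
        apply (rule run_Cond[where i=0])
          apply (simp add: word_result_def False vs w)
         apply simp
        apply (rule run_Bind_Ret[where v=m])
          apply (simp add: word_result_def vs w flip: m_def)
        apply (rule run_Fork[OF left right dj(1-3) sub(1,2)])
        apply (elim conjE)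
        subgoal premises prems for \<dots> r1 M1 c1 s1 r2 M2 c2 s2 M3
          apply (rule run_Bind[where N="\<lambda>r M' c s. M' = M3(g + m := r1) \<and> c \<le> 5 \<and> s \<le> 5"])
           apply (rule run_Write[where i="g + m" and v=r1])
          using sub w word m Suc.prems apply (auto simp: vs word_result_def)[6]
          apply (elim conjE, hypsubst)
          apply (rule run_Ret[where v="r1 + r2"])
          using prems w apply (simp add: word_result_def vs T_def)
          using T[of r1 M1 r2 M2 M3] prems m by (auto simp: cc max_def fun_upd_def)
        done
    qed
  qed
  then show ?thesis unfolding T_def RR_def X_def by (auto elim!: run_conseq)
qed


text \<open>The value of the program expression \<open>head\<close>. For
  \<open>l = low_bits w\<close> it is \<open>high w\<close> of the residue that the stored word
  represents.\<close>

definition grp :: "nat \<Rightarrow> nat \<Rightarrow> int \<Rightarrow> int" where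
  "grp w l x = (x mod 2 ^ w) div 2 ^ l"

lemma exp_val_pow2:
  assumes "\<rho> x = Some (int w)" "(2::int) ^ w < 2 ^ L"
  shows "exp_val L \<rho> (pow2 (Var x)) = Some (2 ^ w)"
proof -
  have "(1::int) \<le> 2 ^ w" by simp
  then have "is_word L 1" "is_word L (2 ^ w)" using assms(2) unfolding is_word_def by linarith+
  then show ?thesis using assms by (simp add: word_result_def)
qed

lemma exp_val_Bin:
  assumes "exp_val L \<rho> e1 = Some x" "exp_val L \<rho> e2 = Some y" "binop_val op x y = r" "is_word L r"
  shows "exp_val L \<rho> (Bin op e1 e2) = Some r"
  using assms by (simp add: word_result_def)

lemma grp_bounds:
  assumes "l \<le> w"
  shows "0 \<le> grp w l x" "grp w l x < 2 ^ (w - l)"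
proof -
  have "x mod 2 ^ w < 2 ^ (w - l) * 2 ^ l" using assms by (simp flip: power_add)
  then show "grp w l x < 2 ^ (w - l)" 
    using div_mult_mod_eq[of "x mod 2 ^ w" "2 ^ l"] pos_mod_sign[of "2 ^ l" "x mod 2 ^ w"]
    unfolding grp_def by (smt (verit) mult_right_mono zero_less_power)
qed (simp add: grp_def pos_imp_zdiv_nonneg_iff)

lemma grp_less_pow:
  assumes "l \<le> w"
  shows "grp w l x < 2 ^ w"
  by (rule less_le_trans[OF grp_bounds(2)[OF assms]]) (simp add: power_increasing)

lemma exp_val_head:
  assumes "\<rho> x = Some a" "\<rho> ''w'' = Some (int w)" "\<rho> ''l'' = Some (int l)"
    "(2::int) ^ w < 2 ^ L" "l \<le> w"
  shows "exp_val L \<rho> (head x) = Some (grp w l a)"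
proof -
  have l: "(2::int) ^ l < 2 ^ L" using assms(4,5) power_increasing[of l w "2::int"] by simp
  have "0 \<le> a mod 2 ^ w" "a mod 2 ^ w < 2 ^ w" by simp_all
  then have "is_word L (a mod 2 ^ w)" using assms(4) unfolding is_word_def by linarith
  moreover have "is_word L (grp w l a)"
    using grp_bounds(1)[OF assms(5), of a] grp_less_pow[OF assms(5), of a] assms(4)
    unfolding is_word_def by linarith
  ultimately show ?thesis
    using exp_val_pow2[of \<rho> "''w''", OF assms(2,4)] exp_val_pow2[of \<rho> "''l''", OF assms(3) l] assms(1)
    by (simp del: exp_val.simps(1) add: word_result_def grp_def)
qed

lemma array_at_append:
  "array_at M b (xs @ ys) \<longleftrightarrow> array_at M b xs \<and> array_at M (b + int (length xs)) ys"
proof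
  assume *: "array_at M b (xs @ ys)"
  have "M (b + int (length xs) + int i) = ys ! i" if "i < length ys" for i
    using * that unfolding array_at_def
    by (metis add.assoc length_append nat_add_left_cancel_less nth_append_length_plus of_nat_add)
  moreover have "M (b + int i) = xs ! i" if "i < length xs" for i
    using *[unfolded array_at_def, rule_format, of i] that by (simp add: nth_append)
  ultimately show "array_at M b xs \<and> array_at M (b + int (length xs)) ys" unfolding array_at_def by blast
next
  assume *: "array_at M b xs \<and> array_at M (b + int (length xs)) ys"
  have "M (b + int i) = (xs @ ys) ! i" if "i < length (xs @ ys)" for i
  proof (cases "i < length xs")
    case False
    have "M (b + int (length xs) + int (i - length xs)) = ys ! (i - length xs)"
      using conjunct2[OF *[unfolded array_at_def], rule_format, of "i - length xs"] that False
      by (smt (verit) add.commute length_append less_diff_conv2 linorder_not_less)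
    moreover have "b + int (length xs) + int (i - length xs) = b + int i" using False by simp
    ultimately show ?thesis using False by (simp add: nth_append)
  qed (use * in \<open>simp add: array_at_def nth_append\<close>)
  then show "array_at M b (xs @ ys)" unfolding array_at_def by blast
qed

abbreviation pack_params :: "name list" where
  "pack_params \<equiv> [''i'', ''j'', ''w'', ''l'', ''g'', ''o'', ''n'']"

text \<open>Induction on the derivation of \<open>counts\<close>, whose split points are those of
  the program. At a split the output of the left half has exactly \<open>sum v {i..<m}\<close>
  entries, so the two outputs are adjacent and disjoint.\<close>

lemma run_pack:
  assumes "counts v g M i j"
    and proc: "map_of P ''pack'' = Some (pack_params, pack_com)"
    and v: "\<And>p. v p \<in> {0, 1}"
    and word: "(2::int) ^ w < 2 ^ L" "l \<le> w" "0 \<le> i" "j < 2 ^ L" "0 \<le> g + i" "g + j \<le> 2 ^ L"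
      "0 \<le> d" "d + sum v {i..<j} < 2 ^ L"
    and M: "\<And>p. p \<in> {i..<j} \<Longrightarrow> is_word L (M p)"
    and disj: "{d..<d + sum v {i..<j}} \<inter> ({i..<j} \<union> {g + i<..<g + j}) = {}"
    and k: "j - i \<le> 2 ^ k"
  shows "run L P ({i..<j} \<union> {g + i<..<g + j} \<union> {d..<d + sum v {i..<j}}) {d..<d + sum v {i..<j}}
    (map_of (zip pack_params [i, j, int w, int l, g, d, sum v {i..<j}])) pack_com M
    (\<lambda>r M' c s. array_at M' d (map (\<lambda>p. grp w l (M p)) (filter (\<lambda>p. v p = 1) [i..j - 1])) \<and>
      c + 50 \<le> 100 * nat (j - i) \<and> s \<le> 50 * (k + 1))"
proof -
  have L1: "(1::int) < 2 ^ L" using word(1) by (smt (verit) one_le_power)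
  have w01: "is_word L 1" "is_word L 0" using L1 by (auto simp: is_word_def)
  define D where "D i j d = {d..<d + sum v {i..<j}}" for i j d
  define T where "T i j d M' \<longleftrightarrow>
    array_at M' d (map (\<lambda>p. grp w l (M p)) (filter (\<lambda>p. v p = 1) [i..j - 1]))" for i j d M'
  define E where "E i j d = map_of (zip pack_params [i, j, int w, int l, g, d, sum v {i..<j}])" for i j d
  have E: "E i j d ''i'' = Some i" "E i j d ''j'' = Some j" "E i j d ''w'' = Some (int w)"
    "E i j d ''l'' = Some (int l)" "E i j d ''g'' = Some g" "E i j d ''o'' = Some d"
    "E i j d ''n'' = Some (sum v {i..<j})" for i j d
    unfolding E_def by simp_all
  have "run L P ({i..<j} \<union> {g + i<..<g + j} \<union> D i j d) (D i j d) (E i j d) pack_com M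
    (\<lambda>r M' c s. T i j d M' \<and> c + 50 \<le> 100 * nat (j - i) \<and> s \<le> 50 * (k + 1))"
    using assms(1) word(3-) M disj k unfolding D_def[symmetric]
  proof (induction arbitrary: d k)
    case (one i)
    have i: "{i..<i + 1} = {i}" by auto
    show ?case
      apply (subst pack_com_def)
      apply (rule run_Cond[where i="if v i = 0 then 1 else 0"])
        apply (simp add: E word_result_def w01 i)
       apply (rule run_Ret[where v=0])
        apply (simp add: word_result_def w01)
       apply (simp add: T_def array_at_def split: if_splits)
      apply (rule run_Cond[where i=1])
        apply (simp add: E word_result_def w01)
       prefer 2 apply simp
      apply (rule run_Bind[where N="\<lambda>r M' c s. r = M i \<and> M' = M \<and> c = 2 \<and> s = 2"])
       apply (rule run_Read[where i=i])
      using one apply (simp_all add: E)[5]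
      apply clarify
      apply (rule run_Write[where i=d and v="grp w l (M i)"])
           apply (simp add: E)
          apply (rule one)
         apply (rule exp_val_head)
             apply (simp_all add: E word(1,2) split: if_splits)
      using v[of i] apply (simp_all add: D_def i T_def array_at_def)
      done
  next
    case (split i j m d k)
    have m: "i < m" "m < j" "j - i \<noteq> 1" using split.hyps(1,2) by auto
    obtain k' where k': "k = Suc k'" using split.prems(9) m by (cases k) auto
    have k'': "m - i \<le> 2 ^ k'" "j - m \<le> 2 ^ k'"
      using split.prems(9) split.hyps(2) unfolding k' by auto
    let ?c = "sum v {i..<m}"
    have ij: "{i..<j} = {i..<m} \<union> {m..<j}" using m by auto
    have sum: "sum v {i..<j} = ?c + sum v {m..<j}" unfolding ij by (subst sum.union_disjoint) auto
    note b = sum_bits_bounds[of v i m, OF v] sum_bits_bounds[of v m j, OF v]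
    have L2: "(2::int) < 2 ^ L" using split.prems(1,2) m by auto
    have w: "is_word L 2" "is_word L ((j - i) div 2)" "is_word L m" "is_word L (g + m)"
      "is_word L ?c" "is_word L (j - i)" "is_word L (d + ?c)" "is_word L (sum v {i..<j} - ?c)"
      using L2 split.prems(1-6) m b sum by (auto simp: is_word_def)
    have D: "D i j d = D i m d \<union> D m j (d + ?c)" "D i m d \<inter> D m j (d + ?c) = {}"
      using b m unfolding D_def sum by auto
    have dj: "D i m d \<inter> ({i..<m} \<union> {g + i<..<g + m}) = {}"
      "D m j (d + ?c) \<inter> ({m..<j} \<union> {g + m<..<g + j}) = {}"
      "D i m d \<inter> ({m..<j} \<union> {g + m<..<g + j} \<union> D m j (d + ?c)) = {}"
      "D m j (d + ?c) \<inter> ({i..<m} \<union> {g + i<..<g + m} \<union> D i m d) = {}"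
    proof -
      have "{g + i<..<g + m} \<subseteq> {g + i<..<g + j}" "{g + m<..<g + j} \<subseteq> {g + i<..<g + j}" using m by auto
      then show "D i m d \<inter> ({i..<m} \<union> {g + i<..<g + m}) = {}"
        "D m j (d + ?c) \<inter> ({m..<j} \<union> {g + m<..<g + j}) = {}"
        "D i m d \<inter> ({m..<j} \<union> {g + m<..<g + j} \<union> D m j (d + ?c)) = {}"
        "D m j (d + ?c) \<inter> ({i..<m} \<union> {g + i<..<g + m} \<union> D i m d) = {}"
        using split.prems(8) D(2) unfolding ij D(1) by blast+
    qed
    have pre1: "0 \<le> i" "m < 2 ^ L" "0 \<le> g + i" "g + m \<le> 2 ^ L" "0 \<le> d" "d + ?c < 2 ^ L"
      "\<And>p. p \<in> {i..<m} \<Longrightarrow> is_word L (M p)" "D i m d \<inter> ({i..<m} \<union> {g + i<..<g + m}) = {}" "m - i \<le> 2 ^ k'"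
      using split.prems(1-7) m b sum k'' dj by auto
    have pre2: "0 \<le> m" "j < 2 ^ L" "0 \<le> g + m" "g + j \<le> 2 ^ L" "0 \<le> d + ?c"
        "d + ?c + sum v {m..<j} < 2 ^ L"
      "\<And>p. p \<in> {m..<j} \<Longrightarrow> is_word L (M p)" "D m j (d + ?c) \<inter> ({m..<j} \<union> {g + m<..<g + j}) = {}"
          "j - m \<le> 2 ^ k'"
      using split.prems(1-7) m b sum k'' dj by auto
    let ?\<rho> = "(E i j d)(''m'' \<mapsto> m, ''c'' \<mapsto> ?c)"
    have left: "run L P ({i..<m} \<union> {g + i<..<g + m} \<union> D i m d) (D i m d) ?\<rho>
       (Call ''pack'' [Var ''i'', Var ''m'', Var ''w'', Var ''l'', Var ''g'', Var ''o'', Var ''c'']) M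
       (\<lambda>r M' c s. T i m d M' \<and> c + 42 \<le> 100 * nat (m - i) \<and> s \<le> 50 * (k' + 1) + 8)"
      apply (rule run_Call[OF proc, where vs="[i, m, int w, int l, g, d, ?c]"])
        apply simp
       apply (simp add: E)
      apply (fold E_def)
      apply (rule run_conseq[OF split.IH(1)[of d k']])
      using pre1 apply auto
      done
    have right: "run L P ({m..<j} \<union> {g + m<..<g + j} \<union> D m j (d + ?c)) (D m j (d + ?c)) ?\<rho>
       (Call ''pack'' [Var ''m'', Var ''j'', Var ''w'', Var ''l'', Var ''g'',
          plus_e (Var ''o'') (Var ''c''), minus_e (Var ''n'') (Var ''c'')]) M
       (\<lambda>r M' c s. T m j (d + ?c) M' \<and> c + 38 \<le> 100 * nat (j - m) \<and> s \<le> 50 * (k' + 1) + 12)"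
      apply (rule run_Call[OF proc, where vs="[m, j, int w, int l, g, d + ?c, sum v {m..<j}]"])
        apply simp
       using w apply (simp add: E word_result_def sum)
      apply (fold E_def)
      apply (rule run_conseq[OF split.IH(2)[of "d + ?c" k']])
      using pre2 apply auto
      done
    have ups: "[i..j - 1] = [i..m - 1] @ [m..j - 1]" using upto_split1[of i m "j - 1"] m by simp
    have T: "T i j d M3" if "T i m d M1" "T m j (d + ?c) M2" "\<And>x. x \<in> D i m d \<Longrightarrow> M3 x = M1 x"
       "\<And>x. x \<in> D m j (d + ?c) \<Longrightarrow> M3 x = M2 x" for M1 M2 M3
    proof -
      have "T i m d M3" "T m j (d + ?c) M3"
        using that unfolding T_def array_at_def D_def sum_bits_length[of v, OF v] by auto
      then show ?thesis
        unfolding T_def ups sum_bits_length[of v, OF v] by (simp add: array_at_append)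
    qed
    show ?case
      apply (subst pack_com_def)
      apply (rule run_Cond[where i="if sum v {i..<j} = 0 then 1 else 0"])
        apply (simp add: E word_result_def w01)
       apply (rule run_Ret[where v=0])
        apply (simp add: word_result_def w01)
      subgoal
        using m by (simp add: T_def array_at_def sum_bits_length[of v, OF v] split: if_splits)
      apply (rule run_Cond[where i=0])
        apply (simp add: E word_result_def w01 m w)
       apply simp
      apply (rule run_Bind_Ret[where v=m])
        apply (simp add: word_result_def E w flip: split.hyps(2))
      apply (rule run_Bind[where N="\<lambda>r M' c s. r = ?c \<and> M' = M \<and> c = 4 \<and> s = 4"])
       apply (rule run_Read[where i="g + m"])
           apply (simp add: word_result_def E w)
      using split.prems(1-6) m w split.hyps(3) apply (auto simp: word_result_def)[4]
      apply clarify
      apply (rule run_Fork[OF left right])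
             apply (rule dj(3))
            apply (rule dj(4))
           apply (rule D(2))
          using m apply (simp add: D(1) ij) apply force
         apply (simp add: D(1))
      apply (elim conjE)
      subgoal for \<dots> r1 M1 c1 s1 r2 M2 c2 s2 M3
        apply (rule run_Ret[where v=0])
         apply (simp add: word_result_def w01)
        using T[of M1 M2 M3] m by (auto simp: k')
      done
  qed
  then show ?thesis unfolding D_def T_def E_def .
qed

section \<open>Stored trees as sets of keys\<close>

text \<open>Hides the abstract tree: from here on memory is described by the key set that it
  represents.\<close>

definition holds :: "mem \<Rightarrow> nat \<Rightarrow> int \<Rightarrow> int set \<Rightarrow> int set \<Rightarrow> bool" where
  "holds M w a F K \<longleftrightarrow> (\<exists>t. stored M t w a F \<and> is_veb t w K)"

lemma stored_frame:
  assumes "stored M t w a F" "\<And>x. x \<in> F \<Longrightarrow> M' x = M x"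
  shows "stored M' t w a F"
  using assms
proof (induction t arbitrary: w a F)
  case (Node s c mn mx)
  from Node.prems(1) obtain Fs Fc where *:
    "M a = encode w mn" "M (a + 1) = encode w mx"
    "stored M s (high_bits w) (M (a + 2)) Fs"
    "\<forall>h\<in>{0..<2 ^ high_bits w}. stored M (c h) (low_bits w) (M (M (a + 3) + h)) (Fc h)"
    "{a..<a + 4} \<inter> {M (a + 3)..<M (a + 3) + 2 ^ high_bits w} = {}"
    "Fs \<inter> ({a..<a + 4} \<union> {M (a + 3)..<M (a + 3) + 2 ^ high_bits w}) = {}"
    "\<forall>h\<in>{0..<2 ^ high_bits w}. Fc h \<inter> ({a..<a + 4} \<union> {M (a + 3)..<M (a + 3) + 2 ^ high_bits w} \<union>
        Fs) = {}"
    "disjoint_family_on Fc {0..<2 ^ high_bits w}"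
    "F = {a..<a + 4} \<union> {M (a + 3)..<M (a + 3) + 2 ^ high_bits w} \<union> Fs \<union> (\<Union>h\<in>{0..<2 ^ high_bits w}. Fc h)"
    unfolding stored.simps Let_def by blast
  have "a \<in> F" "a + 1 \<in> F" "a + 2 \<in> F" "a + 3 \<in> F" unfolding *(9) by auto
  then have eq: "M' a = M a" "M' (a + 1) = M (a + 1)" "M' (a + 2) = M (a + 2)" "M' (a + 3) = M (a + 3)"
    using Node.prems(2) by blast+
  have tab: "M' (M (a + 3) + h) = M (M (a + 3) + h)" if "h \<in> {0..<2 ^ high_bits w}" for h
    using that by (intro Node.prems(2)) (auto simp: *(9))
  have "stored M' s (high_bits w) (M (a + 2)) Fs"
    using Node.IH(1)[OF *(3)] Node.prems(2) *(9) by blast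
  moreover have "stored M' (c h) (low_bits w) (M (M (a + 3) + h)) (Fc h)"
      if "h \<in> {0..<2 ^ high_bits w}" for h
    by (rule Node.IH(2)[OF rangeI *(4)[rule_format, OF that]]) (use Node.prems(2) *(9) that in blast)
  ultimately show ?case
    unfolding stored.simps Let_def eq using *(1,2,5-9) tab
        by (intro conjI exI[of _ Fs] exI[of _ Fc]) auto
qed auto

lemma holds_frame:
  assumes "holds M w a F K" "\<And>x. x \<in> F \<Longrightarrow> M' x = M x"
  shows "holds M' w a F K"
  using assms(1) stored_frame[where M=M and M'=M', OF _ assms(2)] unfolding holds_def by blast

lemma holds_leaf:
  assumes "w < 2"
  shows "holds M w a F K \<longleftrightarrow> K \<subseteq> {0..<2 ^ w} \<and> F = {a, a + 1} \<and>
    M a = encode w (min_key K) \<and> M (a + 1) = encode w (max_key K)"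
proof
  assume "holds M w a F K"
  then obtain t where t: "stored M t w a F" "is_veb t w K" unfolding holds_def by blast
  with assms show "K \<subseteq> {0..<2 ^ w} \<and> F = {a, a + 1} \<and>
    M a = encode w (min_key K) \<and> M (a + 1) = encode w (max_key K)"
    by (cases t) auto
next
  assume "K \<subseteq> {0..<2 ^ w} \<and> F = {a, a + 1} \<and>
    M a = encode w (min_key K) \<and> M (a + 1) = encode w (max_key K)"
  with assms show "holds M w a F K"
    unfolding holds_def by (intro exI[of _ "Leaf (min_key K) (max_key K)"]) auto
qed

abbreviation heads :: "nat \<Rightarrow> int set" where "heads w \<equiv> {0..<2 ^ high_bits w}"

definition clus :: "nat \<Rightarrow> int set \<Rightarrow> int \<Rightarrow> int set" where
  "clus w I h = low w ` {x \<in> I. high w x = h}"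

text \<open>A node is separated into what deletion preserves (\<open>layout\<close>,
  \<open>links\<close>) and what the recursive calls rewrite (\<open>inner_holds\<close>). The
  latter speaks of an arbitrary set \<open>I\<close>, since between the stages of a deletion the
  keys in summary and clusters need not be the inner keys belonging to the current header.\<close>

definition layout :: "nat \<Rightarrow> int \<Rightarrow> int \<Rightarrow> int set \<Rightarrow> (int \<Rightarrow> int set) \<Rightarrow> bool" where
  "layout w a t Fs Fc \<longleftrightarrow>
     {a..<a + 4} \<inter> {t..<t + 2 ^ high_bits w} = {} \<and>
     Fs \<inter> ({a..<a + 4} \<union> {t..<t + 2 ^ high_bits w}) = {} \<and>
     (\<forall>h\<in>heads w. Fc h \<inter> ({a..<a + 4} \<union> {t..<t + 2 ^ high_bits w} \<union> Fs) = {}) \<and>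
     disjoint_family_on Fc (heads w)"

definition links :: "mem \<Rightarrow> nat \<Rightarrow> int \<Rightarrow> int \<Rightarrow> int \<Rightarrow> (int \<Rightarrow> int) \<Rightarrow> bool" where
  "links M w a s t ca \<longleftrightarrow> M (a + 2) = s \<and> M (a + 3) = t \<and> (\<forall>h\<in>heads w. M (t + h) = ca h)"

definition inner_holds ::
  "mem \<Rightarrow> nat \<Rightarrow> int \<Rightarrow> (int \<Rightarrow> int) \<Rightarrow> int set \<Rightarrow> (int \<Rightarrow> int set) \<Rightarrow> int set \<Rightarrow> bool" where
  "inner_holds M w s ca Fs Fc I \<longleftrightarrow> holds M (high_bits w) s Fs (high w ` I) \<and>
     (\<forall>h\<in>heads w. holds M (low_bits w) (ca h) (Fc h) (clus w I h))"

definition node_cells :: "nat \<Rightarrow> int \<Rightarrow> int \<Rightarrow> int set \<Rightarrow> (int \<Rightarrow> int set) \<Rightarrow> int set" where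
  "node_cells w a t Fs Fc = {a..<a + 4} \<union> {t..<t + 2 ^ high_bits w} \<union> Fs \<union> (\<Union>h\<in>heads w. Fc h)"

lemma holds_node:
  assumes "2 \<le> w"
  shows "holds M w a F K \<longleftrightarrow> K \<subseteq> {0..<2 ^ w} \<and>
    M a = encode w (min_key K) \<and> M (a + 1) = encode w (max_key K) \<and>
    (\<exists>s t ca Fs Fc. layout w a t Fs Fc \<and> links M w a s t ca \<and>
       inner_holds M w s ca Fs Fc (inner_keys K) \<and> F = node_cells w a t Fs Fc)"
    (is "_ \<longleftrightarrow> ?R")
proof
  assume "holds M w a F K"
  then obtain v where v: "stored M v w a F" "is_veb v w K" unfolding holds_def by blast
  with assms obtain s c mn mx where "v = Node s c mn mx" by (cases v) auto
  note v = v[unfolded this stored.simps is_veb.simps Let_def]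
  from v(1) obtain Fs Fc where *:
    "stored M s (high_bits w) (M (a + 2)) Fs"
    "\<forall>h\<in>heads w. stored M (c h) (low_bits w) (M (M (a + 3) + h)) (Fc h)"
    "layout w a (M (a + 3)) Fs Fc" "F = node_cells w a (M (a + 3)) Fs Fc"
    unfolding layout_def node_cells_def by blast
  have "inner_holds M w (M (a + 2)) (\<lambda>h. M (M (a + 3) + h)) Fs Fc (inner_keys K)"
    using * v(2) unfolding inner_holds_def holds_def clus_def by blast
  moreover have "links M w a (M (a + 2)) (M (a + 3)) (\<lambda>h. M (M (a + 3) + h))" by (simp add: links_def)
  moreover have "K \<subseteq> {0..<2 ^ w}" "M a = encode w (min_key K)" "M (a + 1) = encode w (max_key K)"
    using v by auto
  ultimately show ?R using *(3,4) by blast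
next
  assume ?R
  then obtain s t ca Fs Fc where *: "K \<subseteq> {0..<2 ^ w}" "M a = encode w (min_key K)"
    "M (a + 1) = encode w (max_key K)" "layout w a t Fs Fc" "links M w a s t ca"
    "inner_holds M w s ca Fs Fc (inner_keys K)" "F = node_cells w a t Fs Fc" by blast
  from *(6) obtain v where v: "stored M v (high_bits w) s Fs"
      "is_veb v (high_bits w) (high w ` inner_keys K)"
    unfolding inner_holds_def holds_def by blast
  from *(6) have "\<forall>h\<in>heads w. \<exists>u. stored M u (low_bits w) (ca h) (Fc h) \<and>
      is_veb u (low_bits w) (clus w (inner_keys K) h)"
    unfolding inner_holds_def holds_def by blast
  then obtain c where c: "\<forall>h\<in>heads w. stored M (c h) (low_bits w) (ca h) (Fc h) \<and>
      is_veb (c h) (low_bits w) (clus w (inner_keys K) h)" by metis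
  have "stored M (Node v c (min_key K) (max_key K)) w a F"
    unfolding stored.simps Let_def
    by (intro conjI exI[of _ Fs] exI[of _ Fc])
      (use * v(1) c in \<open>auto simp: layout_def links_def node_cells_def\<close>)
  moreover have "is_veb (Node v c (min_key K) (max_key K)) w K"
    using *(1) v(2) c assms by (auto simp: clus_def)
  ultimately show "holds M w a F K" unfolding holds_def by blast
qed

lemma holds_header:
  assumes "holds M w a F K"
  shows "a \<in> F" "a + 1 \<in> F" "M a = encode w (min_key K)" "M (a + 1) = encode w (max_key K)"
    "K \<subseteq> {0..<2 ^ w}" "finite K"
proof -
  have "a \<in> F \<and> a + 1 \<in> F \<and> M a = encode w (min_key K) \<and> M (a + 1) = encode w (max_key K) \<and>
    K \<subseteq> {0..<2 ^ w}"
  proof (cases "w < 2")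
    case True
    then show ?thesis using assms by (simp add: holds_leaf)
  next
    case False
    then obtain s t ca Fs Fc where "K \<subseteq> {0..<2 ^ w}" "M a = encode w (min_key K)"
      "M (a + 1) = encode w (max_key K)" "F = node_cells w a t Fs Fc"
      using assms holds_node[of w M a F K] by auto
    moreover have "a \<in> node_cells w a t Fs Fc" "a + 1 \<in> node_cells w a t Fs Fc"
      unfolding node_cells_def by auto
    ultimately show ?thesis by simp
  qed
  then show "a \<in> F" "a + 1 \<in> F" "M a = encode w (min_key K)" "M (a + 1) = encode w (max_key K)"
    "K \<subseteq> {0..<2 ^ w}" by auto
  then show "finite K" using finite_subset by blast
qed

lemma encode_min_key:
  "encode w (min_key K) = (if K = {} then 2 ^ w else Min K)"
  "encode w (max_key K) = (if K = {} then -1 else Max K)"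
  by (auto simp: min_key_def max_key_def)

text \<open>The emptiness test of \<open>extract_com\<close>: an empty tree stores \<open>-1\<close>
  as maximum and \<open>2 ^ w\<close> as minimum, whereas otherwise the minimum is at most the
  maximum.\<close>

lemma encode_less_iff:
  assumes "finite K"
  shows "encode w (max_key K) < encode w (min_key K) \<longleftrightarrow> K = {}"
proof -
  have "(-1::int) < 2 ^ w" by (smt (verit) zero_less_power)
  moreover have "\<not> Max K < Min K" if "K \<noteq> {}"
  proof -
    have "Min K \<le> Max K" using Min_in[OF assms that] assms by simp
    then show ?thesis by simp
  qed
  ultimately show ?thesis by (cases "K = {}") (auto simp: encode_min_key)
qed

section \<open>Arithmetic of the splitting into high and low bits\<close>

lemma high_low_bits: "high_bits w + low_bits w = w" "high_bits w \<le> low_bits w"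
  "low_bits w \<le> w" "high_bits w \<le> w"
  by (auto simp: high_bits_def low_bits_def)

lemma high_low_bits_less: "2 \<le> w \<Longrightarrow> low_bits w < w" "2 \<le> w \<Longrightarrow> high_bits w < w"
  "2 \<le> w \<Longrightarrow> 1 \<le> low_bits w" "2 \<le> w \<Longrightarrow> 1 \<le> high_bits w"
  by (auto simp: high_bits_def low_bits_def)

lemma high_low: "high w x * 2 ^ low_bits w + low w x = x"
  unfolding high_def low_def by (rule div_mult_mod_eq)

lemma high_eq_grp: "high w (x mod 2 ^ w) = grp w (low_bits w) x"
  by (simp add: high_def grp_def)

lemma low_mod: "low w (x mod 2 ^ w) = x mod 2 ^ low_bits w"
  unfolding low_def by (rule mod_mod_cancel) (simp add: le_imp_power_dvd high_low_bits)

lemma high_mem_heads: "x \<in> {0..<2 ^ w} \<Longrightarrow> high w x \<in> heads w"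
  using grp_bounds[OF high_low_bits(3)[of w], of x] high_low_bits(1)[of w]
  by (simp add: high_def grp_def) (metis add_diff_cancel_right')

lemma high_mono: "x \<le> y \<Longrightarrow> high w x \<le> high w y"
  by (simp add: high_def zdiv_mono1)

lemma low_less: "x < y \<Longrightarrow> high w x = high w y \<Longrightarrow> low w x < low w y"
  using high_low[of w x] high_low[of w y] by simp

text \<open>High and low bits together determine a key, so \<open>low w\<close> is injective within
  one cluster and its image commutes with set difference.\<close>

lemma clus_diff: "clus w (I - X) h = clus w I h - clus w X h"
proof -
  have "x = y" if "low w x = low w y" "high w x = high w y" for x y
    using that by (metis high_low)
  then have "inj_on (low w) {x. high w x = h}" by (auto intro: inj_onI)
  then have "low w ` ({x \<in> I. high w x = h} - {x \<in> X. high w x = h}) = clus w I h - clus w X h"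
    unfolding clus_def by (rule inj_on_image_set_diff) auto
  moreover have "{x \<in> I. high w x = h} - {x \<in> X. high w x = h} = {x \<in> I - X. high w x = h}" by auto
  ultimately show ?thesis by (simp add: clus_def)
qed

lemma clus_empty_iff: "clus w I h = {} \<longleftrightarrow> h \<notin> high w ` I"
  by (auto simp: clus_def)

text \<open>A head leaves the summary exactly when its cluster loses its last key. This justifies
  using the emptiness flags to form the batch for the summary.\<close>

lemma high_diff:
  assumes "X \<subseteq> I"
  shows "high w ` (I - X) = high w ` I - {h \<in> high w ` X. clus w I h - clus w X h = {}}"
  unfolding clus_diff[symmetric] clus_empty_iff using assms by auto

text \<open>The division by \<open>2 ^ low_bits w\<close> is monotone, so the least key has the
  least head, and within a cluster the order is that of the low bits. Hence the smallest inner key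
  is found with constantly many reads.\<close>

lemma Min_eq_high_low:
  assumes "finite I" "I \<noteq> {}"
  shows "Min (high w ` I) * 2 ^ low_bits w + Min (clus w I (Min (high w ` I))) = Min I"
proof -
  let ?h = "Min (high w ` I)"
  have h: "high w (Min I) = ?h"
    using assms high_mono by (intro Min_eqI[symmetric]) auto
  have "Min (clus w I ?h) = low w (Min I)"
  proof (rule Min_eqI)
    show "finite (clus w I ?h)" using assms by (simp add: clus_def)
    show "low w (Min I) \<in> clus w I ?h" using assms h by (auto simp: clus_def)
    fix y assume "y \<in> clus w I ?h"
    then obtain x where x: "x \<in> I" "high w x = ?h" "y = low w x" by (auto simp: clus_def)
    then have "Min I \<le> x" using assms by simp
    then show "low w (Min I) \<le> y" using low_less[of "Min I" x w] x h by (cases "Min I = x") auto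
  qed
  then show ?thesis using high_low[of w "Min I"] h by simp
qed

lemma Max_eq_high_low:
  assumes "finite I" "I \<noteq> {}"
  shows "Max (high w ` I) * 2 ^ low_bits w + Max (clus w I (Max (high w ` I))) = Max I"
proof -
  let ?h = "Max (high w ` I)"
  have h: "high w (Max I) = ?h"
    using assms high_mono by (intro Max_eqI[symmetric]) auto
  have "Max (clus w I ?h) = low w (Max I)"
  proof (rule Max_eqI)
    show "finite (clus w I ?h)" using assms by (simp add: clus_def)
    show "low w (Max I) \<in> clus w I ?h" using assms h by (auto simp: clus_def)
    fix y assume "y \<in> clus w I ?h"
    then obtain x where x: "x \<in> I" "high w x = ?h" "y = low w x" by (auto simp: clus_def)
    then have "x \<le> Max I" using assms by simp
    then show "y \<le> low w (Max I)" using low_less[of x "Max I" w] x h by (cases "Max I = x") auto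
  qed
  then show ?thesis using high_low[of w "Max I"] h by simp
qed

lemma inner_keys_eq: "K \<noteq> {} \<Longrightarrow> inner_keys K = K - {Min K, Max K}"
  by (auto simp: inner_keys_def min_key_def max_key_def)

text \<open>The new minimum and maximum \<open>r\<close> and \<open>t\<close> of a node, and the inner keys \<open>I3\<close> that remain when
  they have replaced deleted ones.\<close>

lemma delete_keys:
  fixes K X :: "int set"
  assumes K: "K \<noteq> {}" "K \<subseteq> {0..<2 ^ w}" "X \<subseteq> K"
    and I1: "I1 = inner_keys K - X"
    and r: "r = (if Min K \<in> X then if I1 = {} then if Max K \<in> X then 2 ^ w else Max K else Min I1
        else Min K)"
    and I2: "I2 = (if Min K \<in> X then I1 - {Min I1} else I1)"
    and t: "t = (if Max K \<in> X then if I2 = {} then if r = 2 ^ w then - 1 else r else Max I2 else Max K)"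
    and I3: "I3 = (if Max K \<in> X then I2 - {Max I2} else I2)"
  shows "r = encode w (min_key (K - X))" "t = encode w (max_key (K - X))" "I3 = inner_keys (K - X)"
    "r = 2 ^ w \<longleftrightarrow> K - X = {}"
proof -
  have fin: "finite K" using K(2) by (rule finite_subset) simp
  have mm: "Min K \<in> K" "Max K \<in> K" "\<And>x. x \<in> K \<Longrightarrow> Min K \<le> x" "\<And>x. x \<in> K \<Longrightarrow> x \<le> Max K"
    using fin K(1) by auto
  have I1': "I1 = K - X - {Min K, Max K}" using I1 inner_keys_eq[OF K(1)] by auto
  have KX: "K - X = I1 \<union> ({Min K, Max K} - X)" using I1' mm by auto
  have fI1: "finite I1" using fin I1' by simp
  have I1b: "\<And>x. x \<in> I1 \<Longrightarrow> Min K < x" "\<And>x. x \<in> I1 \<Longrightarrow> x < Max K"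
    using mm I1' by (metis DiffE insertCI order_le_less)+
  have m1: "Min I1 \<in> I1" "\<And>x. x \<in> I1 \<Longrightarrow> Min I1 \<le> x" "Max I1 \<in> I1" "\<And>x. x \<in> I1 \<Longrightarrow> x \<le> Max I1" if "I1 \<noteq> {}"
    using fI1 that by auto
  have lt: "x < 2 ^ w" if "x \<in> K" for x using K(2) that by auto
  \<comment> \<open>Every case except the emptied tree is settled by this, once the remaining set
    \<open>S\<close> and its extremes have been identified.\<close>
  have G: "r = encode w (min_key (K - X)) \<and> t = encode w (max_key (K - X)) \<and> I3 = inner_keys (K - X) \<and>
      (r = 2 ^ w \<longleftrightarrow> K - X = {})"
    if "K - X = S" "r \<in> S" "t \<in> S" "\<And>x. x \<in> S \<Longrightarrow> r \<le> x" "\<And>x. x \<in> S \<Longrightarrow> x \<le> t" "I3 = S - {r, t}" for S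
  proof -
    have "finite S" using that(1) fin by blast
    then have "Min S = r" "Max S = t" using that by (auto intro: Min_eqI Max_eqI)
    moreover have "r < 2 ^ w" using that(1,2) lt by blast
    ultimately show ?thesis using that by (auto simp: encode_min_key inner_keys_eq)
  qed
  have "r = encode w (min_key (K - X)) \<and> t = encode w (max_key (K - X)) \<and> I3 = inner_keys (K - X) \<and>
      (r = 2 ^ w \<longleftrightarrow> K - X = {})"
  proof (cases "Min K \<in> X"; cases "Max K \<in> X"; cases "I1 = {}")
    assume "Min K \<in> X" "Max K \<in> X" "I1 = {}"
    moreover from this have "K - X = {}" using KX by simp
    ultimately show ?thesis using I2 I3 r t unfolding \<open>K - X = {}\<close>
        by (simp add: encode_min_key inner_keys_def)
  next
    assume pq: "Min K \<in> X" "Max K \<in> X" and ne: "I1 \<noteq> {}"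
    then have S: "K - X = I1" using KX by simp
    have r': "r = Min I1" using r pq ne by simp
    have I2': "I2 = I1 - {Min I1}" using I2 pq by simp
    have "Min I1 \<in> K - X" unfolding S by (rule m1(1)[OF ne])
    \<comment> \<open>The default for the new maximum tests \<open>r = 2 ^ w\<close> to recognise
      the empty tree; a genuine key must not be mistaken for it.\<close>
    then have rlt: "r \<noteq> 2 ^ w" using lt[of "Min I1"] r' by simp
    show ?thesis
    proof (cases "I2 = {}")
      case True
      then have "I1 = {r}" using I2' m1(1)[OF ne] r' by auto
      moreover have "t = r" using t pq True rlt by simp
      ultimately show ?thesis using S True I3 by (intro G) auto
    next
      case False
      then have t': "t = Max I2" using t pq by simp
      have fI2: "finite I2" using I2' fI1 by simp
      have tm: "t \<in> I2" "\<And>x. x \<in> I2 \<Longrightarrow> x \<le> t" unfolding t' using fI2 False by simp_all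
      have S2: "K - X = insert r I2" unfolding S I2' r' using m1(1)[OF ne] by auto
      have rm: "r \<notin> I2" "\<And>x. x \<in> I2 \<Longrightarrow> r \<le> x" using m1(2)[OF ne] unfolding r' I2' by auto
      have "I3 = I2 - {t}" using I3 pq t' by simp
      then show ?thesis using tm rm by (intro G[OF S2]) auto
    qed
  next
    assume pq: "Min K \<in> X" "Max K \<notin> X" and ne: "I1 = {}"
    then have S: "K - X = {Max K}" using KX by auto
    have "r = Max K" "t = Max K" "I3 = {}" using r t I2 I3 pq ne by simp_all
    then show ?thesis by (intro G[OF S]) auto
  next
    assume pq: "Min K \<in> X" "Max K \<notin> X" and ne: "I1 \<noteq> {}"
    then have S: "K - X = insert (Max K) I1" using KX by auto
    have rt: "r = Min I1" "t = Max K" "I3 = I1 - {Min I1}" using r t I2 I3 pq ne by simp_all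
    have "Max K \<notin> I1" "Min I1 \<le> Max K" using I1b m1(1)[OF ne] by force+
    then show ?thesis using m1(1,2)[OF ne] I1b by (intro G[OF S]) (auto simp: rt intro: less_imp_le)
  next
    assume pq: "Min K \<notin> X" "Max K \<in> X" and ne: "I1 = {}"
    then have S: "K - X = {Min K}" using KX by auto
    have "r = Min K" using r pq by simp
    moreover have "r \<noteq> 2 ^ w" using calculation lt[OF mm(1)] by simp
    ultimately have "t = Min K" "I3 = {}" using t I2 I3 pq ne by simp_all
    then show ?thesis using \<open>r = Min K\<close> by (intro G[OF S]) auto
  next
    assume pq: "Min K \<notin> X" "Max K \<in> X" and ne: "I1 \<noteq> {}"
    then have S: "K - X = insert (Min K) I1" using KX by auto
    have rt: "r = Min K" "t = Max I1" "I3 = I1 - {Max I1}" using r t I2 I3 pq ne by simp_all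
    have "Min K \<notin> I1" "Min K \<le> Max I1" using I1b m1(3)[OF ne] by force+
    then show ?thesis using m1(3,4)[OF ne] I1b by (intro G[OF S]) (auto simp: rt intro: less_imp_le)
  next
    assume pq: "Min K \<notin> X" "Max K \<notin> X" and ne: "I1 = {}"
    then have S: "K - X = {Min K, Max K}" using KX by auto
    have rt: "r = Min K" "t = Max K" "I3 = {}" using r t I2 I3 pq ne by simp_all
    have "Min K \<le> Max K" using mm by blast
    then show ?thesis by (intro G[OF S]) (auto simp: rt)
  next
    assume pq: "Min K \<notin> X" "Max K \<notin> X" and ne: "I1 \<noteq> {}"
    then have S: "K - X = insert (Min K) (insert (Max K) I1)" using KX by auto
    have rt: "r = Min K" "t = Max K" "I3 = I1" using r t I2 I3 pq ne by simp_all
    have "Min K \<notin> I1" "Max K \<notin> I1" "Min K \<le> Max K" using I1b mm by force+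
    then show ?thesis using I1b by (intro G[OF S]) (auto simp: rt intro: less_imp_le)
  qed
  then show "r = encode w (min_key (K - X))" "t = encode w (max_key (K - X))" "I3 = inner_keys (K - X)"
    "r = 2 ^ w \<longleftrightarrow> K - X = {}"
    by blast+
qed

section \<open>Batches and cost bounds\<close>

text \<open>Residues are required to increase strictly, so that the entries represent distinct keys
  and \<open>n\<close> is the cardinality of \<open>X\<close>; the stored words themselves need not
  be ordered. The word condition makes the entries readable.\<close>

definition batch :: "nat \<Rightarrow> nat \<Rightarrow> mem \<Rightarrow> int \<Rightarrow> int \<Rightarrow> int set \<Rightarrow> bool" where
  "batch L w M i n X \<longleftrightarrow> X = (\<lambda>p. M p mod 2 ^ w) ` {i..<i + n} \<and>
     (\<forall>p\<in>{i..<i + n}. is_word L (M p)) \<and>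
     (\<forall>p\<in>{i..<i + n}. \<forall>q\<in>{i..<i + n}. p < q \<longrightarrow> M p mod 2 ^ w < M q mod 2 ^ w)"

lemma batch_frame:
  assumes "batch L w M i n X" "\<And>x. x \<in> {i..<i + n} \<Longrightarrow> M' x = M x"
  shows "batch L w M' i n X"
proof -
  have "(\<lambda>p. M' p mod 2 ^ w) ` {i..<i + n} = (\<lambda>p. M p mod 2 ^ w) ` {i..<i + n}"
    using assms(2) by (intro image_cong) auto
  then show ?thesis using assms unfolding batch_def by auto
qed

lemma batch_inj: "batch L w M i n X \<Longrightarrow> inj_on (\<lambda>p. M p mod 2 ^ w) {i..<i + n}"
  unfolding batch_def by (intro linorder_inj_onI') fastforce

lemma batch_card:
  assumes "batch L w M i n X" "0 \<le> n"
  shows "int (card X) = n"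
  using assms card_image[OF batch_inj[OF assms(1)]] by (simp add: batch_def)

text \<open>Therefore \<open>2 ^ w\<close> cells suffice for the partial sums and for the packed
  heads, and loops over a batch have depth at most \<open>w\<close>.\<close>

lemma batch_size:
  assumes "batch L w M i n X" "0 \<le> n"
  shows "n \<le> 2 ^ w"
proof -
  have "X \<subseteq> {0..<2 ^ w}" using assms(1) unfolding batch_def by auto
  then have "card X \<le> card {0..<2 ^ w :: int}" by (intro card_mono) auto
  also have "int (card {0..<2 ^ w :: int}) = 2 ^ w" by simp
  finally show ?thesis using batch_card[OF assms] by linarith
qed

lemma batch_of_array:
  assumes "array_at M b xs" "sorted_wrt (<) xs" "set xs \<subseteq> {0..<2 ^ w}" "(2::int) ^ w < 2 ^ L"
  shows "batch L w M b (int (length xs)) (set xs)"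
proof -
  have el: "M p = xs ! nat (p - b)" "nat (p - b) < length xs" if "p \<in> {b..<b + int (length xs)}" for p
  proof -
    show "nat (p - b) < length xs" using that by auto
    then show "M p = xs ! nat (p - b)" using assms(1)[unfolded array_at_def, rule_format, of "nat (p
        - b)"] that by simp
  qed
  have rng: "M p \<in> set xs" "0 \<le> M p" "M p < 2 ^ w" if "p \<in> {b..<b + int (length xs)}" for p
  proof -
    show 1: "M p \<in> set xs" unfolding el(1)[OF that] by (rule nth_mem[OF el(2)[OF that]])
    show "0 \<le> M p" "M p < 2 ^ w" using 1 assms(3) by auto
  qed
  then have md: "M p mod 2 ^ w = M p" if "p \<in> {b..<b + int (length xs)}" for p
    using that by (intro mod_pos_pos_trivial) auto
  have "set xs = M ` {b..<b + int (length xs)}"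
  proof
    show "set xs \<subseteq> M ` {b..<b + int (length xs)}"
    proof
      fix x assume "x \<in> set xs"
      then obtain k where "k < length xs" "x = xs ! k" by (metis in_set_conv_nth)
      then show "x \<in> M ` {b..<b + int (length xs)}"
        using assms(1) unfolding array_at_def by (intro image_eqI[of _ _ "b + int k"]) auto
    qed
  qed (use rng in auto)
  also have "\<dots> = (\<lambda>p. M p mod 2 ^ w) ` {b..<b + int (length xs)}" using md by (intro image_cong) auto
  finally have "set xs = (\<lambda>p. M p mod 2 ^ w) ` {b..<b + int (length xs)}" .
  moreover have "is_word L (M p)" if "p \<in> {b..<b + int (length xs)}" for p
    using rng[OF that] assms(4) unfolding is_word_def by (smt (verit))
  moreover have "M p < M q" if "p \<in> {b..<b + int (length xs)}" "q \<in> {b..<b + int (length xs)}"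
      "p < q" for p q
    using el[OF that(1)] el[OF that(2)] sorted_wrt_nth_less[OF assms(2), of "nat (p - b)"
        "nat (q - b)"] that by simp
  ultimately show ?thesis unfolding batch_def using md by auto
qed

text \<open>The number of levels, following the wider of the two halves. As
  \<open>high_bits w\<close> is at most \<open>low_bits w\<close>, it covers the summary as well by
  monotonicity.\<close>

function dep :: "nat \<Rightarrow> nat" where
  "dep w = (if w < 2 then 1 else 1 + dep (low_bits w))"
  by auto
termination by (relation "measure id") (auto simp: low_bits_def)

declare dep.simps [simp del]

lemma dep_mono: "v \<le> w \<Longrightarrow> dep v \<le> dep w"
proof (induction w arbitrary: v rule: less_induct)
  case (less w)
  show ?case
  proof (cases "v < 2")
    case True
    then show ?thesis by (subst (1 2) dep.simps) auto
  next
    case False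
    then have "dep (low_bits v) \<le> dep (low_bits w)"
      using less by (intro less.IH) (auto simp: low_bits_def)
    then show ?thesis using False less.prems by (subst (1 2) dep.simps) auto
  qed
qed

lemma dep_node: "2 \<le> w \<Longrightarrow> dep w = 1 + dep (low_bits w)"
  by (subst dep.simps) simp

lemma dep_le: "dep w \<le> max 1 w"
proof (induction w rule: less_induct)
  case (less w)
  show ?case
  proof (cases "w < 2")
    case True
    then show ?thesis by (simp add: dep.simps[of w])
  next
    case False
    then show ?thesis using less.IH[of "low_bits w"] high_low_bits_less[of w] by (simp add: dep_node)
  qed
qed

lemma dep_ge_1: "1 \<le> dep w" by (subst dep.simps) simp

lemma dep_le_log: "w \<le> 2 ^ k \<Longrightarrow> dep w \<le> k + 1"
proof (induction k arbitrary: w)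
  case 0
  then show ?case by (simp add: dep.simps)
next
  case (Suc k)
  show ?case
  proof (cases "w < 2")
    case True
    then show ?thesis by (simp add: dep.simps)
  next
    case False
    then show ?thesis using Suc.IH[of "low_bits w"] Suc.prems by (simp add: dep_node low_bits_def)
  qed
qed

text \<open>Size of the scratch region. It has to hold three tables of \<open>2 ^ w\<close> cells,
  one slice of size \<open>scr (low_bits w)\<close> for each cluster and one cell for an extracted
  key; see \<open>scr_fits\<close>.\<close>

definition scr :: "nat \<Rightarrow> int" where "scr w = 2 ^ (2 * (w + 1))"

abbreviation del_params :: "name list" where "del_params \<equiv> [''a'', ''w'', ''i'', ''n'', ''f'']"

text \<open>\<open>v = 1\<close> if the tree has become empty, and \<open>v = 0\<close> otherwise.  Deleting the last keys of a tree
  is cheaper than the general bound by almost the cost of one key; this pays for the deletion of its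
  head from the summary.\<close>

definition work_ok :: "nat \<Rightarrow> int \<Rightarrow> int \<Rightarrow> nat \<Rightarrow> bool" where
  "work_ok w n v c \<longleftrightarrow> int c + 3000 * int (dep w) * v \<le> 3000 * int (dep w) * n + 500 * v"

text \<open>The widths of clusters and summary add up to \<open>w\<close>, so each of the
  \<open>dep w\<close> levels of the span recurrence contributes \<open>O(w)\<close>. The maximum
  with \<open>1\<close> is for width \<open>0\<close>.\<close>

definition span_bd :: "nat \<Rightarrow> nat" where
  "span_bd w = 30000 * max 1 w * dep w"

abbreviation deletes ::
  "nat \<Rightarrow> nat \<Rightarrow> mem \<Rightarrow> int \<Rightarrow> int set \<Rightarrow> int set \<Rightarrow> int set \<Rightarrow> int \<Rightarrow> int \<Rightarrow> int \<Rightarrow> bool" where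
  "deletes L w M a F K X i n f \<equiv>
     run L veb_prog (F \<union> {i..<i + n} \<union> {f..<f + scr w}) (F \<union> {f..<f + scr w})
       (map_of (zip del_params [a, int w, i, n, f])) delete_com M
       (\<lambda>v M' c s. v = (if K \<subseteq> X then 1 else 0) \<and> holds M' w a F (K - X) \<and>
          work_ok w n v c \<and> s \<le> span_bd w)"

text \<open>The quantification over addresses, batch positions and scratch regions is what the
  recursion needs: clusters receive pieces of the original batch in place, the summary receives the
  packed array in scratch.\<close>

definition del_spec :: "nat \<Rightarrow> bool" where
  "del_spec w \<longleftrightarrow> (\<forall>L M a F K X i n f.
     holds M w a F K \<longrightarrow> batch L w M i n X \<longrightarrow> X \<subseteq> K \<longrightarrow> 1 \<le> n \<longrightarrow> F \<subseteq> {0..<2 ^ L} \<longrightarrow>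
     0 \<le> i \<longrightarrow> i + n < 2 ^ L \<longrightarrow> 0 \<le> f \<longrightarrow> f + scr w < 2 ^ L \<longrightarrow>
     F \<inter> {i..<i + n} = {} \<longrightarrow> F \<inter> {f..<f + scr w} = {} \<longrightarrow> {i..<i + n} \<inter> {f..<f + scr w} = {} \<longrightarrow>
     deletes L w M a F K X i n f)"

section \<open>Deletion of inner keys\<close>

text \<open>Setting of a call of \<open>inner\<close>. The batch lies either within the batch of the
  node or, for an extraction, in a single scratch cell in front of \<open>f\<close>. Because of this
  reserved cell the usable region has only \<open>scr w - 1\<close> cells.\<close>

locale veb_inner =
  fixes L w :: nat and M :: mem and a s t :: int and ca :: "int \<Rightarrow> int"
    and Fs :: "int set" and Fc :: "int \<Rightarrow> int set" and I X :: "int set" and i n f :: int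
  assumes w: "2 \<le> w"
    and low_spec: "del_spec (low_bits w)" and high_spec: "del_spec (high_bits w)"
    and links: "links M w a s t ca" and layout: "layout w a t Fs Fc"
    and inner: "inner_holds M w s ca Fs Fc I" and I: "I \<subseteq> {0..<2 ^ w}"
    and batch: "batch L w M i n X" and X: "X \<subseteq> I" and n: "1 \<le> n"
    and cells: "node_cells w a t Fs Fc \<subseteq> {0..<2 ^ L}"
    and i: "0 \<le> i" "i + n < 2 ^ L" and f: "0 \<le> f" "f + scr w \<le> 2 ^ L"
    and disj: "node_cells w a t Fs Fc \<inter> {i..<i + n} = {}"
      "node_cells w a t Fs Fc \<inter> {f..<f + scr w - 1} = {}"
      "{i..<i + n} \<inter> {f..<f + scr w - 1} = {}"
begin

abbreviation "pos \<equiv> {i..<i + n}"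
abbreviation "node \<equiv> node_cells w a t Fs Fc"
abbreviation "clusters \<equiv> \<Union>h\<in>heads w. Fc h"
abbreviation "lw \<equiv> low_bits w"
abbreviation "hw \<equiv> high_bits w"

definition hh :: "int \<Rightarrow> int" where "hh p = grp w lw (M p)"
definition lst :: "int \<Rightarrow> bool" where "lst p \<longleftrightarrow> p + 1 = i + n \<or> hh (p + 1) \<noteq> hh p"
definition first :: "int \<Rightarrow> bool" where "first p \<longleftrightarrow> p = i \<or> hh (p - 1) \<noteq> hh p"
definition gs :: "int \<Rightarrow> int" where "gs h = int (card {q \<in> pos. hh q = h})"

text \<open>\<open>g\<close>, \<open>d\<close> and \<open>u\<close> are the values of the registers
  \<open>g\<close>, \<open>o\<close> and \<open>v\<close> in \<open>inner_com\<close>, and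
  \<open>sub h\<close> is the scratch slice of cluster \<open>h\<close>.\<close>

definition g :: int where "g = f + 2 ^ w - i"
definition d :: int where "d = f + 2 ^ w + 2 ^ w"
definition u :: int where "u = f + 2 ^ w + 2 ^ w + 2 ^ w"
definition sub :: "int \<Rightarrow> int set" where "sub h = {u + h * scr lw..<u + h * scr lw + scr lw}"

text \<open>Comparison of exponents: since \<open>1 \<le> hw\<close>,
  \<open>hw + 2 * (lw + 1) + 1 \<le> 2 * (w + 1)\<close>, so the slices of the clusters fill at most
  half of the region; the other half has at least \<open>4 * 2 ^ w\<close> cells.\<close>

lemma scr_fits: "3 * 2 ^ w + 2 ^ hw * scr lw + 1 \<le> scr w"
proof -
  have hl: "hw + lw = w" "1 \<le> hw" using high_low_bits(1)[of w] high_low_bits_less[OF w] by auto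
  have "hw + 2 * (lw + 1) + 1 \<le> 2 * (w + 1)" using hl by simp
  then have "(2::int) ^ (hw + 2 * (lw + 1) + 1) \<le> scr w" unfolding scr_def
      by (rule power_increasing) simp
  then have 1: "2 * (2 ^ hw * scr lw) \<le> scr w" by (simp add: scr_def power_add algebra_simps)
  have "w + 3 \<le> 2 * (w + 1)" using w by simp
  then have "(2::int) ^ (w + 3) \<le> scr w" unfolding scr_def by (rule power_increasing) simp
  then have 2: "8 * 2 ^ w \<le> scr w" by (simp add: power_add)
  have "(1::int) \<le> 2 ^ w" by simp
  then show ?thesis using 1 2 by linarith
qed

lemma pow_bounds: "(1::int) \<le> 2 ^ w" "(2::int) ^ lw \<le> 2 ^ w" "(2::int) ^ hw \<le> 2 ^ w" "(4::int) \<le> 2 ^ w"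
  "4 \<le> scr lw" "scr hw \<le> scr lw" "(2::int) ^ w < 2 ^ L"
proof -
  show "(1::int) \<le> 2 ^ w" by simp
  show "(2::int) ^ lw \<le> 2 ^ w" "(2::int) ^ hw \<le> 2 ^ w" by (simp_all add: power_increasing high_low_bits)
  show "(4::int) \<le> 2 ^ w" using power_increasing[OF w, of "2::int"] by simp
  show "4 \<le> scr lw" unfolding scr_def using power_increasing[of 2 "2 * (lw + 1)" "2::int"] by simp
  show "scr hw \<le> scr lw" unfolding scr_def by (rule power_increasing) (use high_low_bits(2)[of w] in
      auto)
  have "0 \<le> (2::int) ^ hw * scr lw" by (simp add: scr_def)
  then show "(2::int) ^ w < 2 ^ L" using scr_fits f \<open>(1::int) \<le> 2 ^ w\<close> by linarith
qed

lemma n_le: "n \<le> 2 ^ w" using batch_size[OF batch] n by simp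

lemma sub_fits:
  assumes "h \<in> heads w"
  shows "u \<le> u + h * scr lw" "u + h * scr lw + scr lw \<le> f + scr w - 1" "sub h \<subseteq> {u..<f + scr w - 1}"
proof -
  show 1: "u \<le> u + h * scr lw" using assms pow_bounds(5) by simp
  have "(h + 1) * scr lw \<le> 2 ^ hw * scr lw" using assms pow_bounds(5) by (intro mult_right_mono) auto
  then show "u + h * scr lw + scr lw \<le> f + scr w - 1"
    using scr_fits unfolding u_def by (simp add: algebra_simps)
  then show "sub h \<subseteq> {u..<f + scr w - 1}" using 1 by (auto simp: sub_def)
qed

lemma sub_disjoint: "h \<noteq> h' \<Longrightarrow> sub h \<inter> sub h' = {}"
proof -
  have "sub h \<inter> sub h' = {}" if "h < h'" for h h'
  proof -
    have "(h + 1) * scr lw \<le> h' * scr lw" using that pow_bounds(5) by (intro mult_right_mono) auto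
    then show ?thesis by (auto simp: sub_def algebra_simps)
  qed
  then show "h \<noteq> h' \<Longrightarrow> sub h \<inter> sub h' = {}" by (metis Int_commute linorder_neqE)
qed

section \<open>Groups of batch positions with equal high bits\<close>

lemma hh_eq: "hh p = high w (M p mod 2 ^ w)" by (simp add: hh_def high_eq_grp)

lemma hh_heads: "hh p \<in> heads w"
  unfolding hh_eq by (rule high_mem_heads) simp

lemma hh_mono: "p \<in> pos \<Longrightarrow> q \<in> pos \<Longrightarrow> p \<le> q \<Longrightarrow> hh p \<le> hh q"
  unfolding hh_eq using batch unfolding batch_def
  by (intro high_mono) (cases "p = q"; fastforce)

lemma high_X: "high w ` X = hh ` pos"
  using batch unfolding batch_def hh_eq by (auto simp: image_image)

text \<open>Heads are monotone along the sorted batch, so equal heads are adjacent. With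
  \<open>first_unique\<close> this shows that distinct iterations of the loops write distinct table
  cells and work on distinct clusters.\<close>

lemma lst_unique:
  assumes "p \<in> pos" "q \<in> pos" "lst p" "lst q" "hh p = hh q"
  shows "p = q"
proof -
  have False if "p < q" "p \<in> pos" "q \<in> pos" "lst p" "hh p = hh q" for p q
    using hh_mono[of p "p + 1"] hh_mono[of "p + 1" q] that unfolding lst_def by auto
  then show ?thesis using assms by (metis linorder_neqE)
qed

lemma first_unique:
  assumes "p \<in> pos" "q \<in> pos" "first p" "first q" "hh p = hh q"
  shows "p = q"
proof -
  have False if "p < q" "p \<in> pos" "q \<in> pos" "first q" "hh p = hh q" for p q
    using hh_mono[of p "q - 1"] hh_mono[of "q - 1" q] that unfolding first_def by auto
  then show ?thesis using assms by (metis linorder_neqE)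
qed

lemma group:
  assumes "p \<in> pos" "first p"
  obtains q where "p \<le> q" "q \<in> pos" "lst q" "hh q = hh p"
    "{r \<in> pos. hh r = hh p} = {p..<q + 1}"
proof -
  let ?G = "{r \<in> pos. hh r = hh p}"
  define q where "q = Max ?G"
  have fin: "finite ?G" by (rule finite_subset[of _ "pos"]) auto
  have pG: "p \<in> ?G" using assms by simp
  then have qG: "q \<in> ?G" and qM: "\<And>r. r \<in> ?G \<Longrightarrow> r \<le> q"
    unfolding q_def using Max_in[OF fin] Max_ge[OF fin] by blast+
  have "lst q"
  proof (rule ccontr)
    assume "\<not> lst q"
    then have "q + 1 \<in> ?G" using qG by (auto simp: lst_def)
    then show False using qM[of "q + 1"] by simp
  qed
  moreover have "?G = {p..<q + 1}"
  proof
    show "?G \<subseteq> {p..<q + 1}"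
    proof
      fix r assume r: "r \<in> ?G"
      have "p \<le> r"
      proof (rule ccontr)
        assume "\<not> p \<le> r"
        then show False
          using hh_mono[of r "p - 1"] hh_mono[of "p - 1" p] r assms unfolding first_def by auto
      qed
      then show "r \<in> {p..<q + 1}" using qM[OF r] by simp
    qed
    show "{p..<q + 1} \<subseteq> ?G"
    proof
      fix r assume r: "r \<in> {p..<q + 1}"
      then have "r \<in> pos" using assms(1) qG by auto
      moreover have "hh r = hh p" using hh_mono[of p r] hh_mono[of r q] r assms(1) qG by auto
      ultimately show "r \<in> ?G" by simp
    qed
  qed
  ultimately show ?thesis using that[of q] qG qM[OF pG] by blast
qed

lemma first_exists:
  assumes "h \<in> high w ` X"
  obtains p where "p \<in> pos" "first p" "hh p = h"
proof -
  let ?G = "{r \<in> pos. hh r = h}"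
  have fin: "finite ?G" by (rule finite_subset[of _ "pos"]) auto
  have ne: "?G \<noteq> {}" using assms unfolding high_X by auto
  have m: "Min ?G \<in> ?G" by (rule Min_in[OF fin ne])
  have "first (Min ?G)"
  proof (rule ccontr)
    assume "\<not> first (Min ?G)"
    then have "Min ?G - 1 \<in> ?G" using m by (auto simp: first_def)
    then have "Min ?G \<le> Min ?G - 1" by (rule Min_le[OF fin])
    then show False by simp
  qed
  then show ?thesis using that[of "Min ?G"] m by blast
qed

text \<open>The groups partition the batch and are counted once each, at their first position. This
  bounds the total work of the deletions from clusters by the batch size.\<close>

lemma sum_gs: "(\<Sum>p\<in>{p \<in> pos. first p}. gs (hh p)) = n"
proof -
  have "inj_on hh {p \<in> pos. first p}" using first_unique by (auto intro: inj_onI)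
  moreover have "hh ` {p \<in> pos. first p} = hh ` pos"
  proof
    show "hh ` pos \<subseteq> hh ` {p \<in> pos. first p}"
    proof
      fix h assume "h \<in> hh ` pos"
      then obtain p where "p \<in> pos" "first p" "hh p = h" using first_exists[of h] high_X by blast
      then show "h \<in> hh ` {p \<in> pos. first p}" by blast
    qed
  qed blast
  ultimately have "(\<Sum>p\<in>{p \<in> pos. first p}. gs (hh p)) = (\<Sum>h\<in>hh ` pos. gs h)"
    using sum.reindex[of hh "{p \<in> pos. first p}" gs] by simp
  also have "\<dots> = int (\<Sum>h\<in>hh ` pos. card {q \<in> pos. hh q = h})"
    unfolding gs_def by simp
  also have "(\<Sum>h\<in>hh ` pos. card {q \<in> pos. hh q = h}) = (\<Sum>q\<in>pos. 1)"
    using sum.group[of "pos" "hh ` pos" hh "\<lambda>_. 1 :: nat"] by simp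
  finally show ?thesis using n by simp
qed

lemma clus_X:
  "clus w X h = (\<lambda>q. M q mod 2 ^ lw) ` {q \<in> pos. hh q = h}"
proof -
  have "{x \<in> X. high w x = h} = (\<lambda>q. M q mod 2 ^ w) ` {q \<in> pos. hh q = h}"
    using batch unfolding batch_def hh_eq by blast
  then show ?thesis unfolding clus_def by (simp add: image_image low_mod)
qed

text \<open>Keys with equal heads are ordered by their low bits, and \<open>2 ^ lw\<close> divides
  \<open>2 ^ w\<close>; so the unchanged words of the group represent a sorted batch for the
  cluster.\<close>

lemma clus_X_batch:
  assumes "p \<in> pos" "{r \<in> pos. hh r = hh p} = {p..<p + m}"
  shows "batch L lw M p m (clus w X (hh p))"
proof -
  have G: "q \<in> pos" "hh q = hh p" if "q \<in> {p..<p + m}" for q using assms(2) that by blast+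
  have "M q mod 2 ^ lw < M r mod 2 ^ lw" if "q \<in> {p..<p + m}" "r \<in> {p..<p + m}" "q < r" for q r
  proof -
    have "M q mod 2 ^ w < M r mod 2 ^ w" using batch G that unfolding batch_def by blast
    then show ?thesis using low_less G that unfolding low_mod[symmetric] hh_eq by metis
  qed
  then show ?thesis using G batch unfolding batch_def clus_X assms(2) by blast
qed

abbreviation "loop_args \<equiv> [i, i + n, int w, int lw, f, g, t, u]"

lemma words: "is_word L 0" "is_word L 1" "is_word L 2" "is_word L (2 ^ w)" "is_word L (hh p)"
  "p \<in> {i..i + n} \<Longrightarrow> is_word L p" "p \<in> pos \<Longrightarrow> is_word L (M p)"
  "is_word L (f + hh p)" "x \<in> {0..<2 ^ L} \<Longrightarrow> is_word L x"
proof -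
  note b = pow_bounds scr_fits f i hh_heads[of p]
  have "0 \<le> (2::int) ^ hw * scr lw" by (simp add: scr_def)
  moreover have "0 \<le> hh p" "hh p < 2 ^ hw" using hh_heads[of p] by auto
  ultimately have b': "f + 3 * 2 ^ w < 2 ^ L" "hh p < 2 ^ w" "0 \<le> hh p"
    using pow_bounds(3) scr_fits f by linarith+
  show "is_word L 0" "is_word L 1" "is_word L 2" "is_word L (2 ^ w)" "is_word L (hh p)"
    "is_word L (f + hh p)"
    using b b' unfolding is_word_def by linarith+
  show "p \<in> {i..i + n} \<Longrightarrow> is_word L p" using i unfolding is_word_def by auto
  show "p \<in> pos \<Longrightarrow> is_word L (M p)" using batch unfolding batch_def by blast
  show "x \<in> {0..<2 ^ L} \<Longrightarrow> is_word L x" unfolding is_word_def by (auto intro: order_trans[of _ 0])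
qed

lemma run_Read_head:
  assumes "exp_val L \<rho> e = Some q" "q \<in> pos" "q \<in> R" "M1 q = M q"
    "\<rho> ''h'' = Some (hh p)" "\<rho> ''w'' = Some (int w)" "\<rho> ''l'' = Some (int lw)"
  shows "run L P R Y \<rho> (Bind ''y'' (Read e) (Ret (eq_e (head ''y'') (Var ''h'')))) M1
    (\<lambda>r M' c s. r = (if hh q = hh p then 1 else 0) \<and> M' = M1 \<and> c = 14 + exp_cost e \<and> s \<le> c)"
  apply (rule run_Bind[where N="\<lambda>r M' c s. r = M q \<and> M' = M1 \<and> c = 1 + exp_cost e \<and> s = c"])
   apply (rule run_Read[OF assms(1)])
  using assms(2-4) i words(7) apply auto[4]
  apply clarify
  apply (rule run_Ret)
   apply (rule exp_val_Bin[OF exp_val_head])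
         apply simp
        apply (simp add: assms)
       apply (simp add: assms)
      apply (rule pow_bounds)
     apply (rule high_low_bits)
    apply (simp add: assms)
   apply (rule refl)
   apply (simp add: words)
  apply (simp add: hh_def)
  done

lemma run_Read_this:
  assumes "\<rho> ''i'' = Some p" "p \<in> pos" "p \<in> R" "M1 p = M p"
    "\<rho> ''w'' = Some (int w)" "\<rho> ''l'' = Some (int lw)"
    "run L P R Y (\<rho>(''x'' \<mapsto> M p, ''h'' \<mapsto> hh p)) k M1 (\<lambda>v M' c s. Q v M' (14 + c) (14 + s))"
  shows "run L P R Y \<rho> (Bind ''x'' (Read (Var ''i'')) (Bind ''h'' (Ret (head ''x'')) k)) M1 Q"
  apply (rule run_Bind[where N="\<lambda>r M' c s. r = M p \<and> M' = M1 \<and> c = 2 \<and> s = 2"])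
   apply (rule run_Read)
  using assms(1-4) i words(7) apply auto[5]
  apply clarify
  apply (rule run_Bind[where N="\<lambda>r M' c s. r = hh p \<and> M' = M1 \<and> c = 10 \<and> s = 10"])
   apply (rule run_Ret)
    apply (rule exp_val_head)
        apply simp
       apply (simp add: assms)
      apply (simp add: assms)
     apply (rule pow_bounds)
    apply (rule high_low_bits)
   apply (simp add: hh_def)
  apply clarify
  using assms(7) by (simp add: numeral_eq_Suc)

section \<open>First loop: recording the ends of the groups\<close>

definition seg_cells :: "int \<Rightarrow> int set" where
  "seg_cells p = (if lst p then {f + hh p} else {})"

lemma run_seg_com:
  assumes "p \<in> pos"
  shows "run L P (pos \<union> seg_cells p) (seg_cells p) (for_env p (p + 1) loop_args) seg_com M
    (\<lambda>r M' c s. r = 0 \<and> (lst p \<longrightarrow> M' (f + hh p) = p + 1) \<and> c \<le> 60 \<and> s \<le> 60)"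
  unfolding seg_com_def
  apply (rule run_Read_this[where p=p])
  using assms apply simp_all[6]
  apply (rule run_Bind[where N="\<lambda>r M' c s. r = (if lst p then 0 else 1) \<and> M' = M \<and> c \<le> 25 \<and> s \<le> 25"])
   apply (rule run_Cond[where i="if p + 1 = i + n then 1 else 0"])
  subgoal using assms words(6)[of "p + 1"] by (simp add: word_result_def words)
    apply (rule run_Ret[where v=0])
     apply (simp add: words word_result_def)
    apply (simp add: lst_def split: if_splits)
   apply (rule run_conseq)
      apply (rule run_Read_head[where p=p and q="p + 1"])
  subgoal using assms words(6)[of "p + 1"] by (simp add: word_result_def words)
  using assms apply (auto simp: lst_def split: if_splits)[9]
  apply (elim conjE, hypsubst)
  apply (rule run_Cond[where i="if lst p then 0 else 1"])
    apply simp
   apply (rule run_Ret[where v=0])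
    apply (simp add: words word_result_def)
   apply (simp split: if_splits)
  apply (rule run_Bind[where N="\<lambda>r M' c s. M' (f + hh p) = p + 1 \<and> c \<le> 7 \<and> s \<le> 7"])
   apply (rule run_Write[where i="f + hh p" and v="p + 1"])
  subgoal by (simp add: word_result_def words)
  subgoal using f hh_heads[of p] by auto
  subgoal using assms words(6)[of "p + 1"] by (simp add: word_result_def words)
  subgoal by (simp add: seg_cells_def split: if_splits)
  subgoal by (simp add: seg_cells_def split: if_splits)
  subgoal by simp
  apply (rule run_Ret[where v=0])
   apply (simp add: words word_result_def)
  apply simp
  done


lemma cnt_cells: "{g + i<..<g + (i + n)} \<subseteq> {f + 2 ^ w..<f + 2 ^ w + 2 ^ w}"
  using n_le by (auto simp: g_def)

lemma cnt_word: "0 \<le> g + i" "g + (i + n) \<le> 2 ^ L"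
proof -
  have "0 \<le> (2::int) ^ hw * scr lw" by (simp add: scr_def)
  then show "0 \<le> g + i" "g + (i + n) \<le> 2 ^ L"
    using n_le f pow_bounds(1) scr_fits unfolding g_def by linarith+
qed

lemma scratch_cells:
  "{f..<f + 2 ^ w + 2 ^ w} \<subseteq> {f..<f + scr w - 1}" "{d..<d + 2 ^ w} \<subseteq> {f..<f + scr w - 1}"
  "{u..<f + scr w - 1} \<subseteq> {f..<f + scr w - 1}" "{u..<u + scr hw} \<subseteq> {f..<f + scr w - 1}"
  "u + scr hw \<le> f + scr w - 1"
proof -
  have "0 \<le> scr hw" by (simp add: scr_def)
  moreover from this have "1 * scr hw \<le> (2::int) ^ hw * scr lw"
    using pow_bounds(5,6) by (intro mult_mono) auto
  moreover define Z :: int where "Z = 2 ^ w"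
  moreover have "1 \<le> Z" by (simp add: Z_def)
  moreover have "3 * Z + 2 ^ hw * scr lw + 1 \<le> scr w" unfolding Z_def by (rule scr_fits)
  ultimately show "{f..<f + 2 ^ w + 2 ^ w} \<subseteq> {f..<f + scr w - 1}" "{d..<d + 2 ^ w} \<subseteq> {f..<f + scr w - 1}"
    "{u..<f + scr w - 1} \<subseteq> {f..<f + scr w - 1}" "{u..<u + scr hw} \<subseteq> {f..<f + scr w - 1}"
    "u + scr hw \<le> f + scr w - 1"
    unfolding d_def u_def by (auto simp flip: Z_def)
qed

lemma hh_bounds: "0 \<le> hh p" "hh p < 2 ^ hw" "hh p < 2 ^ w"
proof -
  show 1: "0 \<le> hh p" "hh p < 2 ^ hw" using hh_heads[of p] by auto
  then show "hh p < 2 ^ w" using pow_bounds(3) by linarith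
qed

lemma seg_cells_sub: "seg_cells p \<subseteq> {f..<f + 2 ^ w}"
  using hh_bounds[of p] by (auto simp: seg_cells_def)

text \<open>An instance of \<open>run_for\<close> with all results \<open>0\<close> and depth
  \<open>w\<close>. Its zero partial sums lie in the same cells that the second loop fills with the
  counts of emptied clusters.\<close>

lemma run_seg:
  "run L veb_prog (pos \<union> {f..<f + 2 ^ w + 2 ^ w}) {f..<f + 2 ^ w + 2 ^ w}
     (for_env i (i + n) loop_args) (for_com ''seg'' seg_com) M
     (\<lambda>r M' c s. (\<forall>p\<in>pos. lst p \<longrightarrow> M' (f + hh p) = p + 1) \<and>
        int c \<le> 160 * n \<and> s \<le> 110 + 50 * w)"
proof (rule run_conseq)
  show "run L veb_prog (pos \<union> (\<Union>p\<in>pos. seg_cells p) \<union> {g + i<..<g + (i + n)})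
     ((\<Union>p\<in>pos. seg_cells p) \<union> {g + i<..<g + (i + n)})
     (for_env i (i + n) loop_args) (for_com ''seg'' seg_com) M
     (\<lambda>r M' c s. r = sum (\<lambda>_. 0) pos \<and>
       (\<forall>p\<in>pos. \<exists>Mp. (lst p \<longrightarrow> Mp (f + hh p) = p + 1) \<and> (\<forall>x\<in>seg_cells p. M' x = Mp x)) \<and>
       counts (\<lambda>_. 0) g M' i (i + n) \<and> c + 50 \<le> sum (\<lambda>_. 60) pos + 100 * nat (i + n - i) \<and>
       s \<le> 60 + 50 * (w + 1))"
  proof (rule run_for[OF veb_prog_procs(4) refl])
    fix p assume p: "p \<in> pos"
    show "run L veb_prog (pos \<union> seg_cells p) (seg_cells p) (for_env p (p + 1) loop_args) seg_com M
      (\<lambda>r M' c s. r = 0 \<and> (lst p \<longrightarrow> M' (f + hh p) = p + 1) \<and> c \<le> 60 \<and> s \<le> 60)"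
      by (rule run_seg_com[OF p])
    show "seg_cells p \<inter> pos = {}"
      using seg_cells_sub[of p] scratch_cells(1) disj(3) by fastforce
    show "seg_cells p \<inter> {g + i<..<g + (i + n)} = {}"
      using seg_cells_sub[of p] cnt_cells by fastforce
    fix q assume "q \<in> pos" "p \<noteq> q"
    then show "seg_cells p \<inter> seg_cells q = {}"
      using lst_unique[of p q] p by (auto simp: seg_cells_def)
  next
    show "pos \<inter> {g + i<..<g + (i + n)} = {}"
      using cnt_cells scratch_cells(1) disj(3) by fastforce
  qed (use i n n_le cnt_word in auto)
  show "pos \<union> (\<Union>p\<in>pos. seg_cells p) \<union> {g + i<..<g + (i + n)} \<subseteq>
    pos \<union> {f..<f + 2 ^ w + 2 ^ w}"
    "(\<Union>p\<in>pos. seg_cells p) \<union> {g + i<..<g + (i + n)} \<subseteq> {f..<f + 2 ^ w + 2 ^ w}"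
    using seg_cells_sub cnt_cells by fastforce+
qed (use n in \<open>fastforce simp: seg_cells_def\<close>)

section \<open>Second loop: deletion from the clusters\<close>

definition emp :: "int \<Rightarrow> int" where
  "emp p = (if first p \<and> clus w I (hh p) \<subseteq> clus w X (hh p) then 1 else 0)"

definition run_cells :: "int \<Rightarrow> int set" where
  "run_cells p = (if first p then Fc (hh p) \<union> sub (hh p) else {})"

definition shared :: "int set" where
  "shared = pos \<union> {f..<f + 2 ^ w} \<union> {t..<t + 2 ^ hw}"

text \<open>The first position of a group is charged with the whole deletion from its cluster, in
  the form of \<open>work_ok\<close> solved for the work; \<open>100\<close> covers the rest of the
  iteration.\<close>

definition cst :: "int \<Rightarrow> nat" where
  "cst p = 100 + (if first p
     then nat (3000 * int (dep lw) * (gs (hh p) - emp p) + 500 * emp p) else 0)"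

lemma cluster_holds: "h \<in> heads w \<Longrightarrow> holds M lw (ca h) (Fc h) (clus w I h)"
  using inner by (simp add: inner_holds_def)

lemma cluster_cells: "h \<in> heads w \<Longrightarrow> Fc h \<subseteq> node"
  by (auto simp: node_cells_def)

text \<open>The first position of a group does not know where the group ends; its last position,
  which has the same head, has stored this at \<open>f + hh p\<close>. By \<open>lst_unique\<close>
  there is only one such last position.\<close>

lemma run_run_com:
  assumes p: "p \<in> pos"
    and M1: "\<And>x. x \<in> node \<union> pos \<Longrightarrow> M1 x = M x"
    and ends: "\<And>q. q \<in> pos \<Longrightarrow> lst q \<Longrightarrow> M1 (f + hh q) = q + 1"
  shows "run L veb_prog (shared \<union> run_cells p) (run_cells p) (for_env p (p + 1) loop_args) run_com M1
    (\<lambda>r M' c s. r = emp p \<and>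
       (first p \<longrightarrow> holds M' lw (ca (hh p)) (Fc (hh p)) (clus w (I - X) (hh p))) \<and>
       c \<le> cst p \<and> s \<le> 100 + span_bd lw)"
proof -
  let ?\<rho> = "(for_env p (p + 1) loop_args)(''x'' \<mapsto> M p, ''h'' \<mapsto> hh p)"
  have call: "run L veb_prog (shared \<union> run_cells p) (run_cells p) (?\<rho>(''d'' \<mapsto> 0))
      (Bind ''k'' (Read (plus_e (Var ''f'') (Var ''h'')))
      (Bind ''c'' (Read (plus_e (Var ''t'') (Var ''h'')))
      (Call ''batch_delete'' [Var ''c'', Var ''l'', Var ''i'', minus_e (Var ''k'') (Var ''i''),
        plus_e (Var ''v'') (Bin Shl (Var ''h'') (Bin Mul (Lit 2) (plus_e (Var ''l'') (Lit 1))))]))) M1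
    (\<lambda>r M' c s. r = emp p \<and>
       (first p \<longrightarrow> holds M' lw (ca (hh p)) (Fc (hh p)) (clus w (I - X) (hh p))) \<and>
       c + 55 \<le> cst p \<and> s \<le> 45 + span_bd lw)"
    if first: "first p"
  proof -
    obtain q where q: "p \<le> q" "q \<in> pos" "lst q" "hh q = hh p"
      "{r \<in> pos. hh r = hh p} = {p..<q + 1}"
      using group[OF p first] by blast
    define m where "m = q + 1 - p"
    have m: "1 \<le> m" "q + 1 = p + m" "gs (hh p) = m" "{p..<p + m} \<subseteq> pos"
      using q p by (auto simp: m_def gs_def q(5) cong del: image_cong)
    have h: "hh p \<in> heads w" by (rule hh_heads)
    note h' = hh_bounds[of p]
    have tc: "t + hh p \<in> {t..<t + 2 ^ hw}" using h' by auto
    have tn: "{t..<t + 2 ^ hw} \<subseteq> node" by (auto simp: node_cells_def)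
    have t0: "0 \<le> t + hh p" "is_word L (t + hh p)"
    proof -
      have "t + hh p \<in> {0..<2 ^ L}" using tc tn cells by blast
      then show "0 \<le> t + hh p" "is_word L (t + hh p)" using words(9) by auto
    qed
    have ca: "M1 (t + hh p) = ca (hh p)"
    proof -
      have "M (t + hh p) = ca (hh p)" using links h unfolding links_def by blast
      moreover have "t + hh p \<in> node" using tc tn by blast
      ultimately show ?thesis using M1 by simp
    qed
    have end': "M1 (f + hh p) = p + m" using ends[OF q(2,3)] q(4) m(2) by simp
    have caF: "ca (hh p) \<in> {0..<2 ^ L}"
      using holds_header(1)[OF cluster_holds[OF h]] cluster_cells[OF h] cells by blast
    have hF: "holds M1 lw (ca (hh p)) (Fc (hh p)) (clus w I (hh p))"
      using cluster_cells[OF h] M1 by (intro holds_frame[OF cluster_holds[OF h]]) blast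
    have bF: "batch L lw M1 p m (clus w X (hh p))"
      using m(4) M1 by (intro batch_frame[OF clus_X_batch[OF p q(5)[unfolded m(2)]]]) blast
    have sh: "{p..<p + m} \<subseteq> shared" using m(4) by (auto simp: shared_def)
    have rc: "run_cells p = Fc (hh p) \<union> sub (hh p)" using first by (simp add: run_cells_def)
    have sb: "sub (hh p) \<subseteq> {f..<f + scr w - 1}" using sub_fits(3)[OF h] scratch_cells(3) by blast
    define f' where "f' = u + hh p * scr lw"
    have subeq: "sub (hh p) = {f'..<f' + scr lw}" by (simp add: sub_def f'_def)
    have f': "0 \<le> f'" "f' + scr lw < 2 ^ L"
      using sub_fits(1,2)[OF h] f pow_bounds(1) unfolding f'_def u_def by auto
    have spec: "run L veb_prog (Fc (hh p) \<union> {p..<p + m} \<union> {f'..<f' + scr lw}) (Fc (hh p) \<union>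
        {f'..<f' + scr lw})
       (map_of (zip del_params [ca (hh p), int lw, p, m, f'])) delete_com M1
       (\<lambda>v M' c s. v = (if clus w I (hh p) \<subseteq> clus w X (hh p) then 1 else 0) \<and>
          holds M' lw (ca (hh p)) (Fc (hh p)) (clus w I (hh p) - clus w X (hh p)) \<and>
          work_ok lw m v c \<and> s \<le> span_bd lw)"
    proof (rule low_spec[unfolded del_spec_def, rule_format])
      show "clus w X (hh p) \<subseteq> clus w I (hh p)" using X by (auto simp: clus_def)
      show "Fc (hh p) \<subseteq> {0..<2 ^ L}" using cluster_cells[OF h] cells by blast
      show "0 \<le> p" "p + m < 2 ^ L" using p q(2) m(2) i by auto
      show "Fc (hh p) \<inter> {p..<p + m} = {}" using cluster_cells[OF h] m(4) disj(1) by blast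
      show "Fc (hh p) \<inter> {f'..<f' + scr lw} = {}"
        using cluster_cells[OF h] sb disj(2) unfolding subeq by blast
      show "{p..<p + m} \<inter> {f'..<f' + scr lw} = {}" using m(4) sb disj(3) unfolding subeq by blast
    qed (use hF bF m f' in auto)
    have wrd: "is_word L m" "is_word L (int lw + 1)" "is_word L (2 * (int lw + 1))"
      "is_word L (hh p * scr lw)" "is_word L f'"
    proof -
      have "p \<in> {0..<2 ^ L}" "p + m \<in> {0..<2 ^ L}" using p q(2) m(1,2) i by auto
      then show "is_word L m" using m(1) by (intro words(9)) auto
      have "int (2 * (lw + 1)) < 2 ^ (2 * (lw + 1))" using of_nat_less_two_power by blast
      then have "2 * (int lw + 1) < scr lw" by (simp add: scr_def)
      then show "is_word L (int lw + 1)" "is_word L (2 * (int lw + 1))"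
        using f' by (intro words(9); auto)+
      have "0 \<le> u" using f pow_bounds(1) by (simp add: u_def)
      then have "hh p * scr lw \<le> f'" "0 \<le> hh p * scr lw" using h' pow_bounds(5) by (auto simp: f'_def)
      then show "is_word L (hh p * scr lw)" "is_word L f'" using f' pow_bounds(5)
          by (intro words(9); auto)+
    qed
    have sl: "(2::int) ^ nat (2 * int lw + 2) = scr lw"
    proof -
      have "nat (2 * int lw + 2) = 2 * (lw + 1)" by simp
      then show ?thesis unfolding scr_def by (rule arg_cong)
    qed
    have cost: "c + 100 \<le> cst p" if "work_ok lw m (emp p) c" for c
    proof -
      have "int c \<le> 3000 * int (dep lw) * (gs (hh p) - emp p) + 500 * emp p"
        using that unfolding work_ok_def m(3) by (simp add: algebra_simps)
      then show ?thesis using first unfolding cst_def by simp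
    qed
    have emp: "(if clus w I (hh p) \<subseteq> clus w X (hh p) then 1 else 0) = emp p"
      using first by (simp add: emp_def)
    show ?thesis
      apply (rule run_Bind_Read[where i="f + hh p" and v="p + m"])
      subgoal by (simp add: word_result_def words)
      subgoal using f h' by simp
      subgoal using q(2) m(2) by (intro words(6)) auto
      subgoal using h' by (auto simp: shared_def)
      subgoal by (simp add: end')
      apply (rule run_Bind_Read[where i="t + hh p" and v="ca (hh p)"])
      subgoal by (simp add: word_result_def t0)
      subgoal by (rule t0)
      subgoal by (rule words(9)[OF caF])
      subgoal using tc by (auto simp: shared_def)
      subgoal by (simp add: ca)
      apply (rule run_Call[OF veb_prog_procs(1), where vs="[ca (hh p), int lw, p, m, f']"])
        apply simp
      subgoal using wrd by (simp add: word_result_def f'_def words sl)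
      apply (rule run_conseq[OF spec])
      subgoal using sh by (auto simp: rc subeq)
      subgoal by (auto simp: rc subeq)
      subgoal for \<dots> r M' c s
        using cost[of c] unfolding emp clus_diff by auto
      done
  qed
  show ?thesis
    unfolding run_com_def
    apply (rule run_Read_this[where p=p])
    using p M1 apply (simp_all add: shared_def)[6]
    apply (rule run_Bind[where N="\<lambda>r M' c s. r = (if first p then 0 else 1) \<and> M' = M1 \<and> c \<le> 25 \<and>
        s \<le> 25"])
     apply (rule run_Cond[where i="if p = i then 1 else 0"])
    subgoal by (simp add: word_result_def words)
      apply (rule run_Ret[where v=0])
       apply (simp add: words word_result_def)
      apply (simp add: first_def split: if_splits)
     apply (rule run_conseq)
        apply (rule run_Read_head[where p=p and q="p - 1" and R="shared \<union>
            run_cells p" and Y="run_cells p"])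
    subgoal using p words(6)[of "p - 1"] by (auto simp: word_result_def words split: if_splits)
    subgoal using p by (auto split: if_splits)
    subgoal using p by (auto split: if_splits simp: shared_def)
    subgoal using p by (intro M1) (auto split: if_splits)
    apply simp_all[3]
       apply (rule order_refl)+
    subgoal by (auto simp: first_def split: if_splits)
    apply (elim conjE, hypsubst)
    apply (rule run_Cond[where i="if first p then 0 else 1"])
      apply simp
     apply (rule run_Ret[where v=0])
      apply (simp add: words word_result_def)
     apply (simp add: emp_def cst_def split: if_splits)
    apply (rule run_conseq)
       apply (simp only: if_P)
       apply (rule call)
    apply (auto split: if_splits)
    done
qed

abbreviation "tree_cells \<equiv> Fs \<union> clusters"
abbreviation "scratch \<equiv> {f..<f + scr w - 1}"
abbreviation "all_cells \<equiv> node \<union> pos \<union> scratch"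

lemma emp_bits: "emp p \<in> {0, 1}"
  by (simp add: emp_def)

text \<open>Each emptied cluster reduces the number of fully charged keys by one. The term
  \<open>n - sum emp pos\<close> is thus the saving from which the deletion of
  \<open>sum emp pos\<close> heads from the summary will be paid.\<close>

lemma sum_cst:
  "int (sum cst pos) = 100 * n + 3000 * int (dep lw) * (n - sum emp pos) + 500 * sum emp pos"
proof -
  let ?P = "{p \<in> pos. first p}"
  let ?c = "\<lambda>p. 3000 * int (dep lw) * (gs (hh p) - emp p) + 500 * emp p"
  have fin: "finite pos" by simp
  have c: "int (cst p) = 100 + (if first p then ?c p else 0)" if p: "p \<in> pos" for p
  proof -
    have "finite {q \<in> pos. hh q = hh p}" by (rule finite_subset[OF _ fin]) auto
    then have "1 \<le> card {q \<in> pos. hh q = hh p}"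
      using p by (metis (mono_tags, lifting) One_nat_def Suc_leI card_gt_0_iff empty_iff mem_Collect_eq)
    \<comment> \<open>A group contains at least one key, so the truncation by \<open>nat\<close> in
      \<open>cst\<close> loses nothing.\<close>
    then have "0 \<le> gs (hh p) - emp p" using emp_bits[of p] by (auto simp: gs_def)
    then have "0 \<le> ?c p" using emp_bits[of p] by auto
    then show ?thesis unfolding cst_def by simp
  qed
  have "int (sum cst pos) = (\<Sum>p\<in>pos. 100 + (if first p then ?c p else 0))"
    unfolding of_nat_sum by (rule sum.cong[OF refl c])
  also have "\<dots> = 100 * n + (\<Sum>p\<in>pos. if first p then ?c p else 0)"
    using n by (simp add: sum.distrib)
  also have "(\<Sum>p\<in>pos. if first p then ?c p else 0) = sum ?c ?P"
    by (rule sum.inter_filter[OF fin, symmetric])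
  also have "\<dots> = 3000 * int (dep lw) * (sum (\<lambda>p. gs (hh p)) ?P - sum emp ?P) + 500 * sum emp ?P"
    by (simp add: sum.distrib sum_distrib_left sum_subtractf right_diff_distrib)
  also have "sum emp ?P = sum emp pos"
    by (rule sum.mono_neutral_left[OF fin]) (auto simp: emp_def)
  finally show ?thesis unfolding sum_gs by (simp only: add.assoc)
qed

lemma tree_cells_sub: "tree_cells \<subseteq> node"
  by (auto simp: node_cells_def)

lemma run_cells_sub: "run_cells p \<subseteq> Fc (hh p) \<union> {u..<f + scr w - 1}"
  using sub_fits(3)[OF hh_heads[of p]] by (auto simp: run_cells_def)

lemma clusters_disjoint:
  "h \<in> heads w \<Longrightarrow> h' \<in> heads w \<Longrightarrow> h \<noteq> h' \<Longrightarrow> Fc h \<inter> Fc h' = {}"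
  "h \<in> heads w \<Longrightarrow> Fc h \<inter> Fs = {}" "h \<in> heads w \<Longrightarrow> Fc h \<inter> {t..<t + 2 ^ hw} = {}"
  using layout unfolding layout_def disjoint_family_on_def by blast+

abbreviation "clus_done M' \<equiv> \<forall>h\<in>heads w. holds M' lw (ca h) (Fc h) (clus w (I - X) h)"

abbreviation run_post :: "int \<Rightarrow> mem \<Rightarrow> nat \<Rightarrow> nat \<Rightarrow> bool" where
  "run_post r M' c s' \<equiv> r = sum emp pos \<and> clus_done M' \<and>
     counts emp g M' i (i + n) \<and> (\<forall>x\<in>Fs \<union> pos. M' x = M x) \<and>
     int c \<le> 200 * n + 3000 * int (dep lw) * (n - r) + 500 * r \<and> s' \<le> 150 + span_bd lw + 50 * w"

lemma run_runs:
  assumes M1: "\<And>x. x \<in> node \<union> pos \<Longrightarrow> M1 x = M x"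
    and ends: "\<And>q. q \<in> pos \<Longrightarrow> lst q \<Longrightarrow> M1 (f + hh q) = q + 1"
  shows "run L veb_prog all_cells (clusters \<union> scratch)
     (for_env i (i + n) loop_args) (for_com ''run'' run_com) M1
     run_post"
proof (rule run_conseq)
  let ?Q = "\<lambda>r M' c s. r = sum emp pos \<and>
       (\<forall>p\<in>pos. \<exists>Mp. (first p \<longrightarrow> holds Mp lw (ca (hh p)) (Fc (hh p)) (clus w (I - X) (hh p))) \<and>
          (\<forall>x\<in>run_cells p. M' x = Mp x)) \<and>
       counts emp g M' i (i + n) \<and> c + 50 \<le> sum cst pos + 100 * nat (i + n - i) \<and>
       s \<le> 100 + span_bd lw + 50 * (w + 1)"
  have sc: "f + 2 ^ w + 2 ^ w \<le> u" "{f..<f + 2 ^ w + 2 ^ w} \<subseteq> scratch" "{u..<f + scr w - 1} \<subseteq> scratch"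
    using scratch_cells pow_bounds(1) unfolding u_def by auto
  have tn: "{t..<t + 2 ^ hw} \<subseteq> node" by (auto simp: node_cells_def)
  have U: "(\<Union>p\<in>pos. run_cells p) \<subseteq> clusters \<union> {u..<f + scr w - 1}"
    using run_cells_sub hh_heads by blast
  have cnt: "{g + i<..<g + (i + n)} \<subseteq> {f + 2 ^ w..<f + 2 ^ w + 2 ^ w}" by (rule cnt_cells)
  have cnt': "{g + i<..<g + (i + n)} \<subseteq> {f..<f + 2 ^ w + 2 ^ w}"
      "{g + i<..<g + (i + n)} \<inter> {u..<f + scr w - 1} = {}"
    "{g + i<..<g + (i + n)} \<inter> {f..<f + 2 ^ w} = {}"
  proof -
    have "0 \<le> (2::int) ^ w" by simp
    then show "{g + i<..<g + (i + n)} \<subseteq> {f..<f + 2 ^ w + 2 ^ w}"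
        "{g + i<..<g + (i + n)} \<inter> {u..<f + scr w - 1} = {}"
      "{g + i<..<g + (i + n)} \<inter> {f..<f + 2 ^ w} = {}"
      using cnt sc(1) by fastforce+
  qed
  have f2: "{f..<f + 2 ^ w} \<subseteq> scratch" "{f..<f + 2 ^ w} \<inter> {u..<f + scr w - 1} = {}"
  proof -
    have "0 \<le> (2::int) ^ w" by simp
    then show "{f..<f + 2 ^ w} \<subseteq> scratch" "{f..<f + 2 ^ w} \<inter> {u..<f + scr w - 1} = {}"
      using sc(1,2) by fastforce+
  qed
  have shared_all: "shared \<subseteq> all_cells" unfolding shared_def using tn f2(1) by blast
  have Fcn: "Fc (hh p) \<subseteq> node" for p by (rule cluster_cells[OF hh_heads])
  show "run L veb_prog (shared \<union> (\<Union>p\<in>pos. run_cells p) \<union> {g + i<..<g + (i + n)})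
     ((\<Union>p\<in>pos. run_cells p) \<union> {g + i<..<g + (i + n)})
     (for_env i (i + n) loop_args) (for_com ''run'' run_com) M1
     ?Q"
  proof (rule run_for[OF veb_prog_procs(5) refl])
    fix p assume p: "p \<in> pos"
    show "run L veb_prog (shared \<union> run_cells p) (run_cells p) (for_env p (p + 1) loop_args) run_com M1
      (\<lambda>r M' c s. r = emp p \<and>
         (first p \<longrightarrow> holds M' lw (ca (hh p)) (Fc (hh p)) (clus w (I - X) (hh p))) \<and>
         c \<le> cst p \<and> s \<le> 100 + span_bd lw)"
      by (rule run_run_com[OF p M1 ends])
    show "run_cells p \<inter> shared = {}"
    proof -
      have "Fc (hh p) \<inter> shared = {}"
        using clusters_disjoint(3)[OF hh_heads[of p]] Fcn[of p] disj(1,2) f2(1) unfolding shared_def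
            by blast
      moreover have "{u..<f + scr w - 1} \<inter> shared = {}"
        using tn disj(2,3) sc(3) f2(2) unfolding shared_def by blast
      ultimately show ?thesis using run_cells_sub[of p] by blast
    qed
    show "run_cells p \<inter> {g + i<..<g + (i + n)} = {}"
      using run_cells_sub[of p] Fcn[of p] disj(2) cnt'(1,2) sc(2) by blast
    fix q assume "q \<in> pos" "p \<noteq> q"
    show "run_cells p \<inter> run_cells q = {}"
    proof (cases "first p \<and> first q")
      case True
      then have "hh p \<noteq> hh q" using first_unique p \<open>q \<in> _\<close> \<open>p \<noteq> q\<close> by blast
      moreover have "sub (hh r) \<subseteq> scratch" for r using sub_fits(3)[OF hh_heads[of r]] sc(3) by blast
      ultimately show ?thesis
        using clusters_disjoint(1)[OF hh_heads[of p] hh_heads[of q]] sub_disjoint[of "hh p" "hh q"]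
          Fcn[of p] Fcn[of q] disj(2) unfolding run_cells_def by (simp add: True) blast
    qed (auto simp: run_cells_def)
  next
    show "shared \<inter> {g + i<..<g + (i + n)} = {}"
      using tn disj(2,3) cnt'(1,3) sc(2) unfolding shared_def by blast
  qed (use i n n_le cnt_word emp_bits in auto)
  show "shared \<union> (\<Union>p\<in>pos. run_cells p) \<union> {g + i<..<g + (i + n)} \<subseteq> all_cells"
    using shared_all U cnt'(1) sc tree_cells_sub by blast
  show "(\<Union>p\<in>pos. run_cells p) \<union> {g + i<..<g + (i + n)} \<subseteq> clusters \<union> scratch"
    using U cnt'(1) sc by blast
  fix r M' c s'
  assume *: "?Q r M' c s'"
    and frame: "\<And>x. x \<notin> (\<Union>p\<in>pos. run_cells p) \<union> {g + i<..<g + (i + n)} \<Longrightarrow> M' x = M1 x"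
  have "holds M' lw (ca h) (Fc h) (clus w (I - X) h)" if h: "h \<in> heads w" for h
  proof (cases "h \<in> high w ` X")
    case True
    then obtain p where p: "p \<in> pos" "first p" "hh p = h" by (rule first_exists)
    with * obtain Mp where Mp: "holds Mp lw (ca h) (Fc h) (clus w (I - X) h)"
        "\<forall>x\<in>run_cells p. M' x = Mp x"
      by blast
    then show ?thesis using p by (intro holds_frame[OF Mp(1)]) (auto simp: run_cells_def)
  next
    case False
    \<comment> \<open>Clusters without a key in the batch have to be treated separately: no
      iteration touches their cells, and their key sets do not change.\<close>
    have away: "Fc h \<inter> run_cells p = {}" if "p \<in> pos" for p
    proof -
      have "hh p \<noteq> h" using False that unfolding high_X by blast
      then have "Fc h \<inter> Fc (hh p) = {}" using clusters_disjoint(1)[OF h hh_heads[of p]] by simp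
      then show ?thesis using run_cells_sub[of p] cluster_cells[OF h] disj(2) sc(3) by blast
    qed
    have away': "Fc h \<inter> {g + i<..<g + (i + n)} = {}" using cluster_cells[OF h] disj(2) cnt'(1) sc(2)
        by blast
    have M': "M' x = M x" if "x \<in> Fc h" for x
    proof -
      have "M' x = M1 x" by (rule frame) (use away away' that in blast)
      also have "\<dots> = M x" by (rule M1) (use cluster_cells[OF h] that in blast)
      finally show ?thesis .
    qed
    have "clus w (I - X) h = clus w I h"
      using False unfolding clus_diff clus_empty_iff[symmetric] by blast
    then show ?thesis using holds_frame[OF cluster_holds[OF h], of M'] M' by simp
  qed
  moreover have "M' x = M x" if x: "x \<in> Fs \<union> pos" for x
  proof -
    have "x \<notin> clusters"
      using x clusters_disjoint(2) tree_cells_sub disj(1) by blast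
    moreover have "x \<notin> scratch" using x tree_cells_sub disj(2,3) by blast
    ultimately have "M' x = M1 x" using U cnt'(1) sc(2,3) by (intro frame) blast
    also have "M1 x = M x" by (rule M1) (use x tree_cells_sub in blast)
    finally show ?thesis .
  qed
  moreover have "int c \<le> 200 * n + 3000 * int (dep lw) * (n - r) + 500 * r"
  proof -
    have "int c + 50 \<le> int (sum cst pos) + 100 * n" using * n by linarith
    then show ?thesis using * sum_cst by simp
  qed
  ultimately show "run_post r M' c s'"
    using * by auto
qed

section \<open>Packing the heads of emptied clusters and deleting them from the summary\<close>

definition "k = sum emp pos"
definition "gone = {h \<in> high w ` X. clus w I h - clus w X h = {}}"

lemma k_bounds: "0 \<le> k" "k \<le> n" "k \<le> 2 ^ w"
  using sum_bits_bounds[of emp i "i + n", OF emp_bits] n n_le unfolding k_def by auto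

text \<open>Only first positions carry a flag, and distinct first positions have distinct heads. So
  the heads, listed by increasing position, are strictly sorted and form a valid batch for the
  summary.\<close>

lemma gone_batch:
  assumes "array_at M' d (map hh (filter (\<lambda>p. emp p = 1) [i..i + n - 1]))"
  shows "batch L hw M' d k gone"
proof -
  let ?ps = "filter (\<lambda>p. emp p = 1) [i..i + n - 1]"
  have "set (map hh ?ps) = hh ` {p \<in> pos. emp p = 1}" by auto
  also have "\<dots> = gone"
  proof
    show "hh ` {p \<in> pos. emp p = 1} \<subseteq> gone"
      unfolding gone_def high_X by (auto simp: emp_def split: if_splits)
    show "gone \<subseteq> hh ` {p \<in> pos. emp p = 1}"
    proof
      fix h assume h: "h \<in> gone"
      then have "h \<in> high w ` X" by (simp add: gone_def)
      then obtain p where p: "p \<in> pos" "first p" "hh p = h" by (rule first_exists)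
      moreover from p h have "emp p = 1" by (auto simp: gone_def emp_def)
      ultimately show "h \<in> hh ` {p \<in> pos. emp p = 1}" by blast
    qed
  qed
  finally have set: "set (map hh ?ps) = gone" .
  have "sorted_wrt (<) ?ps"
    by (intro sorted_wrt_filter) (simp add: strict_sorted_iff)
  then have "sorted_wrt (\<lambda>p q. hh p < hh q) ?ps"
  proof (rule sorted_wrt_mono_rel[rotated])
    fix p q assume *: "p \<in> set ?ps" "q \<in> set ?ps" "p < q"
    then have "p \<in> pos" "q \<in> pos" "first p" "first q"
      by (auto simp: emp_def split: if_splits)
    then show "hh p < hh q" using hh_mono[of p q] first_unique[of p q] * by force
  qed
  then have sorted: "sorted_wrt (<) (map hh ?ps)" by (simp add: sorted_wrt_map)
  have "gone \<subseteq> heads w" unfolding gone_def high_X using hh_heads by blast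
  moreover have "(2::int) ^ hw < 2 ^ L" using pow_bounds(3,7) by linarith
  ultimately have "batch L hw M' d (int (length (map hh ?ps))) gone"
    using batch_of_array[OF assms sorted, of hw] unfolding set by blast
  then show ?thesis unfolding k_def sum_bits_length[of emp, OF emp_bits] by simp
qed

lemma run_packs:
  assumes "counts emp g M2 i (i + n)" "\<And>x. x \<in> pos \<Longrightarrow> M2 x = M x"
  shows "run L veb_prog all_cells {d..<d + 2 ^ w}
     (map_of (zip pack_params [i, i + n, int w, int lw, g, d, k])) pack_com M2
     (\<lambda>r M' c s. batch L hw M' d k gone \<and> int c \<le> 100 * n \<and> s \<le> 50 + 50 * w)"
proof -
  have dk: "{d..<d + k} \<subseteq> {d..<d + 2 ^ w}" using k_bounds by auto
  have d': "f + 2 ^ w + 2 ^ w = d" by (simp add: d_def)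
  have dd: "{f..<d} \<inter> {d..<d + 2 ^ w} = {}" by auto
  have cnt: "{g + i<..<g + (i + n)} \<subseteq> {f..<d}"
  proof -
    have "{f + 2 ^ w..<d} \<subseteq> {f..<d}" by simp
    then show ?thesis using cnt_cells unfolding d' by blast
  qed
  have d0: "0 \<le> d" "d + k < 2 ^ L"
  proof -
    have "0 \<le> (2::int) ^ hw * scr lw" by (simp add: scr_def)
    then show "0 \<le> d" "d + k < 2 ^ L"
      using f pow_bounds(1) scr_fits k_bounds(3) unfolding d_def by linarith+
  qed
  have pack: "run L veb_prog (pos \<union> {g + i<..<g + (i + n)} \<union> {d..<d + sum emp pos})
     {d..<d + sum emp pos}
    (map_of (zip pack_params [i, i + n, int w, int lw, g, d, sum emp pos])) pack_com M2
    (\<lambda>r M' c s. array_at M' d (map (\<lambda>p. grp w lw (M2 p)) (filter (\<lambda>p. emp p = 1) [i..i + n - 1])) \<and>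
      c + 50 \<le> 100 * nat (i + n - i) \<and> s \<le> 50 * (w + 1))"
  proof (rule run_pack[OF assms(1) veb_prog_procs(6) emp_bits])
    show "{d..<d + sum emp pos} \<inter> (pos \<union> {g + i<..<g + (i + n)}) = {}"
      using dk cnt dd scratch_cells(2) disj(3) unfolding k_def by blast
    show "is_word L (M2 p)" if "p \<in> pos" for p using assms(2)[OF that] words(7)[OF that] by simp
  qed (use pow_bounds(7) high_low_bits(3) i cnt_word d0 n_le in \<open>simp_all add: k_def\<close>)
  have eq: "map (\<lambda>p. grp w lw (M2 p)) (filter (\<lambda>p. emp p = 1) [i..i + n - 1]) =
      map hh (filter (\<lambda>p. emp p = 1) [i..i + n - 1])"
    using assms(2) by (auto simp: hh_def)
  show ?thesis
  proof (rule run_conseq[OF pack[folded k_def]])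
    show "pos \<union> {g + i<..<g + (i + n)} \<union> {d..<d + k} \<subseteq> all_cells"
      using dk cnt scratch_cells(1,2) unfolding d' by blast
    show "{d..<d + k} \<subseteq> {d..<d + 2 ^ w}" by (rule dk)
    fix r M' c s'
    assume "array_at M' d (map (\<lambda>p. grp w lw (M2 p)) (filter (\<lambda>p. emp p = 1) [i..i + n - 1])) \<and>
        c + 50 \<le> 100 * nat (i + n - i) \<and> s' \<le> 50 * (w + 1)"
    then show "batch L hw M' d k gone \<and> int c \<le> 100 * n \<and> s' \<le> 50 + 50 * w"
      using gone_batch[of M'] n unfolding eq by auto
  qed
qed

text \<open>An empty array is present in every memory, so \<open>gone_batch\<close> applies although
  nothing has been packed.\<close>

lemma gone_empty: "k = 0 \<Longrightarrow> gone = {}"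
proof -
  assume k: "k = 0"
  then have "filter (\<lambda>p. emp p = 1) [i..i + n - 1] = []"
    unfolding k_def sum_bits_length[of emp, OF emp_bits] by simp
  then have "batch L hw M d 0 gone" using gone_batch[of M] k by (simp add: array_at_def)
  then show "gone = {}" by (simp add: batch_def)
qed

text \<open>By \<open>high_diff\<close>, deleting \<open>gone\<close> makes the summary agree with
  the clusters again. The work is stated with \<open>dep lw\<close> instead of
  \<open>dep hw\<close>, so that it can be added to the work on the clusters.\<close>

lemma run_summary:
  assumes gone: "batch L hw M3 d k gone" and k: "1 \<le> k"
    and Fs: "\<And>x. x \<in> Fs \<Longrightarrow> M3 x = M x"
    and clus: "\<And>h. h \<in> heads w \<Longrightarrow> holds M3 lw (ca h) (Fc h) (clus w (I - X) h)"
  shows "run L veb_prog all_cells (tree_cells \<union> scratch)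
     (map_of (zip del_params [s, int hw, d, k, u])) delete_com M3
     (\<lambda>r M' c s'. inner_holds M' w s ca Fs Fc (I - X) \<and> int c \<le> 3000 * int (dep lw) * k \<and>
         s' \<le> span_bd hw)"
    (is "run _ _ _ _ _ _ _ ?Q")
proof -
  have sub: "Fs \<subseteq> node" "{d..<d + k} \<subseteq> scratch" "{u..<u + scr hw} \<subseteq> scratch"
    using tree_cells_sub scratch_cells(2,4) k_bounds(3) by auto
  have holds: "holds M3 hw s Fs (high w ` I)"
    using inner Fs by (intro holds_frame[of M hw s Fs _ M3]) (auto simp: inner_holds_def)
  have du: "d + 2 ^ w = u" by (simp add: d_def u_def)
  have spec: "run L veb_prog (Fs \<union> {d..<d + k} \<union> {u..<u + scr hw}) (Fs \<union> {u..<u + scr hw})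
     (map_of (zip del_params [s, int hw, d, k, u])) delete_com M3
     (\<lambda>v M' c s'. v = (if high w ` I \<subseteq> gone then 1 else 0) \<and> holds M' hw s Fs (high w ` I - gone) \<and>
        work_ok hw k v c \<and> s' \<le> span_bd hw)" (is "run _ _ _ _ _ _ _ ?S")
  proof (rule high_spec[unfolded del_spec_def, rule_format])
    show "gone \<subseteq> high w ` I" using X by (auto simp: gone_def)
    show "Fs \<subseteq> {0..<2 ^ L}" using sub(1) cells by blast
    show "0 \<le> d" "0 \<le> u" using f pow_bounds(1) by (auto simp: d_def u_def)
    show "u + scr hw < 2 ^ L" using scratch_cells(5) f by linarith
    moreover have "0 \<le> scr hw" by (simp add: scr_def)
    ultimately show "d + k < 2 ^ L" using k_bounds(3) du by linarith
    show "Fs \<inter> {d..<d + k} = {}" "Fs \<inter> {u..<u + scr hw} = {}" using sub disj(2) by blast+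
    show "{d..<d + k} \<inter> {u..<u + scr hw} = {}" using k_bounds(3) du by auto
  qed (use gone k holds in auto)
  show ?thesis
  proof (rule run_conseq[OF spec])
    show "Fs \<union> {d..<d + k} \<union> {u..<u + scr hw} \<subseteq> all_cells" using sub by blast
    show "Fs \<union> {u..<u + scr hw} \<subseteq> tree_cells \<union> scratch" using sub by blast
    fix v M' c s'
    assume *: "?S v M' c s'"
      and frame: "\<And>x. x \<notin> Fs \<union> {u..<u + scr hw} \<Longrightarrow> M' x = M3 x"
    have "holds M' lw (ca h) (Fc h) (clus w (I - X) h)" if h: "h \<in> heads w" for h
    proof (rule holds_frame[OF clus[OF h]], rule frame)
      fix x assume "x \<in> Fc h"
      then show "x \<notin> Fs \<union> {u..<u + scr hw}"
        using clusters_disjoint(2)[OF h] cluster_cells[OF h] disj(2) sub(3) by blast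
    qed
    moreover have "high w ` (I - X) = high w ` I - gone" unfolding gone_def by (rule high_diff[OF X])
    ultimately have "inner_holds M' w s ca Fs Fc (I - X)" using * by (simp add: inner_holds_def)
    moreover have "int c \<le> 3000 * int (dep lw) * k"
    proof -
      have v: "v = 0 \<or> v = 1" using * by auto
      have d1: "1 \<le> dep hw" "dep hw \<le> dep lw" using dep_ge_1 dep_mono high_low_bits(2) by blast+
      have "int c \<le> 3000 * int (dep hw) * k"
        using v * d1 unfolding work_ok_def by auto
      also have "\<dots> \<le> 3000 * int (dep lw) * k" using d1 k by (intro mult_right_mono) auto
      finally show ?thesis .
    qed
    ultimately show "?Q v M' c s'"
      using * by blast
  qed
qed

lemma lw_eq: "(int w + 1) div 2 = int lw" "int w div 2 = int hw"
  by (simp_all add: low_bits_def high_bits_def zdiv_int)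

text \<open>The clusters cost \<open>3000 * dep lw\<close> for \<open>n - k\<close> keys and the
  summary the same for \<open>k\<close> keys, together as much as \<open>n\<close> keys at one level
  less. Loops, packing and the term \<open>500 * k\<close> are linear in \<open>n\<close> because
  \<open>k \<le> n\<close>, and fit into \<open>1500 * n\<close>.\<close>

lemma run_inner_com:
  "run L veb_prog all_cells (tree_cells \<union> scratch)
     (map_of (zip del_params [a, int w, i, n, f])) inner_com M
     (\<lambda>r M' c s'. inner_holds M' w s ca Fs Fc (I - X) \<and>
        int c \<le> 3000 * int (dep lw) * n + 1500 * n \<and> s' \<le> 800 + 300 * w + span_bd lw + span_bd hw)"
proof -
  have "{a..<a + 4} \<subseteq> node" by (auto simp: node_cells_def)
  then have ac: "a + 2 \<in> node" "a + 3 \<in> node" by auto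
  then have aL: "a + 2 \<in> {0..<2 ^ L}" "a + 3 \<in> {0..<2 ^ L}" using cells by blast+
  have tL: "t \<in> {0..<2 ^ L}"
    using cells by (rule subsetD) (auto simp: node_cells_def)
  have sL: "s \<in> {0..<2 ^ L}"
    using holds_header(1)[of M hw s Fs "high w ` I"] inner tree_cells_sub cells
    unfolding inner_holds_def by blast
  have lk: "M (a + 2) = s" "M (a + 3) = t" using links by (simp_all add: links_def)
  have scr0: "0 \<le> (2::int) ^ hw * scr lw" by (simp add: scr_def)
  have wd: "is_word L (int w)" "is_word L (int w + 1)" "is_word L (int lw)" "is_word L (int hw)"
    "is_word L (a + 2)" "is_word L (a + 3)" "is_word L (i + n)"
    "is_word L (f + 2 ^ w)" "is_word L g" "is_word L (f + 2 ^ w + 2 ^ w)" "is_word L d" "is_word L u"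
    "is_word L 3"
  proof -
    have "int w < 2 ^ w" using of_nat_less_two_power by blast
    then have w1: "int w + 1 < 2 ^ L" using pow_bounds(7) by linarith
    have l1: "int lw \<le> int w" "int hw \<le> int w" using high_low_bits by auto
    show "is_word L (int w)" "is_word L (int w + 1)" "is_word L (int lw)" "is_word L (int hw)"
      using w1 l1 unfolding is_word_def by linarith+
    show "is_word L (a + 2)" "is_word L (a + 3)" using aL words(9) by blast+
    show "is_word L (i + n)" using n by (intro words(6)) auto
    show "is_word L (f + 2 ^ w)" "is_word L g" "is_word L (f + 2 ^ w + 2 ^ w)" "is_word L d"
        "is_word L u"
      "is_word L 3"
      using f i n scr_fits scr0 pow_bounds(1,4,7) unfolding is_word_def d_def u_def g_def by linarith+
  qed
  have nodeFs: "Fs \<subseteq> node" using tree_cells_sub by blast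
  \<comment> \<open>The states after the two loops and the packing. The cell \<open>a + 2\<close>
    appears in \<open>N2\<close> and \<open>N3\<close> because the pointer to the summary is read
    only after these stages.\<close>
  define N1 where "N1 M1 \<longleftrightarrow> (\<forall>x\<in>node \<union> pos. M1 x = M x) \<and>
      (\<forall>p\<in>pos. lst p \<longrightarrow> M1 (f + hh p) = p + 1)" for M1
  define N2 where "N2 M2 \<longleftrightarrow> clus_done M2 \<and>
      counts emp g M2 i (i + n) \<and> (\<forall>x\<in>Fs \<union> pos \<union> {a + 2}. M2 x = M x)" for M2
  define N3 where "N3 M3 \<longleftrightarrow> clus_done M3 \<and>
      batch L hw M3 d k gone \<and> (\<forall>x\<in>Fs \<union> {a + 2}. M3 x = M x)" for M3
  have sgs: "{f..<f + 2 ^ w + 2 ^ w} \<subseteq> scratch" "{d..<d + 2 ^ w} \<subseteq> scratch" by (rule scratch_cells)+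
  have stage1: "run L veb_prog all_cells (tree_cells \<union> scratch) (for_env i (i + n) loop_args)
      (for_com ''seg'' seg_com) M (\<lambda>r M1 c s. N1 M1 \<and> int c \<le> 160 * n \<and> s \<le> 110 + 50 * w)"
  proof (rule run_conseq[OF run_seg])
    fix v M' c s'
    assume *: "(\<forall>p\<in>pos. lst p \<longrightarrow> M' (f + hh p) = p + 1) \<and> int c \<le> 160 * n \<and> s' \<le> 110 + 50 * w"
      and frame: "\<And>x. x \<notin> {f..<f + 2 ^ w + 2 ^ w} \<Longrightarrow> M' x = M x"
    have "M' x = M x" if "x \<in> node \<union> pos" for x
      by (rule frame) (use that sgs(1) disj(2,3) in blast)
    then show "N1 M' \<and> int c \<le> 160 * n \<and> s' \<le> 110 + 50 * w" using * unfolding N1_def by blast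
  qed (use sgs in blast)+
  have stage2: "run L veb_prog all_cells (tree_cells \<union> scratch) (for_env i (i + n) loop_args)
      (for_com ''run'' run_com) M1 (\<lambda>r M2 c s. r = k \<and> N2 M2 \<and>
        int c \<le> 200 * n + 3000 * int (dep lw) * (n - k) + 500 * k \<and> s \<le> 150 + span_bd lw + 50 * w)"
    if "N1 M1" for M1
  proof -
    have "M1 x = M x" if "x \<in> node \<union> pos" for x using \<open>N1 M1\<close> that unfolding N1_def by blast
    moreover have "M1 (f + hh q) = q + 1" if "q \<in> pos" "lst q" for q
        using \<open>N1 M1\<close> that unfolding N1_def by blast
    ultimately show ?thesis
    proof (rule run_conseq[OF run_runs])
      show "clusters \<union> scratch \<subseteq> tree_cells \<union> scratch" by blast
      fix r M' c s'
      assume *: "run_post r M' c s'"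
        and frame: "\<And>x. x \<notin> clusters \<union> scratch \<Longrightarrow> M' x = M1 x"
      have "a + 2 \<notin> clusters"
      proof
        assume "a + 2 \<in> clusters"
        then obtain h where h: "h \<in> heads w" "a + 2 \<in> Fc h" by blast
        moreover have "Fc h \<inter> {a..<a + 4} = {}" using layout h(1) unfolding layout_def by blast
        moreover have "a + 2 \<in> {a..<a + 4}" by simp
        ultimately show False by blast
      qed
      moreover have "a + 2 \<notin> scratch" using ac disj(2) by blast
      ultimately have "M' (a + 2) = M1 (a + 2)" by (intro frame) blast
      then have "M' (a + 2) = M (a + 2)" using \<open>N1 M1\<close> ac unfolding N1_def by simp
      then show "r = k \<and> N2 M' \<and>
        int c \<le> 200 * n + 3000 * int (dep lw) * (n - k) + 500 * k \<and> s' \<le> 150 + span_bd lw + 50 * w"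
        using * unfolding N2_def k_def by blast
    qed (assumption | rule order_refl)+
  qed
  have stage3: "run L veb_prog all_cells (tree_cells \<union> scratch)
     (map_of (zip pack_params [i, i + n, int w, int lw, g, d, k])) pack_com M2
     (\<lambda>r M3 c s. N3 M3 \<and> int c \<le> 100 * n \<and> s \<le> 50 + 50 * w)" if N2: "N2 M2" for M2
  proof -
    have "counts emp g M2 i (i + n)" using N2 unfolding N2_def by blast
    moreover have "M2 x = M x" if "x \<in> pos" for x using N2 that unfolding N2_def by blast
    ultimately show ?thesis
    proof (rule run_conseq[OF run_packs])
      show "{d..<d + 2 ^ w} \<subseteq> tree_cells \<union> scratch" using sgs(2) by blast
      fix r M' c s'
      assume *: "batch L hw M' d k gone \<and> int c \<le> 100 * n \<and> s' \<le> 50 + 50 * w"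
        and frame: "\<And>x. x \<notin> {d..<d + 2 ^ w} \<Longrightarrow> M' x = M2 x"
      have eq: "M' x = M2 x" if "x \<in> node" for x
        by (rule frame) (use that sgs(2) disj(2) in blast)
      have "holds M' lw (ca h) (Fc h) (clus w (I - X) h)" if h: "h \<in> heads w" for h
      proof (rule holds_frame)
        show "holds M2 lw (ca h) (Fc h) (clus w (I - X) h)" using N2 h unfolding N2_def by blast
        show "M' x = M2 x" if "x \<in> Fc h" for x by (rule eq) (use that cluster_cells[OF h] in blast)
      qed
      moreover have "M' x = M x" if "x \<in> Fs \<union> {a + 2}" for x
      proof -
        have "M' x = M2 x" by (rule eq) (use that ac nodeFs in blast)
        also have "\<dots> = M x" using N2 that unfolding N2_def by blast
        finally show ?thesis .
      qed
      ultimately show "N3 M' \<and> int c \<le> 100 * n \<and> s' \<le> 50 + 50 * w" using * unfolding N3_def by blast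
    qed (assumption | rule order_refl)+
  qed
  have stage4: "run L veb_prog all_cells (tree_cells \<union> scratch)
     (map_of (zip del_params [s, int hw, d, k, u])) delete_com M3
     (\<lambda>r M' c s'. inner_holds M' w s ca Fs Fc (I - X) \<and> int c \<le> 3000 * int (dep lw) * k \<and>
         s' \<le> span_bd hw)"
    if "N3 M3" "k \<noteq> 0" for M3
    by (rule run_summary) (use that k_bounds in \<open>auto simp: N3_def\<close>)
  \<comment> \<open>Justifies the early exit: if no cluster has become empty, the summary is already
    correct.\<close>
  have unchanged: "inner_holds M2 w s ca Fs Fc (I - X)" if "k = 0" "N2 M2" for M2
  proof -
    have "high w ` (I - X) = high w ` I - gone" unfolding gone_def by (rule high_diff[OF X])
    then have "high w ` (I - X) = high w ` I" using gone_empty[OF that(1)] by simp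
    moreover have "holds M2 hw s Fs (high w ` I)"
      using inner that(2) by (intro holds_frame[of M hw s Fs _ M2]) (auto simp: inner_holds_def N2_def)
    ultimately show ?thesis using that(2) by (simp add: inner_holds_def N2_def)
  qed
  \<comment> \<open>The saving from emptied clusters and the cost of the summary recombine to the
    budget of all \<open>n\<close> keys.\<close>
  have dk: "0 \<le> 3000 * int (dep lw) * (n - k)" "3000 * int (dep lw) * (n - k) + 3000 * int (dep lw)
      * k = 3000 * int (dep lw) * n"
  proof -
    show "0 \<le> 3000 * int (dep lw) * (n - k)" using k_bounds by (intro mult_nonneg_nonneg) auto
  qed (simp add: algebra_simps)
  show ?thesis
    unfolding inner_com_def
    apply (rule run_Bind[where N="\<lambda>r M' c s. r = 2 ^ w \<and> M' = M \<and> c = 4 \<and> s = 4"])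
     apply (rule run_Ret[OF exp_val_pow2[OF _ pow_bounds(7)]])
      apply simp
     apply simp
    apply clarify
    apply (rule run_Bind_Ret[where v="int lw"])
    subgoal using wd words by (simp add: word_result_def lw_eq)
    apply (rule run_Bind_Read[where i="a + 3" and v=t])
    subgoal using wd by (simp add: word_result_def)
    subgoal using aL by simp
    subgoal by (rule words(9)[OF tL])
    subgoal using ac by blast
    subgoal by (simp add: lk)
    apply (rule run_Bind_Ret[where v="i + n"])
    subgoal using wd by (simp add: word_result_def)
    apply (rule run_Bind_Ret[where v=g])
    subgoal using wd by (simp add: word_result_def g_def)
    apply (rule run_Bind_Ret[where v=d])
    subgoal using wd by (simp add: word_result_def d_def)
    apply (rule run_Bind_Ret[where v=u])
    subgoal using wd by (simp add: word_result_def d_def u_def)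
    apply (rule run_Bind[where N="\<lambda>r M1 c s. N1 M1 \<and> int c \<le> 160 * n + 11 \<and> s \<le> 121 + 50 * w"])
     apply (rule run_Call[OF veb_prog_procs(4), where vs="i # (i + n) # loop_args"])
       apply simp
      apply simp
     apply (rule run_conseq[OF stage1])
       apply simp
      apply simp
     apply simp
    apply (elim conjE)
    apply (rule run_Bind[where N="\<lambda>r M2 c s. r = k \<and> N2 M2 \<and>
        int c \<le> 200 * n + 3000 * int (dep lw) * (n - k) + 500 * k + 11 \<and> s \<le> 161 + span_bd lw + 50 * w"])
     apply (rule run_Call[OF veb_prog_procs(5), where vs="i # (i + n) # loop_args"])
       apply simp
      apply simp
     apply (rule run_conseq[OF stage2])
        apply assumption
       apply simp
      apply simp
     apply simp
    apply (elim conjE)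
    apply (rule run_Cond[where i="if k = 0 then 1 else 0"])
    subgoal using words by (simp add: word_result_def)
     apply (rule run_Ret[where v=0])
    subgoal using words by (simp add: word_result_def)
    subgoal for \<dots> M2 c2 s2
      using unchanged[of M2] dk k_bounds n by (simp split: if_splits)
    apply (rule run_Bind[where N="\<lambda>r M3 c s. N3 M3 \<and> int c \<le> 100 * n + 8 \<and> s \<le> 58 + 50 * w"])
     apply (rule run_Call[OF veb_prog_procs(6), where vs="[i, i + n, int w, int lw, g, d, k]"])
       apply simp
      apply simp
     apply (rule run_conseq[OF stage3])
        apply assumption
       apply simp
      apply simp
     apply simp
    apply (elim conjE)
    apply (rule run_Bind[where N="\<lambda>r M3 c s'. r = s \<and> N3 M3 \<and> c = 4 \<and> s' = 4"])
     apply (rule run_Read[where i="a + 2"])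
    subgoal using wd words by (simp add: word_result_def)
    subgoal using aL by simp
    subgoal unfolding N3_def using words(9)[OF sL] lk by simp
    subgoal using ac by blast
    subgoal unfolding N3_def using lk by simp
    apply clarify
    apply (rule run_Call[OF veb_prog_procs(1), where vs="[s, int hw, d, k, u]"])
      apply simp
    subgoal using wd words by (simp add: word_result_def lw_eq)
    apply (rule run_conseq[OF stage4])
        apply assumption
    subgoal by (simp split: if_splits)
    subgoal by simp
    subgoal by simp
    subgoal using dk k_bounds n by simp
    done
qed

end

section \<open>Deletion from a tree\<close>

lemma inner_holds_frame:
  assumes "inner_holds M w s ca Fs Fc I" "\<And>x. x \<in> Fs \<union> (\<Union>h\<in>heads w. Fc h) \<Longrightarrow> M' x = M x"
  shows "inner_holds M' w s ca Fs Fc I"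
  unfolding inner_holds_def
proof (intro conjI ballI)
  show "holds M' (high_bits w) s Fs (high w ` I)"
    using assms by (intro holds_frame[of M _ s Fs _ M']) (auto simp: inner_holds_def)
  show "holds M' (low_bits w) (ca h) (Fc h) (clus w I h)" if "h \<in> heads w" for h
  proof (rule holds_frame)
    show "holds M (low_bits w) (ca h) (Fc h) (clus w I h)" using assms(1) that
        by (simp add: inner_holds_def)
    show "M' x = M x" if "x \<in> Fc h" for x by (rule assms(2)) (use that \<open>h \<in> heads w\<close> in blast)
  qed
qed

lemma links_frame:
  assumes "links M w a s t ca" "\<And>x. x \<in> {a + 2, a + 3} \<union> {t..<t + 2 ^ high_bits w} \<Longrightarrow> M' x = M x"
  shows "links M' w a s t ca"
  using assms unfolding links_def by auto

lemma encode_eq: "K \<noteq> {} \<Longrightarrow> encode w (min_key K) = Min K" "K \<noteq> {} \<Longrightarrow> encode w (max_key K) = Max K"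
  by (simp_all add: encode_min_key)

lemma pow_le_scr: "4 * 2 ^ w \<le> scr w"
proof -
  have "(2::int) ^ (w + 2) \<le> scr w" unfolding scr_def by (rule power_increasing) auto
  then show ?thesis by (simp add: power_add)
qed

text \<open>\<open>ob\<close> is the offset of the minimum or maximum cell in a header, used both in
  the summary and in the cluster found through it. The key assembled from the two values is deleted
  as a batch of size one, at the cost of \<open>inner\<close> for one key plus a constant. Bounding
  the work suffices, as it also bounds the span.\<close>

lemma run_extract_com:
  assumes w: "2 \<le> w" and low_spec: "del_spec (low_bits w)" and high_spec: "del_spec (high_bits w)"
    and links: "links M w a s t ca" and layout: "layout w a t Fs Fc"
    and inner: "inner_holds M w s ca Fs Fc I" and I: "I \<subseteq> {0..<2 ^ w}"
    and cells: "node_cells w a t Fs Fc \<subseteq> {0..<2 ^ L}"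
    and f0: "0 \<le> f" "f + scr w < 2 ^ L"
    and disj: "node_cells w a t Fs Fc \<inter> {f..<f + scr w} = {}"
    and ob: "ob \<in> {0, 1}"
    and m: "m = (if ob = 0 then Min I else Max I)"
  shows "run L veb_prog (node_cells w a t Fs Fc \<union> {f..<f + scr w})
     (Fs \<union> (\<Union>h\<in>heads w. Fc h) \<union> {f..<f + scr w})
     (map_of (zip [''a'', ''w'', ''o'', ''d'', ''f''] [a, int w, ob, d, f])) extract_com M
     (\<lambda>r M' c s'. inner_holds M' w s ca Fs Fc (I - {m}) \<and> r = (if I = {} then d else m) \<and>
        c \<le> (if I = {} then 50 else 3000 * dep (low_bits w) + 1700))"
proof -
  let ?H = "high w ` I"
  let ?N = "node_cells w a t Fs Fc"
  have w2: "(2::int) ^ w < 2 ^ L" "1 \<le> (2::int) ^ w" 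
  proof -
    show 1: "1 \<le> (2::int) ^ w" by simp
    then show "(2::int) ^ w < 2 ^ L" using pow_le_scr[of w] f0 by linarith
  qed
  have bits: "(2::int) ^ high_bits w \<le> 2 ^ w" "(2::int) ^ low_bits w \<le> 2 ^ w"
    by (simp_all add: power_increasing high_low_bits)
  have words: "is_word L x" if "x \<in> {0..<2 ^ L}" for x using that
      by (auto simp: is_word_def intro: order_trans[of _ 0])
  have fin: "finite I" using I finite_subset by blast
  have "{a..<a + 4} \<subseteq> ?N" by (auto simp: node_cells_def)
  then have aN: "a + 2 \<in> ?N" "a + 3 \<in> ?N" by auto
  have lk: "M (a + 2) = s" "M (a + 3) = t" using links by (simp_all add: links_def)
  have Hh: "holds M (high_bits w) s Fs ?H" using inner by (simp add: inner_holds_def)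
  note hd = holds_header[OF Hh]
  have FsN: "Fs \<subseteq> ?N" by (auto simp: node_cells_def)
  have sN: "s \<in> ?N" "s + 1 \<in> ?N" using hd(1,2) FsN by blast+
  have finH: "finite ?H" using fin by simp
  have keyw: "is_word L (encode (high_bits w) (min_key ?H))"
      "is_word L (encode (high_bits w) (max_key ?H))"
  proof -
    have "Min ?H \<in> heads w \<and> Max ?H \<in> heads w" if "?H \<noteq> {}"
      using Min_in[OF finH that] Max_in[OF finH that] hd(5) by blast
    then have "(?H \<noteq> {} \<longrightarrow> 0 \<le> Min ?H \<and> Min ?H < 2 ^ high_bits w \<and> 0 \<le> Max ?H \<and> Max ?H < 2 ^ high_bits w)"
      unfolding atLeastLessThan_iff by blast
    moreover have "0 < (2::int) ^ high_bits w" by simp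
    ultimately show "is_word L (encode (high_bits w) (min_key ?H))"
        "is_word L (encode (high_bits w) (max_key ?H))"
      using w2 bits unfolding encode_min_key is_word_def by - (smt (verit))+
  qed
  have numw: "is_word L 0" "is_word L 1" "is_word L 2" "is_word L 3" "is_word L (int w)"
      "is_word L (int w + 1)"
    "is_word L (int (low_bits w))" "is_word L f" "is_word L (f + 1)"
  proof -
    have "int w < 2 ^ w" using of_nat_less_two_power by blast
    moreover have "(4::int) \<le> 2 ^ w" using power_increasing[OF w, of "2::int"] by simp
    moreover have "int (low_bits w) \<le> int w" using high_low_bits by simp
    ultimately show "is_word L 0" "is_word L 1" "is_word L 2" "is_word L 3" "is_word L (int w)"
        "is_word L (int w + 1)"
      "is_word L (int (low_bits w))" "is_word L f" "is_word L (f + 1)"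
      using w2 f0 pow_le_scr[of w] unfolding is_word_def by linarith+
  qed
  have aw: "is_word L (a + 2)" "is_word L (a + 3)" "is_word L s" "is_word L (s + 1)" "0 \<le> a + 2"
      "0 \<le> a + 3" "0 \<le> s"
    using aN sN cells words by auto
  have lw: "(int w + 1) div 2 = int (low_bits w)" by (simp add: low_bits_def zdiv_int)
  define Q where "Q r M' c \<longleftrightarrow> inner_holds M' w s ca Fs Fc (I - {m}) \<and> r = (if I = {} then d else m) \<and>
        c \<le> (if I = {} then 50 else 3000 * dep (low_bits w) + 1700)" for r M' and c :: nat
  have main: "run L veb_prog (?N \<union> {f..<f + scr w}) (Fs \<union> (\<Union>h\<in>heads w. Fc h) \<union> {f..<f + scr w}) \<rho>
    (Bind ''h'' (Read (plus_e (Var ''s'') (Var ''o'')))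
    (Bind ''t'' (Read (plus_e (Var ''a'') (Lit 3)))
    (Bind ''c'' (Read (plus_e (Var ''t'') (Var ''h'')))
    (Bind ''x'' (Read (plus_e (Var ''c'') (Var ''o'')))
    (Bind ''x'' (Ret (plus_e (Bin Shl (Var ''h'') (Bin Div (plus_e (Var ''w'') (Lit 1)) (Lit 2)))
        (Var ''x'')))
    (Bind ''u'' (Write (Var ''f'') (Var ''x''))
    (Bind ''u'' (Call ''inner'' [Var ''a'', Var ''w'', Var ''f'', Lit 1, plus_e (Var ''f'') (Lit 1)])
    (Ret (Var ''x'')))))))))
    M (\<lambda>r M' c s'. Q r M' (c + 50))"
    if ne: "I \<noteq> {}" and \<rho>: "\<rho> ''a'' = Some a" "\<rho> ''s'' = Some s" "\<rho> ''w'' = Some (int w)"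
        "\<rho> ''o'' = Some ob"
      "\<rho> ''f'' = Some f" for \<rho>
  proof -
    have neH: "?H \<noteq> {}" using ne by simp
    define y where "y = (if ob = 0 then Min ?H else Max ?H)"
    define z where "z = (if ob = 0 then Min (clus w I y) else Max (clus w I y))"
    have hH: "y \<in> ?H" using neH Min_in[OF finH] Max_in[OF finH] by (simp add: y_def)
    then have h: "y \<in> heads w" using hd(5) by blast
    have Hc: "holds M (low_bits w) (ca y) (Fc y) (clus w I y)" using inner h
        by (simp add: inner_holds_def)
    note ch = holds_header[OF Hc]
    have neC: "clus w I y \<noteq> {}" using hH by (simp add: clus_empty_iff)
    have FcN: "Fc y \<subseteq> ?N" using h by (auto simp: node_cells_def)
    have lC: "z \<in> clus w I y" using neC Min_in[OF ch(6)] Max_in[OF ch(6)] by (simp add: z_def)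
    then have l: "0 \<le> z" "z < 2 ^ low_bits w" using ch(5) by auto
    have eq: "y * 2 ^ low_bits w + z = m"
      using Min_eq_high_low[OF fin ne, of w] Max_eq_high_low[OF fin ne, of w] unfolding m z_def
          y_def by simp
    have mI: "m \<in> I" unfolding m using fin ne by simp
    then have mb: "0 \<le> m" "m < 2 ^ w" using I by auto
    have Mh: "M (s + ob) = y" using hd(3,4) ob neH by (auto simp: encode_min_key y_def)
    have Ml: "M (ca y + ob) = z" using ch(3,4) ob neC by (auto simp: encode_min_key z_def)
    have tN: "{t..<t + 2 ^ high_bits w} \<subseteq> ?N" by (auto simp: node_cells_def)
    have th: "t + y \<in> ?N" using tN h by auto
    have Mc: "M (t + y) = ca y" using links h unfolding links_def by blast
    have so: "s + ob \<in> ?N" using sN ob by auto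
    have co: "ca y + ob \<in> ?N" using ch(1,2) FcN ob by auto
    have caN: "ca y \<in> ?N" using ch(1) FcN by blast
    have inL: "x \<in> ?N \<Longrightarrow> 0 \<le> x" "x \<in> ?N \<Longrightarrow> is_word L x" for x using cells words by auto
    have t0: "t \<in> ?N" using tN by auto
    have kw: "is_word L y" "is_word L z" "is_word L m" "is_word L (y * 2 ^ low_bits w)"
    proof -
      have hb: "0 \<le> y" "y < 2 ^ high_bits w" using h by auto
      have "0 \<le> y * 2 ^ low_bits w" using hb by simp
      moreover have "y * 2 ^ low_bits w \<le> m" using eq l by linarith
      ultimately show "is_word L y" "is_word L z" "is_word L m" "is_word L (y * 2 ^ low_bits w)"
        using hb l mb w2 bits unfolding is_word_def by linarith+
    qed
    let ?M = "M(f := m)"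
    have scr4: "4 \<le> scr w" using pow_le_scr[of w] w2 by linarith
    then have "f \<in> {f..<f + scr w}" by simp
    then have fN: "f \<notin> ?N" using disj by blast
    have frame: "?M x = M x" if "x \<in> ?N" for x using fN that by auto
    have fs: "{f..<f + 1} \<subseteq> {f..<f + scr w}" "{f + 1..<f + 1 + scr w - 1} \<subseteq> {f..<f + scr w}"
      using scr4 by auto
    \<comment> \<open>The batch is the cell \<open>f\<close>, which has just received the key; the
      working region begins one cell later and ends where the original one does.\<close>
    interpret veb_inner L w ?M a s t ca Fs Fc I "{m}" f 1 "f + 1"
    proof
      show "links ?M w a s t ca" using tN aN by (intro links_frame[OF links] frame) auto
      show "inner_holds ?M w s ca Fs Fc I"
        by (intro inner_holds_frame[OF inner] frame) (auto simp: node_cells_def)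
      have one: "{f..<f + 1} = {f}" by auto
      show "batch L w ?M f 1 {m}" using mb kw by (auto simp: batch_def one)
      show "{m} \<subseteq> I" using mI by simp
      show "?N \<inter> {f..<f + 1} = {}" "?N \<inter> {f + 1..<f + 1 + scr w - 1} = {}" using fs disj by blast+
    qed (use w low_spec high_spec layout I cells f0 scr4 in auto)
    have call: "run L veb_prog (?N \<union> {f..<f + scr w}) (Fs \<union> (\<Union>h\<in>heads w. Fc h) \<union> {f..<f + scr w})
       (map_of (zip del_params [a, int w, f, 1, f + 1])) inner_com ?M
       (\<lambda>r M' c s'. inner_holds M' w s ca Fs Fc (I - {m}) \<and> c \<le> 3000 * dep (low_bits w) + 1500)"
    proof (rule run_conseq[OF run_inner_com])
      show "?N \<union> {f..<f + 1} \<union> {f + 1..<f + 1 + scr w - 1} \<subseteq> ?N \<union> {f..<f + scr w}"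
        "Fs \<union> (\<Union>h\<in>heads w. Fc h) \<union> {f + 1..<f + 1 + scr w - 1} \<subseteq> Fs \<union> (\<Union>h\<in>heads w. Fc h) \<union>
            {f..<f + scr w}"
        using fs by blast+
    qed auto
    show ?thesis
      apply (rule run_Bind_Read[where i="s + ob" and v=y])
      subgoal using \<rho> inL(2)[OF so] by (simp add: word_result_def)
      subgoal by (rule inL[OF so])
      subgoal by (rule kw)
      subgoal using so by blast
      subgoal unfolding Mh by simp
      apply (rule run_Bind_Read[where i="a + 3" and v=t])
      subgoal using \<rho> aw numw by (simp add: word_result_def)
      subgoal by (rule inL[OF aN(2)])
      subgoal by (rule inL[OF t0])
      subgoal using aN by blast
      subgoal unfolding lk by simp
      apply (rule run_Bind_Read[where i="t + y" and v="ca y"])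
      subgoal using inL(2)[OF th] by (simp add: word_result_def)
      subgoal by (rule inL[OF th])
      subgoal by (rule inL[OF caN])
      subgoal using th by blast
      subgoal unfolding Mc by simp
      apply (rule run_Bind_Read[where i="ca y + ob" and v=z])
      subgoal using \<rho> inL(2)[OF co] by (simp add: word_result_def)
      subgoal by (rule inL[OF co])
      subgoal by (rule kw)
      subgoal using co by blast
      subgoal unfolding Ml by simp
      apply (rule run_Bind_Ret[where v=m])
      subgoal
        apply (rule exp_val_Bin[where x="y * 2 ^ low_bits w" and y="z"])
           apply (rule exp_val_Bin[where x="y" and y="int (low_bits w)"])
              apply simp
        using \<rho> numw lw apply (simp add: word_result_def)
            apply simp
           apply (rule kw)
          apply simp
        using eq apply simp
        apply (rule kw)
        done
      apply (rule run_Bind[where N="\<lambda>r M' c s. M' = ?M \<and> c = 3 \<and> s = 3"])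
       apply (rule run_Write[where i=f and v=m])
      using \<rho> f0 fs apply auto[6]
      apply (elim conjE, hypsubst)
      apply (rule run_Bind[where N="\<lambda>r M' c s'. inner_holds M' w s ca Fs Fc (I - {m}) \<and>
          c \<le> 3000 * dep (low_bits w) + 1510"])
       apply (rule run_Call[OF veb_prog_procs(3), where vs="[a, int w, f, 1, f + 1]"])
         apply simp
      subgoal using \<rho> numw by (simp add: word_result_def)
       apply (rule run_conseq[OF call])
         apply simp
        apply simp
       apply simp
      apply (rule run_Ret[where v=m])
       apply simp
      using ne apply (simp add: Q_def)
      done
  qed
  have "run L veb_prog (?N \<union> {f..<f + scr w}) (Fs \<union> (\<Union>h\<in>heads w. Fc h) \<union> {f..<f + scr w})
     (map_of (zip [''a'', ''w'', ''o'', ''d'', ''f''] [a, int w, ob, d, f])) extract_com M (\<lambda>r M' c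
         s'. Q r M' c)"
    unfolding extract_com_def
    apply (rule run_Cond[where i=0])
    subgoal using w numw by (simp add: word_result_def)
     apply simp
    apply (rule run_Bind_Read[where i="a + 2" and v=s])
    subgoal using aw numw by (simp add: word_result_def)
    subgoal by (rule aw)
    subgoal by (rule aw)
    subgoal using aN by blast
    subgoal unfolding lk by simp
    apply (rule run_Bind_Read[where i=s and v="encode (high_bits w) (min_key ?H)"])
    subgoal by simp
    subgoal by (rule aw)
    subgoal by (rule keyw)
    subgoal using sN by blast
    subgoal unfolding hd(3) by simp
    apply (rule run_Bind_Read[where i="s + 1" and v="encode (high_bits w) (max_key ?H)"])
    subgoal using aw numw by (simp add: word_result_def)
    subgoal using aw by simp
    subgoal by (rule keyw)
    subgoal using sN by blast
    subgoal unfolding hd(4) by simp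
    apply (rule run_Cond[where i="if I = {} then 1 else 0"])
    subgoal using encode_less_iff[OF finH, of "high_bits w"] numw by (simp add: word_result_def)
     apply (rule run_Ret[where v=d])
      apply simp
    subgoal using inner by (simp add: Q_def split: if_splits)
    apply (rule run_conseq)
       apply (rule main)
    subgoal by (simp split: if_splits)
    apply simp_all[5]
      apply (rule order_refl)
     apply (rule order_refl)
    apply (auto simp: Q_def split: if_splits)
    done
  then show ?thesis unfolding Q_def .
qed

lemma batch_tl:
  assumes "batch L w M i n X" "1 \<le> n"
  shows "batch L w M (i + 1) (n - 1) (X - {M i mod 2 ^ w})"
proof -
  have set: "{i..<i + n} = insert i {i + 1..<i + 1 + (n - 1)}" using assms(2) by auto
  have "M i mod 2 ^ w \<notin> (\<lambda>p. M p mod 2 ^ w) ` {i + 1..<i + 1 + (n - 1)}"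
    using batch_inj[OF assms(1)] unfolding set inj_on_insert by simp
  then have "X - {M i mod 2 ^ w} = (\<lambda>p. M p mod 2 ^ w) ` {i + 1..<i + 1 + (n - 1)}"
    using assms(1) unfolding batch_def set by auto
  then show ?thesis using assms(1) unfolding batch_def set by blast
qed

lemma batch_butlast:
  assumes "batch L w M i n X" "1 \<le> n"
  shows "batch L w M i (n - 1) (X - {M (i + n - 1) mod 2 ^ w})"
proof -
  have set: "{i..<i + n} = insert (i + n - 1) {i..<i + (n - 1)}" using assms(2) by auto
  have "M (i + n - 1) mod 2 ^ w \<notin> (\<lambda>p. M p mod 2 ^ w) ` {i..<i + (n - 1)}"
    using batch_inj[OF assms(1)] unfolding set inj_on_insert by simp
  then have "X - {M (i + n - 1) mod 2 ^ w} = (\<lambda>p. M p mod 2 ^ w) ` {i..<i + (n - 1)}"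
    using assms(1) unfolding batch_def set by auto
  then show ?thesis using assms(1) unfolding batch_def set by blast
qed

lemma batch_ends:
  assumes "batch L w M i n X" "1 \<le> n"
  shows "M i mod 2 ^ w = Min X" "M (i + n - 1) mod 2 ^ w = Max X" "X \<noteq> {}" "finite X"
proof -
  have X: "X = (\<lambda>p. M p mod 2 ^ w) ` {i..<i + n}" using assms(1) by (simp add: batch_def)
  show "finite X" "X \<noteq> {}" unfolding X using assms(2) by auto
  have mono: "M p mod 2 ^ w \<le> M q mod 2 ^ w" if "p \<in> {i..<i + n}" "q \<in> {i..<i + n}" "p \<le> q" for p q
    using assms(1) that unfolding batch_def by (cases "p = q") (auto intro: less_imp_le)
  show "M i mod 2 ^ w = Min X"
    unfolding X using assms(2) mono by (intro Min_eqI[symmetric]) auto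
  show "M (i + n - 1) mod 2 ^ w = Max X"
    unfolding X using assms(2) mono by (intro Max_eqI[symmetric]) auto
qed

abbreviation extract_params :: "name list" where
  "extract_params \<equiv> [''a'', ''w'', ''o'', ''d'', ''f'']"

text \<open>Leaves and inner nodes are treated uniformly: \<open>inn M I\<close> says that summary and clusters, which
  occupy the cells \<open>T\<close>, hold the inner keys \<open>I\<close>; for a leaf, \<open>I\<close> and \<open>T\<close> are empty.\<close>

lemma run_delete_com:
  fixes inn :: "mem \<Rightarrow> int set \<Rightarrow> bool" and w :: nat and M :: mem and i n :: int
  assumes header: "M a = encode w (min_key K)" "M (a + 1) = encode w (max_key K)" "K \<subseteq> {0..<2 ^ w}"
    and bat: "batch L w M i n X" and X: "X \<subseteq> K" and n: "1 \<le> n"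
    and F: "F \<subseteq> {0..<2 ^ L}" "a \<in> F" "a + 1 \<in> F" "T \<subseteq> F - {a, a + 1}"
    and i: "0 \<le> i" "i + n < 2 ^ L" and f: "0 \<le> f" "f + scr w < 2 ^ L"
    and disj: "F \<inter> {i..<i + n} = {}" "F \<inter> {f..<f + scr w} = {}" "{i..<i + n} \<inter> {f..<f + scr w} = {}"
    and inn0: "inn M (inner_keys K)"
    and frame: "\<And>M1 M2 I. inn M1 I \<Longrightarrow> (\<And>x. x \<in> T \<Longrightarrow> M2 x = M1 x) \<Longrightarrow> inn M2 I"
    and inner: "\<And>I X' i' n'. inn M I \<Longrightarrow> I \<subseteq> inner_keys K \<Longrightarrow> batch L w M i' n' X' \<Longrightarrow> X' \<subseteq> I \<Longrightarrow>
      1 \<le> n' \<Longrightarrow> {i'..<i' + n'} \<subseteq> {i..<i + n} \<Longrightarrow>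
      run L veb_prog (F \<union> {i..<i + n} \<union> {f..<f + scr w}) (T \<union> {f..<f + scr w})
        (map_of (zip del_params [a, int w, i', n', f + 1])) inner_com M
        (\<lambda>r M' c s. inn M' (I - X') \<and> int c \<le> 3000 * int (dep w) * n' - 1500 * n' \<and>
           s + 29000 * max 1 w \<le> span_bd w)"
    and extr: "\<And>M1 I ob d. (\<And>x. x \<in> F - T - {a, a + 1} \<Longrightarrow> M1 x = M x) \<Longrightarrow> inn M1 I \<Longrightarrow>
      I \<subseteq> inner_keys K \<Longrightarrow> ob \<in> {0, 1} \<Longrightarrow>
      run L veb_prog (F \<union> {i..<i + n} \<union> {f..<f + scr w}) (T \<union> {f..<f + scr w})
        (map_of (zip extract_params [a, int w, ob, d, f])) extract_com M1
        (\<lambda>r M' c s. inn M' (I - {if ob = 0 then Min I else Max I}) \<and>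
           r = (if I = {} then d else if ob = 0 then Min I else Max I) \<and>
           int c \<le> (if I = {} then 50 else 3000 * int (dep w) - 1000))"
  shows "run L veb_prog (F \<union> {i..<i + n} \<union> {f..<f + scr w}) (F \<union> {f..<f + scr w})
    (map_of (zip del_params [a, int w, i, n, f])) delete_com M
    (\<lambda>v M' c s. v = (if K \<subseteq> X then 1 else 0) \<and> inn M' (inner_keys (K - X)) \<and>
       M' a = encode w (min_key (K - X)) \<and> M' (a + 1) = encode w (max_key (K - X)) \<and>
       (\<forall>x\<in>F - T - {a, a + 1}. M' x = M x) \<and> work_ok w n v c \<and> s \<le> span_bd w)"
proof -
  let ?R = "F \<union> {i..<i + n} \<union> {f..<f + scr w}"
  let ?W = "F \<union> {f..<f + scr w}"
  let ?inner = "Call ''inner'' [Var ''a'', Var ''w'', plus_e (Var ''i'') (Var ''p''), Var ''k'',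
      plus_e (Var ''f'') (Lit 1)]"
  let ?extr0 = "Call ''extract'' [Var ''a'', Var ''w'', Lit 0, Var ''d'', Var ''f'']"
  let ?extr1 = "Call ''extract'' [Var ''a'', Var ''w'', Lit 1, Var ''d'', Var ''f'']"
  let ?S = "T \<union> {f..<f + scr w}"
  note be = batch_ends[OF bat n]
  have K0: "K \<noteq> {}" using be(3) X by blast
  have finK: "finite K" using header(3) finite_subset by blast
  have KM: "Min K \<in> K" "Max K \<in> K" using finK K0 by auto
  have MinX: "Min X = Min K \<longleftrightarrow> Min K \<in> X"
    using be(3,4) finK KM X Min_in[OF be(4,3)] by (metis Min_antimono Min_le dual_order.antisym)
  have MaxX: "Max X = Max K \<longleftrightarrow> Max K \<in> X"
    using be(3,4) finK KM X Max_in[OF be(4,3)] by (metis Max_ge Max_mono dual_order.antisym)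
  have enc: "M a = Min K" "M (a + 1) = Max K" using header encode_eq[OF K0] by auto
  define p :: int where "p = (if Min K \<in> X then 1 else 0)"
  define q :: int where "q = (if Max K \<in> X then 1 else 0)"
  define k where "k = n - p - q"
  define I1 where "I1 = inner_keys K - X"
  define d1 where "d1 = (if Max K \<in> X then 2 ^ w else Max K)"
  define r where "r = (if Min K \<in> X then if I1 = {} then d1 else Min I1 else Min K)"
  define I2 where "I2 = (if Min K \<in> X then I1 - {Min I1} else I1)"
  define d2 where "d2 = (if r = 2 ^ w then -1 else r)"
  define t where "t = (if Max K \<in> X then if I2 = {} then d2 else Max I2 else Max K)"
  define I3 where "I3 = (if Max K \<in> X then I2 - {Max I2} else I2)"
  have r_eq: "r = (if Min K \<in> X then if I1 = {} then
      if Max K \<in> X then 2 ^ w else Max K else Min I1 else Min K)"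
    unfolding r_def d1_def by (rule refl)
  have t_eq: "t = (if Max K \<in> X then if I2 = {} then
      if r = 2 ^ w then - 1 else r else Max I2 else Max K)"
    unfolding t_def d2_def by (rule refl)
  note res = delete_keys[OF K0 header(3) X I1_def r_eq I2_def t_eq I3_def]
  have I12: "I1 \<subseteq> inner_keys K" "I2 \<subseteq> inner_keys K" by (auto simp: I1_def I2_def)
  define X' where "X' = X - {Min K, Max K}"
  have IX': "inner_keys K - X' = I1" "X' \<subseteq> inner_keys K"
    using X by (auto simp: I1_def X'_def inner_keys_eq[OF K0])
  have bat1: "batch L w M (i + p) (n - p) (X - {Min K})"
  proof (cases "Min K \<in> X")
    case True
    then show ?thesis using batch_tl[OF bat n] be(1) MinX by (simp add: p_def)
  qed (use bat in \<open>simp add: p_def\<close>)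
  have bat2: "batch L w M (i + p) k X'" if np: "1 \<le> n - p"
  proof (cases "Max K \<in> X - {Min K}")
    case True
    then have "Max (X - {Min K}) = Max K"
      using X finK be(4) by (intro Max_eqI) auto
    then have "M (i + n - 1) mod 2 ^ w = Max K" using batch_ends(2)[OF bat1 np]
        by (simp add: add_diff_eq)
    then show ?thesis using batch_butlast[OF bat1 np] True
        by (simp add: k_def q_def X'_def Diff_insert2[symmetric])
  next
    case False
    \<comment> \<open>The last key of the shortened batch is not the maximum either because the
      maximum is not deleted, or because it coincides with the minimum and has just been stripped.
      In the latter case the batch has a single key, contradicting \<open>np\<close>.\<close>
    then have "q = 0 \<or> Min K = Max K \<and> Min K \<in> X" by (auto simp: q_def)
    then show ?thesis
    proof
      assume q: "q = 0"
      then have "Max K \<notin> X" by (simp add: q_def split: if_splits)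
      then have "X' = X - {Min K}" by (auto simp: X'_def)
      then show ?thesis using bat1 q by (simp add: k_def)
    next
      assume *: "Min K = Max K \<and> Min K \<in> X"
      then have "K = {Min K}" using finK KM by (metis Max_ge Min_le dual_order.antisym empty_iff
          insertI1 insert_iff subsetI subset_antisym)
      then have "card X \<le> 1" using X by (metis card.empty card_insert_disjoint card_mono empty_iff
          finite.emptyI finite.insertI One_nat_def)
      then have "n \<le> 1" using batch_card[OF bat] n by simp
      moreover have "p = 1" using conjunct2[OF *] by (simp add: p_def)
      ultimately show ?thesis using np by simp
    qed
  qed
  have X'0: "X' = {}" if "k \<le> 0"
  proof (cases "1 \<le> n - p")
    case True
    from bat2[OF True] that show ?thesis by (simp add: batch_def)
  next
    case False
    then have "n - p \<le> 0" by simp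
    then show ?thesis using bat1 unfolding batch_def X'_def by auto
  qed
  \<comment> \<open>\<open>k\<close> is negative only if the single key of the batch is both minimum
    and maximum, that is, the only key of the tree.\<close>
  have kneg: "K \<subseteq> X" if "k < 0"
  proof -
    have pq: "p = 1" "q = 1" "n = 1" using that n unfolding k_def p_def q_def by (auto split: if_splits)
    then have "card X = 1" using batch_card[OF bat] by simp
    then obtain x where "X = {x}" by (meson card_1_singletonE)
    then have "Min K = x" "Max K = x" using pq unfolding p_def q_def by (auto split: if_splits)
    then have "y = x" if "y \<in> K" for y using that finK by (metis Max_ge Min_le dual_order.antisym)
    then show ?thesis using \<open>X = {x}\<close> by blast
  qed
  have scr4: "4 * 2 ^ w \<le> scr w" by (rule pow_le_scr)
  have w2: "(2::int) ^ w < 2 ^ L" "1 \<le> (2::int) ^ w" "2 ^ w + 3 < (2::int) ^ L"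
  proof -
    show 1: "1 \<le> (2::int) ^ w" by simp
    then show "(2::int) ^ w < 2 ^ L" "2 ^ w + 3 < (2::int) ^ L" using scr4 f by linarith+
  qed
  have Kb: "0 \<le> Min K" "Min K < 2 ^ w" "0 \<le> Max K" "Max K < 2 ^ w" using KM header(3) by auto
  have pq01: "p = 0 \<or> p = 1" "q = 0 \<or> q = 1" by (auto simp: p_def q_def)
  have rb: "-1 \<le> r" "r \<le> 2 ^ w" "-1 \<le> t" "t \<le> 2 ^ w"
  proof -
    have "encode w (min_key Y) \<le> 2 ^ w \<and> -1 \<le> encode w (min_key Y) \<and> encode w (max_key Y) \<le> 2 ^ w \<and>
        -1 \<le> encode w (max_key Y)"
      if "Y \<subseteq> K" for Y
    proof (cases "Y = {}")
      case True
      have "- 1 \<le> (2::int) ^ w" using w2(2) by linarith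
      then show ?thesis using True by (simp add: encode_min_key)
    next
      case False
      moreover have "finite Y" using that finK finite_subset by blast
      ultimately have "Min Y \<in> Y" "Max Y \<in> Y" by auto
      then have "Min Y \<in> {0..<2 ^ w}" "Max Y \<in> {0..<2 ^ w}" using that header(3) by blast+
      then show ?thesis using False by (simp add: encode_min_key)
    qed
    from this[of "K - X"] show "-1 \<le> r" "r \<le> 2 ^ w" "-1 \<le> t" "t \<le> 2 ^ w" unfolding res(1,2) by auto
  qed
  have wd: "is_word L 0" "is_word L 1" "is_word L (-1)" "is_word L a" "is_word L (a + 1)"
      "is_word L (2 ^ w)"
    "is_word L (Min K)" "is_word L (Max K)" "is_word L r" "is_word L d2" "is_word L t" "is_word L n"
    "is_word L (n - 1)" "is_word L (n - p)" "is_word L k" "is_word L (i + p)"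
        "is_word L (i + (n - 1))" "is_word L (f + 1)"
    "is_word L (M i mod 2 ^ w)" "is_word L (M (i + (n - 1)) mod 2 ^ w)"
  proof -
    have al: "0 \<le> a" "a < 2 ^ L" "0 \<le> a + 1" "a + 1 < 2 ^ L" using F(1,2,3) by auto
    have md: "0 \<le> x mod 2 ^ w" "x mod 2 ^ w < 2 ^ w" for x :: int by simp_all
    show "is_word L (M i mod 2 ^ w)" "is_word L (M (i + (n - 1)) mod 2 ^ w)"
      using w2 md[of "M i"] md[of "M (i + (n - 1))"] unfolding is_word_def by linarith+
    show "is_word L 0" "is_word L 1" "is_word L (-1)" "is_word L a" "is_word L (a + 1)"
        "is_word L (2 ^ w)"
      "is_word L (Min K)" "is_word L (Max K)" "is_word L r" "is_word L t" "is_word L n"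
      "is_word L (n - 1)" "is_word L (n - p)" "is_word L k" "is_word L (i + p)"
          "is_word L (i + (n - 1))" "is_word L (f + 1)"
      using al w2 Kb rb pq01 n i f scr4 unfolding is_word_def k_def by (smt (verit))+
    then show "is_word L d2" by (simp add: d2_def)
  qed
  have wM: "is_word L (M i)" "is_word L (M (i + (n - 1)))" using bat n unfolding batch_def by auto
  have e2: "exp_val L \<rho> (pow2 (Var ''w'')) = Some (2 ^ w)" if "\<rho> ''w'' = Some (int w)" for \<rho>
    by (rule exp_val_pow2[of \<rho> "''w''", OF that w2(1)])
  have aS: "a \<notin> ?S" "a + 1 \<notin> ?S" using F(2-4) disj(2) by blast+
  have sub: "?S \<subseteq> F \<union> {f..<f + scr w}" using F(4) by blast
  have hdr: "x \<notin> ?S" if "x \<in> F - T - {a, a + 1}" for x using that disj(2) by blast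
  define N1 where "N1 M1 \<longleftrightarrow> inn M1 I1 \<and> (\<forall>x. x \<notin> ?S \<longrightarrow> M1 x = M x)" for M1
  define N2 where "N2 M2 \<longleftrightarrow> inn M2 I2 \<and> (\<forall>x. x \<notin> ?S \<longrightarrow> M2 x = M x)" for M2
  define N3 where "N3 M3 \<longleftrightarrow> inn M3 I3 \<and> (\<forall>x. x \<notin> ?S \<longrightarrow> M3 x = (M(a := r)) x)" for M3
  \<comment> \<open>Work of the inner deletion and of the two replacements. A replacement that finds
    an inner key is paid from the budget of the deleted extreme key with \<open>1000\<close> to
    spare; one that finds none has constant cost.\<close>
  define c1 where "c1 = 15 + (if 0 < k then 3000 * int (dep w) * k - 1500 * k else 0)"
  define c2 where "c2 = 70 + (if p = 1 \<and> I1 \<noteq> {} then 3000 * int (dep w) - 1000 else 0)"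
  define c3 where "c3 = 70 + (if q = 1 \<and> I2 \<noteq> {} then 3000 * int (dep w) - 1000 else 0)"
  have D1: "1 \<le> dep w" "dep w \<le> max 1 w" by (rule dep_ge_1, rule dep_le)
  have D1': "29000 * max 1 w + 1000 \<le> span_bd w"
  proof -
    have "30000 * max 1 w * 1 \<le> 30000 * max 1 w * dep w" using D1 by (intro mult_le_mono2)
    moreover have "1 \<le> max 1 w" by simp
    ultimately show ?thesis unfolding span_bd_def by linarith
  qed
  have stage1: "run L veb_prog ?R ?W \<rho>
      (Cond (less_e (Lit 0) (Var ''k''))
        ?inner
        (Ret (Lit 0))) M (\<lambda>r M1 c s. N1 M1 \<and> int c \<le> c1 + 10 \<and> s + 29000 * max 1 w \<le> span_bd w + 50)"
    if \<rho>: "\<rho> ''a'' = Some a" "\<rho> ''w'' = Some (int w)" "\<rho> ''i'' = Some i" "\<rho> ''p'' = Some p"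
      "\<rho> ''k'' = Some k" "\<rho> ''f'' = Some f" for \<rho>
  proof (rule run_Cond[where i="if 0 < k then 1 else 0"])
    show "exp_val L \<rho> (less_e (Lit 0) (Var ''k'')) = Some (if 0 < k then 1 else 0)"
      using \<rho> wd by (simp add: word_result_def)
  next
    assume "(if 0 < k then 1 else 0) \<noteq> (0::int)"
    then have k: "0 < k" by (simp split: if_splits)
    have np: "1 \<le> n - p" using k pq01 unfolding k_def by auto
    have sb: "{i + p..<i + p + k} \<subseteq> {i..<i + n}" using pq01 unfolding k_def by auto
    show "run L veb_prog ?R ?W \<rho> ?inner M
        (\<lambda>v M' c s. N1 M' \<and> int (1 + exp_cost (less_e (Lit 0) (Var ''k'')) + c) \<le> c1 + 10 \<and>
          1 + exp_cost (less_e (Lit 0) (Var ''k'')) + s + 29000 * max 1 w \<le> span_bd w + 50)"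
      apply (rule run_Call[OF veb_prog_procs(3), where vs="[a, int w, i + p, k, f + 1]"])
        apply simp
      subgoal using \<rho> wd by (simp add: word_result_def)
      apply (rule run_conseq[OF inner[OF inn0 order_refl bat2[OF np] IX'(2) _ sb]])
      subgoal using k by simp
      subgoal by simp
      subgoal using sub by blast
      subgoal using k by (auto simp: N1_def IX'(1) c1_def)
      done
  next
    assume "(if 0 < k then 1 else 0) = (0::int)"
    then have k: "k \<le> 0" by (simp split: if_splits)
    have "N1 M" using inn0 IX'(1) X'0[OF k] by (simp add: N1_def)
    then show "run L veb_prog ?R ?W \<rho> (Ret (Lit 0)) M
        (\<lambda>v M' c s. N1 M' \<and> int (1 + exp_cost (less_e (Lit 0) (Var ''k'')) + c) \<le> c1 + 10 \<and>
          1 + exp_cost (less_e (Lit 0) (Var ''k'')) + s + 29000 * max 1 w \<le> span_bd w + 50)"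
      apply (intro run_Ret[where v=0])
      subgoal using wd by (simp add: word_result_def)
      subgoal using k D1' by (simp add: c1_def)
      done
  qed
  have stage2: "run L veb_prog ?R ?W \<rho>
      (Cond (Var ''p'') ?extr0 (Ret (Var ''mn'')))
      M1 (\<lambda>v M2 c s. v = r \<and> N2 M2 \<and> int c \<le> c2)"
    if N1: "N1 M1" and \<rho>: "\<rho> ''a'' = Some a" "\<rho> ''w'' = Some (int w)" "\<rho> ''d'' = Some d1"
        "\<rho> ''p'' = Some p"
      "\<rho> ''mn'' = Some (Min K)" "\<rho> ''f'' = Some f" for \<rho> M1
  proof (rule run_Cond[where i=p])
    show "exp_val L \<rho> (Var ''p'') = Some p" using \<rho> by simp
  next
    assume "p \<noteq> 0"
    then have p: "p = 1" "Min K \<in> X" by (auto simp: p_def split: if_splits)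
    have hM: "M1 x = M x" if "x \<in> F - T - {a, a + 1}" for x using N1 hdr[OF that] unfolding N1_def
        by blast
    have iM: "inn M1 I1" using N1 by (simp add: N1_def)
    show "run L veb_prog ?R ?W \<rho>
        ?extr0 M1
        (\<lambda>v M' c s. v = r \<and> N2 M' \<and> int (1 + exp_cost (Var ''p'') + c) \<le> c2)"
      apply (rule run_Call[OF veb_prog_procs(2), where vs="[a, int w, 0, d1, f]"])
        apply simp
      subgoal using \<rho> wd by (simp add: word_result_def)
      apply (rule run_conseq[OF extr[OF hM iM I12(1), of 0 d1]])
      apply simp_all[3]
      subgoal using sub by blast
      subgoal using p N1 by (auto simp: N1_def N2_def r_def I2_def c2_def split: if_splits)
      done
  next
    assume "p = 0"
    then have p: "p = 0" "Min K \<notin> X" by (auto simp: p_def split: if_splits)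
    show "run L veb_prog ?R ?W \<rho> (Ret (Var ''mn'')) M1
        (\<lambda>v M' c s. v = r \<and> N2 M' \<and> int (1 + exp_cost (Var ''p'') + c) \<le> c2)"
      apply (rule run_Ret[where v="Min K"])
      subgoal using \<rho> by simp
      subgoal using p N1 by (simp add: N1_def N2_def r_def I2_def c2_def)
      done
  qed
  have stage3: "run L veb_prog ?R ?W \<rho>
      (Cond (Var ''q'') ?extr1 (Ret (Var ''mx'')))
      (M2(a := r)) (\<lambda>v M3 c s. v = t \<and> N3 M3 \<and> int c \<le> c3)"
    if N2: "N2 M2" and \<rho>: "\<rho> ''a'' = Some a" "\<rho> ''w'' = Some (int w)" "\<rho> ''d'' = Some d2"
        "\<rho> ''q'' = Some q"
      "\<rho> ''mx'' = Some (Max K)" "\<rho> ''f'' = Some f" for \<rho> M2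
  proof (rule run_Cond[where i=q])
    show "exp_val L \<rho> (Var ''q'') = Some q" using \<rho> by simp
  next
    assume "q \<noteq> 0"
    then have q: "q = 1" "Max K \<in> X" by (auto simp: q_def split: if_splits)
    have hM: "(M2(a := r)) x = M x" if "x \<in> F - T - {a, a + 1}" for x
      using N2 hdr[OF that] that unfolding N2_def by auto
    have iM: "inn (M2(a := r)) I2"
      using N2 aS unfolding N2_def by (intro frame[of M2 I2 "M2(a := r)"]) auto
    show "run L veb_prog ?R ?W \<rho>
        ?extr1 (M2(a := r))
        (\<lambda>v M' c s. v = t \<and> N3 M' \<and> int (1 + exp_cost (Var ''q'') + c) \<le> c3)"
      apply (rule run_Call[OF veb_prog_procs(2), where vs="[a, int w, 1, d2, f]"])
        apply simp
      subgoal using \<rho> wd by (simp add: word_result_def)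
      apply (rule run_conseq[OF extr[OF hM iM I12(2), of 1 d2]])
      apply simp_all[3]
      subgoal using sub by blast
      subgoal using q N2 by (auto simp: N2_def N3_def t_def I3_def c3_def split: if_splits)
      done
  next
    assume "q = 0"
    then have q: "q = 0" "Max K \<notin> X" by (auto simp: q_def split: if_splits)
    have iM: "inn (M2(a := r)) I2"
      using N2 aS unfolding N2_def by (intro frame[of M2 I2 "M2(a := r)"]) auto
    show "run L veb_prog ?R ?W \<rho> (Ret (Var ''mx'')) (M2(a := r))
        (\<lambda>v M' c s. v = t \<and> N3 M' \<and> int (1 + exp_cost (Var ''q'') + c) \<le> c3)"
      apply (rule run_Ret[where v="Max K"])
      subgoal using \<rho> by simp
      subgoal using q N2 iM by (simp add: N2_def N3_def t_def I3_def c3_def)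
      done
  qed
  \<comment> \<open>The budget of \<open>n = k + p + q\<close> keys is compared with the costs. If
    the tree becomes empty, both extractions find nothing, so the budgets of minimum and maximum
    remain available; with \<open>k = -1\<close> exactly the constants
    \<open>170 + 15 + 70 + 70\<close> are uncovered, and \<open>500\<close> pays for them. Otherwise
    they are absorbed by the slack of \<open>1500\<close> per inner key or, if \<open>k = 0\<close>,
    of \<open>1000\<close> per replaced extreme.\<close>
  have work: "work_ok w n (if K \<subseteq> X then 1 else 0) c" if c: "int c \<le> 170 + c1 + c2 + c3" for c
  proof -
    have n': "3000 * int (dep w) * n = 3000 * int (dep w) * k + 3000 * int (dep w) * p + 3000 * int
        (dep w) * q"
      unfolding k_def by (simp add: algebra_simps)
    have c1': "k \<le> 0 \<Longrightarrow> c1 = 15" "1 \<le> k \<Longrightarrow> c1 \<le> 3000 * int (dep w) * k - 1485"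
      unfolding c1_def by auto
    show ?thesis
    proof (cases "K \<subseteq> X")
      case True
      then have I1: "I1 = {}" and p1: "p = 1" and q1: "q = 1" using KM
          by (auto simp: I1_def inner_keys_def p_def q_def)
      then have c23: "c2 = 70" "c3 = 70" by (simp_all add: c2_def c3_def I2_def)
      have "-1 \<le> k" using n p1 q1 by (simp add: k_def)
      then have kD: "- (3000 * int (dep w)) \<le> 3000 * int (dep w) * k"
        using mult_left_mono[of "-1" k "3000 * int (dep w)"] by simp
      have "int c + 3000 * int (dep w) * 1 \<le> 3000 * int (dep w) * n + 500 * 1"
      proof (cases "k \<le> 0")
        case True
        then show ?thesis using c n'[unfolded p1 q1] c1'(1)[OF True] c23 kD by linarith
      next
        case False
        then have "1 \<le> k" by simp
        then show ?thesis using c n'[unfolded p1 q1] c1'(2) c23 kD by linarith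
      qed
      then show ?thesis using True by (simp add: work_ok_def)
    next
      case False
      then have k: "0 \<le> k" using kneg by linarith
      have pq: "k = 0 \<Longrightarrow> p = 1 \<or> q = 1" using n pq01 unfolding k_def by auto
      have D: "1 \<le> int (dep w)" using D1(1) by simp
      have c23: "c2 \<le> 70 + (3000 * int (dep w) - 1000) * p" "c3 \<le> 70 + (3000 * int (dep w) - 1000) * q"
        using pq01 D unfolding c2_def c3_def by auto
      have "int c \<le> 3000 * int (dep w) * n"
      proof (cases "k = 0")
        case True
        from pq[OF True] pq01 c23 c n' c1'(1) True D show ?thesis by (elim disjE) auto
      next
        case False
        from pq01 c23 c n' c1'(2) False k D show ?thesis by (elim disjE) auto
      qed
      then show ?thesis using False by (simp add: work_ok_def)
    qed
  qed
  have work1: "work_ok w n 1 c" if "K \<subseteq> X" "int c \<le> 170 + c1 + c2 + c3" for c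
    using work[OF that(2)] that(1) by simp
  have work0: "work_ok w n 0 c" if "x \<in> K" "x \<notin> X" "int c \<le> 170 + c1 + c2 + c3" for c x
  proof -
    have "\<not> K \<subseteq> X" using that(1,2) by blast
    then show ?thesis using work[OF that(3)] by simp
  qed
  have c23: "c2 \<le> 3000 * int (max 1 w)" "c3 \<le> 3000 * int (max 1 w)"
    using D1 unfolding c2_def c3_def by auto
  \<comment> \<open>Both replacements together take at most \<open>6000 * max 1 w\<close> by their
    work bounds; the reserve of \<open>29000 * max 1 w\<close> covers this and the
    constants.\<close>
  have span: "s1 + s2 + s3 + 170 \<le> span_bd w"
    if "s1 + 29000 * max 1 w \<le> span_bd w + 50" "int s2 \<le> c2" "int s3 \<le> c3" for s1 s2 s3
  proof -
    have "s2 \<le> 3000 * max 1 w" "s3 \<le> 3000 * max 1 w" using that c23 by linarith+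
    then show ?thesis using that(1) by linarith
  qed
  have final: "inn M' (inner_keys (K - X)) \<and> M' a = encode w (min_key (K - X)) \<and>
      M' (a + 1) = encode w (max_key (K - X)) \<and> (\<forall>x\<in>F - T - {a, a + 1}. M' x = M x)"
    if "N3 M3" "M' = M3(a + 1 := t)" for M3 M'
  proof -
    have "inn M' I3" using that aS unfolding N3_def by (intro frame[of M3 I3 M']) auto
    moreover have "M' a = r" using that aS unfolding N3_def by simp
    moreover have "\<forall>x\<in>F - T - {a, a + 1}. M' x = M x" using that hdr unfolding N3_def by auto
    ultimately show ?thesis using res that(2) by simp
  qed
  show ?thesis
    unfolding delete_com_def
    apply (rule run_Cond[where i=0])
    subgoal using n wd by (simp add: word_result_def)
     apply simp
    apply (rule run_Bind_Read[where i=a and v="Min K"])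
    subgoal by simp
    subgoal using F by auto
    subgoal by (rule wd)
    subgoal using F by blast
    subgoal unfolding enc by simp
    apply (rule run_Bind_Read[where i="a + 1" and v="Max K"])
    subgoal using wd by (simp add: word_result_def)
    subgoal using F by auto
    subgoal by (rule wd)
    subgoal using F by blast
    subgoal unfolding enc by simp
    apply (rule run_Bind_Read[where i=i and v="M i"])
    subgoal by simp
    subgoal using i by simp
    subgoal by (rule wM)
    subgoal using n by simp
    subgoal by simp
    apply (rule run_Bind_Read[where i="i + (n - 1)" and v="M (i + (n - 1))"])
    subgoal using wd by (simp add: word_result_def)
    subgoal using i n by simp
    subgoal by (rule wM)
    subgoal using n by simp
    subgoal by simp
    apply (rule run_Bind_Ret[where v=p])
    subgoal
      apply (rule exp_val_Bin[where x="M i mod 2 ^ w" and y="Min K"])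
         apply (rule exp_val_Bin[OF _ e2])
      using wd be(1) MinX apply (auto simp: p_def)
      done
    apply (rule run_Bind_Ret[where v=q])
    subgoal
      apply (rule exp_val_Bin[where x="M (i + (n - 1)) mod 2 ^ w" and y="Max K"])
         apply (rule exp_val_Bin[OF _ e2])
      using wd be(2) MaxX apply (auto simp: q_def add_diff_eq)
      done
    apply (rule run_Bind_Ret[where v=k])
    subgoal using wd by (simp add: word_result_def k_def)
    apply (rule run_Bind[OF stage1])
    apply simp_all[6]
    apply (elim conjE)
    subgoal for \<dots> v1 M1 cu su
      apply (rule run_Bind[where N="\<lambda>r M' c s. r = d1 \<and> M' = M1 \<and> c \<le> 6 \<and> s \<le> 6"])
       apply (rule run_Cond[where i=q])
         apply simp
        apply (rule run_Ret[where v=d1])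
      subgoal using e2 wd by (simp add: q_def d1_def word_result_def split: if_splits)
        apply simp
       apply (rule run_Ret[where v=d1])
      subgoal by (simp add: q_def d1_def split: if_splits)
       apply simp
      apply clarify
      apply (rule run_Bind[OF stage2])
      subgoal by assumption
      apply simp_all[6]
      apply (elim conjE)
      subgoal for \<dots> v2 M2 cr sr
        apply (rule run_Bind[where N="\<lambda>v M' c s. M' = M2(a := r) \<and> c = 3 \<and> s = 3"])
         apply (rule run_Write[where i=a and v=r])
        subgoal by simp
        subgoal using F by auto
        subgoal by simp
        subgoal using F by blast
        subgoal using F by blast
        subgoal by simp
        apply (elim conjE, hypsubst)
        apply (rule run_Bind[where N="\<lambda>v M' c s. v = (if K \<subseteq> X then 1 else 0) \<and> M' = M2(a := r) \<and>
            c = 6 \<and> s = 6"])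
         apply (rule run_Ret[where v="if r = 2 ^ w then 1 else 0"])
        subgoal
          apply (rule exp_val_Bin[OF _ e2, where x=r])
          using wd apply auto
          done
        subgoal using res(4) by auto
        apply (elim conjE, hypsubst)
        apply (rule run_Bind[where N="\<lambda>v M' c s. v = d2 \<and> M' = M2(a := r) \<and> c \<le> 6 \<and> s \<le> 6"])
         apply (rule run_Cond[where i="if K \<subseteq> X then 1 else 0"])
           apply simp
          apply (rule run_Ret[where v=d2])
        subgoal using res(4) wd by (auto simp: d2_def word_result_def split: if_splits)
          apply simp
         apply (rule run_Ret[where v=d2])
        subgoal using res(4) by (auto simp: d2_def split: if_splits)
         apply simp
        apply (elim conjE, hypsubst)
        apply (rule run_Bind[OF stage3])
        subgoal by assumption
        apply simp_all[6]
        apply (elim conjE)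
        subgoal for \<dots> v3 M3 ct st
          apply (rule run_Bind[where N="\<lambda>v M' c s. M' = M3(a + 1 := t) \<and> c = 5 \<and> s = 5"])
           apply (rule run_Write[where i="a + 1" and v=t])
          subgoal using wd by (simp add: word_result_def)
          subgoal using F by auto
          subgoal by simp
          subgoal using F by blast
          subgoal using F by blast
          subgoal by simp
          apply (elim conjE)
          apply (rule run_Ret[where v="if K \<subseteq> X then 1 else 0"])
           apply simp
          subgoal for \<dots> v4 M4 c4 s4
            using final[of M3 M4] work1 work0 span[of su sr st] by (auto split: if_splits)
          done
        done
      done
    done
qed

lemma inner_keys_leaf:
  assumes "w < 2" "K \<subseteq> {0..<2 ^ w}"
  shows "inner_keys K = {}"
proof (cases "K = {}")
  case False
  have "finite K" using assms(2) finite_subset by blast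
  then have m: "Min K \<in> K" "Max K \<in> K" "\<And>x. x \<in> K \<Longrightarrow> Min K \<le> x" "\<And>x. x \<in> K \<Longrightarrow> x \<le> Max K"
    using False by auto
  have "(2::int) ^ w \<le> 2" using assms(1) power_increasing[of w 1 "2::int"] by simp
  then have b: "0 \<le> x \<and> x < 2" if "x \<in> K" for x using assms(2) that by fastforce
  have "x = Min K \<or> x = Max K" if "x \<in> K" for x
    using b[OF that] b[OF m(1)] b[OF m(2)] m(3)[OF that] m(4)[OF that] by linarith
  then show ?thesis unfolding inner_keys_eq[OF False] by blast
qed (simp add: inner_keys_def)

lemma del_spec_leaf:
  assumes w: "w < 2"
  shows "del_spec w"
  unfolding del_spec_def
proof (intro allI impI)
  fix L M a F K X i n f
  assume h: "holds M w a F K" and bat: "batch L w M i n X" and X: "X \<subseteq> K" and n: "1 \<le> n"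
    and F: "F \<subseteq> {0..<2 ^ L}" and i: "0 \<le> i" "i + n < 2 ^ L" and f: "0 \<le> f" "f + scr w < 2 ^ L"
    and disj: "F \<inter> {i..<i + n} = {}" "F \<inter> {f..<f + scr w} = {}" "{i..<i + n} \<inter> {f..<f + scr w} = {}"
  have h': "K \<subseteq> {0..<2 ^ w}" "F = {a, a + 1}" "M a = encode w (min_key K)"
      "M (a + 1) = encode w (max_key K)"
    using h w by (simp_all add: holds_leaf)
  have ik: "inner_keys K = {}" by (rule inner_keys_leaf[OF w h'(1)])
  have "1 \<le> (2::int) ^ w" by simp
  then have "(4::int) < 2 ^ L" using pow_le_scr[of w] f by linarith
  then have wd: "is_word L 2" "is_word L 1" "is_word L 0" unfolding is_word_def by linarith+
  have "run L veb_prog (F \<union> {i..<i + n} \<union> {f..<f + scr w}) (F \<union> {f..<f + scr w})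
    (map_of (zip del_params [a, int w, i, n, f])) delete_com M
    (\<lambda>v M' c s. v = (if K \<subseteq> X then 1 else 0) \<and> inner_keys (K - X) = {} \<and>
       M' a = encode w (min_key (K - X)) \<and> M' (a + 1) = encode w (max_key (K - X)) \<and>
       (\<forall>x\<in>F - {} - {a, a + 1}. M' x = M x) \<and> work_ok w n v c \<and> s \<le> span_bd w)"
  \<comment> \<open>For a leaf, the specification of \<open>inner\<close> is vacuous since batches
    are nonempty, and \<open>extract\<close> stops at its test of the width.\<close>
  proof (rule run_delete_com[where T="{}" and inn="\<lambda>_ I. I = {}", OF h'(3,4,1) bat X n])
    fix I X' :: "int set" and i' n' :: int
    assume "I = {}" "batch L w M i' n' X'" "X' \<subseteq> I" "1 \<le> n'"
    then have False using batch_ends(3) by blast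
    then show "run L veb_prog (F \<union> {i..<i + n} \<union> {f..<f + scr w}) ({} \<union> {f..<f + scr w})
        (map_of (zip del_params [a, int w, i', n', f + 1])) inner_com M
        (\<lambda>r M' c s. I - X' = {} \<and> int c \<le> 3000 * int (dep w) * n' - 1500 * n' \<and>
           s + 29000 * max 1 w \<le> span_bd w)" ..
  next
    fix M1 :: mem and I :: "int set" and ob d :: int
    assume "I = {}"
    then show "run L veb_prog (F \<union> {i..<i + n} \<union> {f..<f + scr w}) ({} \<union> {f..<f + scr w})
        (map_of (zip extract_params [a, int w, ob, d, f])) extract_com M1
        (\<lambda>r M' c s. I - {if ob = 0 then Min I else Max I} = {} \<and>
           r = (if I = {} then d else if ob = 0 then Min I else Max I) \<and>
           int c \<le> (if I = {} then 50 else 3000 * int (dep w) - 1000))"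
      unfolding extract_com_def
      apply (intro run_Cond[where i=1])
      subgoal using w wd by (simp add: word_result_def)
       apply (rule run_Ret[where v=d])
        apply simp
       apply simp
      apply simp
      done
  qed (use F h' i f disj ik in auto)
  then show "deletes L w M a F K X i n f"
    by (rule run_conseq) (use h' w in \<open>auto simp: holds_leaf\<close>)
qed

text \<open>Because \<open>dep\<close> of the high half is at most that of the low half and the two
  widths add up to \<open>w\<close>, both bounds together are at most
  \<open>30000 * w * dep (low_bits w)\<close>. The additional level provides
  \<open>30000 * w\<close>, which for \<open>2 \<le> w\<close> exceeds all other terms.\<close>

lemma span_bd_node:
  assumes "2 \<le> w"
  shows "800 + 300 * w + span_bd (low_bits w) + span_bd (high_bits w) + 29000 * max 1 w \<le> span_bd w"
proof -
  let ?l = "low_bits w" and ?h = "high_bits w"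
  have m: "max 1 ?l = ?l" "max 1 ?h = ?h" "max 1 w = w" using high_low_bits_less[OF assms] assms by auto
  have "span_bd ?h \<le> 30000 * ?h * dep ?l"
    unfolding span_bd_def m using dep_mono[OF high_low_bits(2)] by (rule mult_le_mono2)
  then have "span_bd ?l + span_bd ?h \<le> 30000 * (?h + ?l) * dep ?l"
    unfolding span_bd_def[of ?l] m by (simp add: algebra_simps)
  then have "span_bd ?l + span_bd ?h \<le> 30000 * w * dep ?l" unfolding high_low_bits(1) .
  moreover have "span_bd w = 30000 * w * dep ?l + 30000 * w"
    unfolding span_bd_def m dep_node[OF assms] by (simp add: algebra_simps)
  ultimately show ?thesis using assms unfolding m by linarith
qed

lemma del_spec_node:
  assumes w: "2 \<le> w" and low_spec: "del_spec (low_bits w)" and high_spec: "del_spec (high_bits w)"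
  shows "del_spec w"
  unfolding del_spec_def
proof (intro allI impI)
  fix L M a F K X i n f
  assume h: "holds M w a F K" and bat: "batch L w M i n X" and X: "X \<subseteq> K" and n: "1 \<le> n"
    and F: "F \<subseteq> {0..<2 ^ L}" and i: "0 \<le> i" "i + n < 2 ^ L" and f: "0 \<le> f" "f + scr w < 2 ^ L"
    and disj: "F \<inter> {i..<i + n} = {}" "F \<inter> {f..<f + scr w} = {}" "{i..<i + n} \<inter> {f..<f + scr w} = {}"
  obtain s t ca Fs Fc where h': "K \<subseteq> {0..<2 ^ w}" "M a = encode w (min_key K)"
      "M (a + 1) = encode w (max_key K)"
    and layout: "layout w a t Fs Fc" and links: "links M w a s t ca"
    and inner: "inner_holds M w s ca Fs Fc (inner_keys K)" and Feq: "F = node_cells w a t Fs Fc"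
    using h[unfolded holds_node[OF w]] by (elim conjE exE) rule
  define T where "T = Fs \<union> (\<Union>h\<in>heads w. Fc h)"
  have TF: "T \<subseteq> F" by (auto simp: T_def Feq node_cells_def)
  have hT: "{a..<a + 4} \<inter> T = {}" "{t..<t + 2 ^ high_bits w} \<inter> T = {}"
      "{a..<a + 4} \<inter> {t..<t + 2 ^ high_bits w} = {}"
    using layout unfolding layout_def T_def by blast+
  have aF: "{a..<a + 4} \<subseteq> F" "{t..<t + 2 ^ high_bits w} \<subseteq> F" by (auto simp: Feq node_cells_def)
  have a01: "a \<in> {a..<a + 4}" "a + 1 \<in> {a..<a + 4}" "a + 2 \<in> {a..<a + 4}" "a + 3 \<in> {a..<a + 4}" by auto
  \<comment> \<open>Pointers and table lie outside the cells of summary and clusters and outside the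
    two header cells that are rewritten; so the links survive every stage.\<close>
  have ptrs: "{a + 2, a + 3} \<union> {t..<t + 2 ^ high_bits w} \<subseteq> F - T - {a, a + 1}"
  proof -
    have "{a + 2, a + 3} \<subseteq> F - T - {a, a + 1}" 
    proof -
      have "a + 2 \<notin> T" "a + 3 \<notin> T" "a + 2 \<in> F" "a + 3 \<in> F" using a01(3,4) hT(1) aF(1) by blast+
      then show ?thesis by simp
    qed
    moreover have "{t..<t + 2 ^ high_bits w} \<subseteq> F - T - {a, a + 1}" using a01(1,2) hT(2,3) aF(2) by blast
    ultimately show ?thesis by blast
  qed
  have ik: "inner_keys K \<subseteq> {0..<2 ^ w}" using h'(1) by (auto simp: inner_keys_def)
  have scr4: "4 \<le> scr w"
  proof -
    have "1 \<le> (2::int) ^ w" by simp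
    then show ?thesis using pow_le_scr[of w] by linarith
  qed
  have sc: "{f + 1..<f + 1 + scr w - 1} \<subseteq> {f..<f + scr w}" by auto
  have dn: "int (dep w) = 1 + int (dep (low_bits w))" using dep_node[OF w] by simp
  have "run L veb_prog (F \<union> {i..<i + n} \<union> {f..<f + scr w}) (F \<union> {f..<f + scr w})
    (map_of (zip del_params [a, int w, i, n, f])) delete_com M
    (\<lambda>v M' c s'. v = (if K \<subseteq> X then 1 else 0) \<and> inner_holds M' w s ca Fs Fc (inner_keys (K - X)) \<and>
       M' a = encode w (min_key (K - X)) \<and> M' (a + 1) = encode w (max_key (K - X)) \<and>
       (\<forall>x\<in>F - T - {a, a + 1}. M' x = M x) \<and> work_ok w n v c \<and> s' \<le> span_bd w)"
    (is "run _ _ _ _ _ _ _ ?Q")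
  proof (rule run_delete_com[where inn="\<lambda>M1 I. inner_holds M1 w s ca Fs Fc I", OF h'(2,3,1) bat X n F])
    fix I X' :: "int set" and i' n' :: int
    assume *: "inner_holds M w s ca Fs Fc I" "I \<subseteq> inner_keys K" "batch L w M i' n' X'" "X' \<subseteq> I" "1 \<le> n'"
      "{i'..<i' + n'} \<subseteq> {i..<i + n}"
    have i': "0 \<le> i'" "i' + n' < 2 ^ L" using *(5,6) i by auto
    have N: "veb_inner L w M a s t ca Fs Fc I X' i' n' (f + 1)"
    proof
      show "I \<subseteq> {0..<2 ^ w}" using *(2) ik by blast
      show "node_cells w a t Fs Fc \<inter> {i'..<i' + n'} = {}"
        "node_cells w a t Fs Fc \<inter> {f + 1..<f + 1 + scr w - 1} = {}"
        "{i'..<i' + n'} \<inter> {f + 1..<f + 1 + scr w - 1} = {}"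
        using disj *(6) sc unfolding Feq by blast+
      show "node_cells w a t Fs Fc \<subseteq> {0..<2 ^ L}" using F by (simp add: Feq)
    qed (use w low_spec high_spec links layout * i' f in auto)
    show "run L veb_prog (F \<union> {i..<i + n} \<union> {f..<f + scr w}) (T \<union> {f..<f + scr w})
        (map_of (zip del_params [a, int w, i', n', f + 1])) inner_com M
        (\<lambda>r M' c s'. inner_holds M' w s ca Fs Fc (I - X') \<and> int c \<le> 3000 * int (dep w) * n' - 1500 * n' \<and>
           s' + 29000 * max 1 w \<le> span_bd w)" (is "run _ _ _ _ _ _ _ ?Q")
    proof (rule run_conseq[OF veb_inner.run_inner_com[OF N]])
      show "node_cells w a t Fs Fc \<union> {i'..<i' + n'} \<union> {f + 1..<f + 1 + scr w - 1} \<subseteq> F \<union>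
          {i..<i + n} \<union> {f..<f + scr w}"
        using *(6) sc unfolding Feq by blast
      show "Fs \<union> (\<Union>h\<in>heads w. Fc h) \<union> {f + 1..<f + 1 + scr w - 1} \<subseteq> T \<union> {f..<f + scr w}"
        using sc unfolding T_def by blast
      fix r M' c s'
      assume "inner_holds M' w s ca Fs Fc (I - X') \<and> int c \<le> 3000 * int (dep (low_bits w)) * n' +
          1500 * n' \<and>
        s' \<le> 800 + 300 * w + span_bd (low_bits w) + span_bd (high_bits w)"
      then show "?Q r M' c s'"
        using span_bd_node[OF w] unfolding dn by (simp add: algebra_simps)
    qed
  next
    fix M1 I ob d
    assume *: "\<And>x. x \<in> F - T - {a, a + 1} \<Longrightarrow> M1 x = M x" "inner_holds M1 w s ca Fs Fc I"
        "I \<subseteq> inner_keys K"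
      "ob \<in> {0, 1 :: int}"
    show "run L veb_prog (F \<union> {i..<i + n} \<union> {f..<f + scr w}) (T \<union> {f..<f + scr w})
        (map_of (zip extract_params [a, int w, ob, d, f])) extract_com M1
        (\<lambda>r M' c s'. inner_holds M' w s ca Fs Fc (I - {if ob = 0 then Min I else Max I}) \<and>
           r = (if I = {} then d else if ob = 0 then Min I else Max I) \<and>
           int c \<le> (if I = {} then 50 else 3000 * int (dep w) - 1000))"
    proof (rule run_conseq[OF run_extract_com[OF w low_spec high_spec _ layout *(2) _ _ f _ *(4) refl]])
      show "links M1 w a s t ca" by (rule links_frame[OF links]) (use *(1) ptrs in blast)
      show "I \<subseteq> {0..<2 ^ w}" using *(3) ik by blast
      show "node_cells w a t Fs Fc \<subseteq> {0..<2 ^ L}" "node_cells w a t Fs Fc \<inter> {f..<f + scr w} = {}"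
        using F disj(2) by (simp_all add: Feq)
      show "node_cells w a t Fs Fc \<union> {f..<f + scr w} \<subseteq> F \<union> {i..<i + n} \<union> {f..<f + scr w}"
        "Fs \<union> (\<Union>h\<in>heads w. Fc h) \<union> {f..<f + scr w} \<subseteq> T \<union> {f..<f + scr w}"
        unfolding Feq T_def by blast+
    qed (use dn in \<open>auto split: if_splits\<close>)
  next
    show "a \<in> F" "a + 1 \<in> F" using a01 aF by blast+
    show "T \<subseteq> F - {a, a + 1}" using TF hT(1) a01 by blast
    show "inner_holds M2 w s ca Fs Fc I"
      if "inner_holds M1 w s ca Fs Fc I" "\<And>x. x \<in> T \<Longrightarrow> M2 x = M1 x" for M1 M2 I
      using inner_holds_frame[OF that(1)] that(2) unfolding T_def by blast
  qed (use i f disj inner in auto)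
  then show "deletes L w M a F K X i n f"
  proof (rule run_conseq)
    fix v M' c s'
    assume *: "?Q v M' c s'"
    have "links M' w a s t ca" by (rule links_frame[OF links]) (use * ptrs in blast)
    then have "holds M' w a F (K - X)"
      unfolding holds_node[OF w] using * h'(1) layout Feq by blast
    then show "v = (if K \<subseteq> X then 1 else 0) \<and> holds M' w a F (K - X) \<and> work_ok w n v c \<and> s' \<le> span_bd w"
      using * by blast
  qed auto
qed

lemma del_spec: "del_spec w"
proof (induction w rule: less_induct)
  case (less w)
  then show ?case using del_spec_leaf del_spec_node high_low_bits_less by (cases "w < 2") auto
qed

section \<open>From levels and widths to logarithms\<close>

lemma dep_le_log2:
  assumes "2 \<le> w"
  shows "real (dep w) \<le> 3 * log 2 (real w)" "1 \<le> log 2 (real w)"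
proof -
  have l: "1 \<le> log 2 (real w)" using assms by simp
  define k where "k = nat \<lceil>log 2 (real w)\<rceil>"
  have "real w = 2 powr (log 2 (real w))" using assms by simp
  also have "\<dots> \<le> 2 powr (real k)" unfolding k_def by (intro powr_mono) linarith+
  finally have "w \<le> 2 ^ k" by (simp add: powr_realpow flip: of_nat_le_iff)
  then have "dep w \<le> k + 1" by (rule dep_le_log)
  moreover have "real k \<le> log 2 (real w) + 1" using l unfolding k_def by linarith
  \<comment> \<open>Rounding up gives at most \<open>log 2 w + 2\<close> levels; the factor
    \<open>3\<close> absorbs the \<open>2\<close> since the logarithm is at least
    \<open>1\<close>.\<close>
  ultimately show "real (dep w) \<le> 3 * log 2 (real w)" using l by linarith
  show "1 \<le> log 2 (real w)" by (rule l)
qed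

text \<open>The summand \<open>6\<close> is the cost of the top-level call with its five literal
  arguments.\<close>

lemma work_bound:
  assumes "work_ok w n v c" "n = int m" "v \<in> {0, 1}" "m \<le> 2 ^ w" "1 \<le> m"
  shows "real (6 + c) \<le> 100000 * max 1 (real m * log 2 (real w))"
proof -
  have "int c \<le> 3000 * int (dep w) * int m + 500"
    using assms(1-3) by (auto simp: work_ok_def)
  then have "real_of_int (int c) \<le> real_of_int (3000 * int (dep w) * int m + 500)"
    by (simp only: of_int_le_iff)
  then have c: "real c \<le> 3000 * real (dep w) * real m + 500" by simp
  show ?thesis
  proof (cases "w < 2")
    case True
    \<comment> \<open>For widths \<open>0\<close> and \<open>1\<close> the logarithm gives no usable
      factor, but at most two keys exist, so the term \<open>1\<close> of the maximum carries the
      bound.\<close>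
    have "m \<le> 2" using assms(4) True power_increasing[of w 1 "2::nat"] by simp
    then have "real c \<le> 6500" using c True by (simp add: dep.simps[of w])
    then show ?thesis by simp
  next
    case False
    note l = dep_le_log2[of w]
    have m: "1 \<le> real m * log 2 (real w)" using l(2) False assms(5) mult_mono[of 1 "real m" 1 "log 2
        (real w)"] by simp
    have "real (dep w) * real m \<le> 3 * log 2 (real w) * real m" using l(1) False
        by (intro mult_right_mono) auto
    then have "real c \<le> 9000 * (real m * log 2 (real w)) + 500" using c by (simp add: algebra_simps)
    then have "real (6 + c) \<le> 100000 * (real m * log 2 (real w))" using m by simp
    then show ?thesis using m by simp
  qed
qed

lemma span_bound:
  assumes "s \<le> span_bd w"
  shows "real (6 + s) \<le> 100000 * max 1 (real w * log 2 (real w))"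
proof (cases "w < 2")
  case True
  then have "s \<le> 30000" using assms by (simp add: span_bd_def dep.simps[of w])
  then show ?thesis by simp
next
  case False
  note l = dep_le_log2[of w]
  have m: "1 \<le> real w * log 2 (real w)" using l(2) False mult_mono[of 1 "real w" 1 "log 2 (real w)"]
      by simp
  have "real w * real (dep w) \<le> real w * (3 * log 2 (real w))" using l(1) False
      by (intro mult_left_mono) auto
  moreover have "real s \<le> 30000 * (real w * real (dep w))"
    using assms False by (simp add: span_bd_def flip: of_nat_mult of_nat_le_iff)
  ultimately have "real s \<le> 90000 * (real w * log 2 (real w))" by linarith
  then have "real (6 + s) \<le> 100000 * (real w * log 2 (real w))" using m by simp
  then show ?thesis using m by simp
qed

text \<open>Transfers \<open>del_spec\<close> to the input format: the sorted list of keys is a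
  batch whose entries are their own residues. The empty batch is treated separately, because
  \<open>del_spec\<close> concerns nonempty ones; it is left immediately by the first test of
  \<open>delete_com\<close>.\<close>

lemma run_batch_delete:
  assumes veb: "is_veb t w K" "stored M t w a F" and B: "B \<subseteq> K" "m = card B"
    and arr: "array_at M b (sorted_list_of_set B)" and F: "F \<subseteq> {0..<2 ^ L}"
    and b: "0 \<le> b" "b + int m < 2 ^ L" and f: "0 \<le> f" "f + scr w < 2 ^ L"
    and disj: "F \<inter> {b..<b + int m} = {}" "F \<inter> {f..<f + scr w} = {}"
        "{b..<b + int m} \<inter> {f..<f + scr w} = {}"
  shows "run L veb_prog UNIV (F \<union> {f..<f + scr w}) Map.empty
    (Call ''batch_delete'' [Lit a, Lit (int w), Lit b, Lit (int m), Lit f]) M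
    (\<lambda>v M' c s. holds M' w a F (K - B) \<and>
       real c \<le> 100000 * max 1 (real m * log 2 (real w)) \<and> real s \<le> 100000 * max 1 (real w * log 2
           (real w)))"
proof -
  have h: "holds M w a F K" using veb unfolding holds_def by blast
  note hd = holds_header[OF h]
  have finB: "finite B" using B(1) hd(6) finite_subset by blast
  have w1: "1 \<le> (2::int) ^ w" by simp
  have wL: "(2::int) ^ w < 2 ^ L" using w1 pow_le_scr[of w] f by linarith
  have "int w < 2 ^ w" using of_nat_less_two_power by blast
  moreover have "0 \<le> a" "a < 2 ^ L" using hd(1) F by auto
  moreover have "0 \<le> scr w" by (simp add: scr_def)
  ultimately have wd: "is_word L a" "is_word L (int w)" "is_word L b" "is_word L (int m)"
      "is_word L f" "is_word L 0" "is_word L 1"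
    using wL b f w1 unfolding is_word_def by linarith+
  have body: "run L veb_prog UNIV (F \<union> {f..<f + scr w})
    (map_of (zip del_params [a, int w, b, int m, f])) delete_com M
    (\<lambda>v M' c s. holds M' w a F (K - B) \<and> real (6 + c) \<le> 100000 * max 1 (real m * log 2 (real w)) \<and>
       real (6 + s) \<le> 100000 * max 1 (real w * log 2 (real w)))" (is "run _ _ _ _ _ _ _ ?Q")
  proof (cases "m = 0")
    case True
    then have "B = {}" using B(2) finB by simp
    have mx: "3 \<le> 25000 * max 1 x" for x :: real using max.cobounded1[of 1 x] by linarith
    show ?thesis
      unfolding delete_com_def
      apply (rule run_Cond[where i=1])
      subgoal using True wd by (simp add: word_result_def)
       apply (rule run_Ret[where v=0])
      subgoal using wd by (simp add: word_result_def)
      subgoal using h \<open>B = {}\<close> by (simp add: mx)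
      apply simp
      done
  next
    case False
    have len: "length (sorted_list_of_set B) = m" using B(2) by simp
    have "batch L w M b (int (length (sorted_list_of_set B))) (set (sorted_list_of_set B))"
      using finB B(1) hd(5) wL by (intro batch_of_array[OF arr]) auto
    then have bat: "batch L w M b (int m) B" using finB len by simp
    have "B \<subseteq> {0..<2 ^ w}" using B(1) hd(5) by blast
    then have "m \<le> card {0..<2 ^ w :: int}" unfolding B(2) by (intro card_mono) auto
    then have m: "m \<le> 2 ^ w" by (simp add: nat_power_eq)
    have spec: "deletes L w M a F K B b (int m) f"
      by (rule del_spec[unfolded del_spec_def, rule_format, OF h bat B(1) _ F b f disj]) (use False
          in simp)
    show ?thesis
    proof (rule run_conseq[OF spec])
      fix v M' c s
      assume *: "v = (if K \<subseteq> B then 1 else 0) \<and> holds M' w a F (K - B) \<and> work_ok w (int m) v c \<and>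
          s \<le> span_bd w"
      then have "real (6 + c) \<le> 100000 * max 1 (real m * log 2 (real w))"
        using m False by (intro work_bound[of w "int m" v]) (auto split: if_splits)
      moreover have "real (6 + s) \<le> 100000 * max 1 (real w * log 2 (real w))" using * span_bound by blast
      ultimately show "?Q v M' c s"
        using * by simp
    qed auto
  qed
  show ?thesis
    apply (rule run_Call[OF veb_prog_procs(1), where vs="[a, int w, b, int m, f]"])
      apply simp
    subgoal using wd by (simp add: word_result_def)
    apply (rule run_conseq[OF body])
      apply (rule order_refl)
     apply (rule order_refl)
    apply simp
    done
qed

theorem theorem5p3:
  shows "\<exists>(P :: prog) (\<kappa> :: nat) (C :: real).
    \<forall>(w :: nat) (U :: int) (t :: veb) (K :: int set) (B :: int set) (m :: nat)
      (L :: nat) (M :: mem) (a :: int) (F :: int set) (b :: int) (f :: int) (batch :: int set)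
      (free :: int set).
      U = 2 ^ w \<longrightarrow> is_veb t w K \<longrightarrow> B \<subseteq> K \<longrightarrow> m = card B \<longrightarrow>
      batch = {b..<b + int m} \<longrightarrow> free = {f..<f + 2 ^ (\<kappa> * (w + 1))} \<longrightarrow>
      stored M t w a F \<longrightarrow> array_at M b (sorted_list_of_set B) \<longrightarrow>
      F \<subseteq> {0..<2 ^ L} \<longrightarrow>
      0 \<le> b \<longrightarrow> b + int m < 2 ^ L \<longrightarrow>
      0 \<le> f \<longrightarrow> f + 2 ^ (\<kappa> * (w + 1)) < 2 ^ L \<longrightarrow>
      F \<inter> batch = {} \<longrightarrow> F \<inter> free = {} \<longrightarrow> batch \<inter> free = {} \<longrightarrow>
      (\<exists>v M' A W work span t'.
         exec L P Map.empty
           (Call ''batch_delete'' [Lit a, Lit (int w), Lit b, Lit (int m), Lit f])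
           M (v, M', A, W, work, span) \<and>
         is_veb t' w (K - B) \<and> stored M' t' w a F \<and>
         (\<forall>x. x \<notin> F \<union> free \<longrightarrow> M' x = M x) \<and>
         real work \<le> C * max 1 (real m * log 2 (log 2 (real_of_int U))) \<and>
         real span \<le> C * max 1 (log 2 (real_of_int U) * log 2 (log 2 (real_of_int U))))"
proof (rule exI[of _ veb_prog], rule exI[of _ 2], rule exI[of _ 100000], intro allI impI)
  \<comment> \<open>The witness \<open>2\<close> is the factor in the exponent of
    \<open>scr\<close>, so \<open>free\<close> is precisely the scratch region of a call at width
    \<open>w\<close>; \<open>100000\<close> is the constant of
    \<open>run_batch_delete\<close>.\<close>
  fix w U t K B m L M a F b f and batch free :: "int set"
  assume *: "U = (2 :: int) ^ w" "is_veb t w K" "B \<subseteq> K" "m = card B"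
    "batch = {b..<b + int m}" "free = {f..<f + 2 ^ (2 * (w + 1))}"
    "stored M t w a F" "array_at M b (sorted_list_of_set B)" "F \<subseteq> {0..<2 ^ L}"
    "0 \<le> b" "b + int m < 2 ^ L" "0 \<le> f" "f + 2 ^ (2 * (w + 1)) < 2 ^ L"
    "F \<inter> batch = {}" "F \<inter> free = {}" "batch \<inter> free = {}"
  have U: "log 2 (real_of_int U) = real w" unfolding *(1) by (simp add: log_nat_power)
  have "run L veb_prog UNIV (F \<union> {f..<f + scr w}) Map.empty
    (Call ''batch_delete'' [Lit a, Lit (int w), Lit b, Lit (int m), Lit f]) M
    (\<lambda>v M' c s. holds M' w a F (K - B) \<and>
       real c \<le> 100000 * max 1 (real m * log 2 (real w)) \<and> real s \<le> 100000 * max 1 (real w * log 2 (real w)))"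
    using *(14-16) *(5,6) by (intro run_batch_delete[OF *(2,7,3,4,8-12)]) (use *(13) in \<open>simp_all only: scr_def\<close>)
  then show "\<exists>v M' A W work span t'.
         exec L veb_prog Map.empty
           (Call ''batch_delete'' [Lit a, Lit (int w), Lit b, Lit (int m), Lit f])
           M (v, M', A, W, work, span) \<and>
         is_veb t' w (K - B) \<and> stored M' t' w a F \<and>
         (\<forall>x. x \<notin> F \<union> free \<longrightarrow> M' x = M x) \<and>
         real work \<le> 100000 * max 1 (real m * log 2 (log 2 (real_of_int U))) \<and>
         real span \<le> 100000 * max 1 (log 2 (real_of_int U) * log 2 (log 2 (real_of_int U)))"
  proof (rule runE)
    fix v M' A W c s
    assume r: "exec L veb_prog Map.empty
           (Call ''batch_delete'' [Lit a, Lit (int w), Lit b, Lit (int m), Lit f])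
           M (v, M', A, W, c, s)" "W \<subseteq> F \<union> {f..<f + scr w}"
      "holds M' w a F (K - B) \<and>
       real c \<le> 100000 * max 1 (real m * log 2 (real w)) \<and> real s \<le> 100000 * max 1 (real w * log 2 (real w))"
      "\<And>x. x \<notin> W \<Longrightarrow> M' x = M x"
    then obtain t' where t': "is_veb t' w (K - B)" "stored M' t' w a F" unfolding holds_def by blast
    have "\<forall>x. x \<notin> F \<union> free \<longrightarrow> M' x = M x" using r(2,4) unfolding *(6) scr_def by blast
    then show ?thesis using r t' unfolding U by blast
  qed
qed

end
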